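(* Up to isomorphism, there are exactly $14$ finite stable groups, namely $$C_1,\ C_2,\ C_2\times C_2,\ C_2\times C_2\times C_2,\ C_2\times C_2\times C_2\times C_2,\ C_3,\ C_3\times C_3,\ C_4,\ C_2\times C_4,\ C_5,\ C_7,\ S_3,\ D_4,\ Q_8 .$$ That is, a finite group $G$ is stable if and only if it is isomorphic to one of these $14$ pairwise non-isomorphic groups.
   Context: Let $G$ be a finite group with identity $e$ and let $A\subseteq G$ be a non-empty subset. A non-empty subset $B\subseteq G$ is called a (right) $s$-factor of $G$ associated with $A$ if every element $x\in AB=\{ab\mid a\in A,\ b\in B\}$ can be written uniquely as $x=ab$ with $a\in A$, $b\in B$, and $B$ is maximal with respect to inclusion among subsets with this property. The upper index $|G:A|^+$ and lower index $|G:A|^-$ are the sizes of a largest and of a smallest right $s$-factor of $G$ associated with $A$, respectively. The subset $A$ is called (right) stable in $G$ if $|G:A|^+=|G:A|^-$. The group $G$ is called (right) stable if all its non-empty subsets are right stable. Notation: $C_n$ is the cyclic group of order $n$; $S_3$ is the symmetric group on three letters; $D_4$ is the dihedral group of order $8$; $Q_8$ is the quaternion group of order $8$. *)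

theory Defs
  imports "HOL-Algebra.Algebra"
begin

text \<open>
  The notions below are meant for a group \<open>G\<close>. In \<open>right_s_factor\<close>, \<open>B\<close> is maximal among the
  non-empty subsets \<open>B'\<close> of \<open>G\<close> such that every element of \<open>A B'\<close> is uniquely a product \<open>a b\<close>.
\<close>

definition unique_products :: "('a, 'b) monoid_scheme \<Rightarrow> 'a set \<Rightarrow> 'a set \<Rightarrow> bool" where
  "unique_products G A B \<longleftrightarrow>
     (\<forall>x \<in> A <#>\<^bsub>G\<^esub> B. \<exists>!(a, b). a \<in> A \<and> b \<in> B \<and> x = a \<otimes>\<^bsub>G\<^esub> b)"

definition right_s_factor :: "('a, 'b) monoid_scheme \<Rightarrow> 'a set \<Rightarrow> 'a set \<Rightarrow> bool" where
  "right_s_factor G A B \<longleftrightarrow>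
     B \<noteq> {} \<and> B \<subseteq> carrier G \<and> unique_products G A B \<and>
     (\<forall>B'. B' \<noteq> {} \<and> B' \<subseteq> carrier G \<and> unique_products G A B' \<and> B \<subseteq> B' \<longrightarrow> B' = B)"

definition upper_index :: "('a, 'b) monoid_scheme \<Rightarrow> 'a set \<Rightarrow> nat" where
  "upper_index G A = Max (card ` {B. right_s_factor G A B})"

definition lower_index :: "('a, 'b) monoid_scheme \<Rightarrow> 'a set \<Rightarrow> nat" where
  "lower_index G A = Min (card ` {B. right_s_factor G A B})"

definition right_stable_subset :: "('a, 'b) monoid_scheme \<Rightarrow> 'a set \<Rightarrow> bool" where
  "right_stable_subset G A \<longleftrightarrow> upper_index G A = lower_index G A"

definition stable_group :: "('a, 'b) monoid_scheme \<Rightarrow> bool" where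
  "stable_group G \<longleftrightarrow> (\<forall>A. A \<noteq> {} \<and> A \<subseteq> carrier G \<longrightarrow> right_stable_subset G A)"

text \<open>
  \<open>cyclic_product [n\<^sub>1, \<dots>, n\<^sub>k]\<close> is the direct product of cyclic groups of orders
  \<open>n\<^sub>1, \<dots>, n\<^sub>k\<close>. Its elements are lists, so that all these products, including the
  cyclic groups \<open>cyclic_product [n]\<close> themselves, have the same type.
\<close>

definition cyclic_product :: "nat list \<Rightarrow> int list monoid" where
  "cyclic_product ns = DirProd_list (map integer_mod_group ns)"

definition abelian_stable_list :: "int list monoid list" where
  "abelian_stable_list = map cyclic_product
     [[1], [2], [2, 2], [2, 2, 2], [2, 2, 2, 2], [3], [3, 3], [4], [2, 4], [5], [7]]"

text \<open>
  The dihedral group of order \<open>2n\<close>, for \<open>n > 0\<close>: the pair \<open>(a, s)\<close> stands for \<open>r\<^sup>a\<close> if \<open>s\<close> is false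
  and for \<open>r\<^sup>a f\<close> if \<open>s\<close> is true, where \<open>r\<close> is a rotation of order \<open>n\<close> and \<open>f\<close> a reflection,
  so that \<open>f r = r\<^sup>-\<^sup>1 f\<close>.
\<close>

definition dihedral_group :: "nat \<Rightarrow> (int \<times> bool) monoid" where
  "dihedral_group n =
     \<lparr>carrier = {0..<int n} \<times> UNIV,
      monoid.mult = (\<lambda>(a, s) (b, t). ((if s then a - b else a + b) mod int n, s \<noteq> t)),
      one = (0, False)\<rparr>"

text \<open>
  The quaternion group: the pair \<open>(\<epsilon>, u)\<close> with \<open>\<epsilon> = 1\<close> or \<open>\<epsilon> = -1\<close> stands for the
  quaternion \<open>\<epsilon> u\<close>, and \<open>quat_unit_mult u v\<close> is the product of the units \<open>u\<close> and \<open>v\<close> in this form.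
\<close>

datatype quat_unit = Q1 | Qi | Qj | Qk

fun quat_unit_mult :: "quat_unit \<Rightarrow> quat_unit \<Rightarrow> int \<times> quat_unit" where
  "quat_unit_mult Q1 v = (1, v)"
| "quat_unit_mult u Q1 = (1, u)"
| "quat_unit_mult Qi Qi = (-1, Q1)"
| "quat_unit_mult Qj Qj = (-1, Q1)"
| "quat_unit_mult Qk Qk = (-1, Q1)"
| "quat_unit_mult Qi Qj = (1, Qk)"
| "quat_unit_mult Qj Qk = (1, Qi)"
| "quat_unit_mult Qk Qi = (1, Qj)"
| "quat_unit_mult Qj Qi = (-1, Qk)"
| "quat_unit_mult Qk Qj = (-1, Qi)"
| "quat_unit_mult Qi Qk = (-1, Qj)"

definition quaternion_group :: "(int \<times> quat_unit) monoid" where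
  "quaternion_group =
     \<lparr>carrier = {1, -1} \<times> UNIV,
      monoid.mult = (\<lambda>(\<epsilon>, u) (\<delta>, v). (\<epsilon> * \<delta> * fst (quat_unit_mult u v), snd (quat_unit_mult u v))),
      one = (1, Q1)\<rparr>"

lemma group_cyclic_product: "group (cyclic_product ns)"
  unfolding cyclic_product_def by (rule DirProd_list_is_group) simp

lemma order_cyclic_product:
  assumes "0 \<notin> set ns"
  shows "order (cyclic_product ns) = prod_list ns"
  using assms
proof (induction ns)
  case Nil
  then show ?case by (simp add: cyclic_product_def DirProd_list_def order_def)
next
  case (Cons n ns)
  have "(\<lambda>(x, xs). x # xs) \<in> iso (integer_mod_group n \<times>\<times> cyclic_product ns) (cyclic_product (n # ns))"
    using DirProd_list_iso[of "integer_mod_group n"] by (simp add: cyclic_product_def)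
  then have "order (cyclic_product (n # ns)) = order (integer_mod_group n \<times>\<times> cyclic_product ns)"
    unfolding iso_def order_def using bij_betw_same_card by fastforce
  also have "\<dots> = n * order (cyclic_product ns)"
    using Cons.prems by (simp add: order_def card_cartesian_product carrier_integer_mod_group)
  finally show ?case using Cons by simp
qed

lemma order_sym_group_3: "order (sym_group 3) = 6"
  using card_permutations[of "{1..3::nat}" 3]
  by (simp add: order_def sym_group_def fact_numeral)

lemma group_dihedral_group:
  assumes "n > 0"
  shows "group (dihedral_group n)"
proof (rule groupI)
  fix x assume x: "x \<in> carrier (dihedral_group n)"
  obtain a s where as: "x = (a, s)" by (cases x)
  let ?y = "(if s then a else (- a) mod int n, s)"
  have "?y \<in> carrier (dihedral_group n)" "?y \<otimes>\<^bsub>dihedral_group n\<^esub> x = \<one>\<^bsub>dihedral_group n\<^esub>"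
    using x assms by (auto simp: as dihedral_group_def mod_simps)
  then show "\<exists>y\<in>carrier (dihedral_group n). y \<otimes>\<^bsub>dihedral_group n\<^esub> x = \<one>\<^bsub>dihedral_group n\<^esub>"
    by blast
qed (use assms in \<open>auto simp: dihedral_group_def mod_simps algebra_simps\<close>)

lemma order_dihedral_group: "order (dihedral_group n) = 2 * n"
  by (simp add: order_def dihedral_group_def card_cartesian_product)

lemma group_quaternion_group: "group quaternion_group"
proof (rule groupI)
  fix x y z assume "x \<in> carrier quaternion_group" "y \<in> carrier quaternion_group"
    "z \<in> carrier quaternion_group"
  moreover obtain a u b v c w where "x = (a, u)" "y = (b, v)" "z = (c, w)" by (metis surj_pair)
  ultimately show "x \<otimes>\<^bsub>quaternion_group\<^esub> y \<otimes>\<^bsub>quaternion_group\<^esub> z =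
      x \<otimes>\<^bsub>quaternion_group\<^esub> (y \<otimes>\<^bsub>quaternion_group\<^esub> z)"
    by (cases u; cases v; cases w) (simp_all add: quaternion_group_def)
next
  fix x assume x: "x \<in> carrier quaternion_group"
  obtain a u where au: "x = (a, u)" by (cases x)
  let ?y = "(if u = Q1 then a else - a, u)"
  have "?y \<in> carrier quaternion_group" "?y \<otimes>\<^bsub>quaternion_group\<^esub> x = \<one>\<^bsub>quaternion_group\<^esub>"
    using x by (cases u; auto simp: au quaternion_group_def)+
  then show "\<exists>y\<in>carrier quaternion_group. y \<otimes>\<^bsub>quaternion_group\<^esub> x = \<one>\<^bsub>quaternion_group\<^esub>"
    by blast
next
  fix x y assume "x \<in> carrier quaternion_group" "y \<in> carrier quaternion_group"
  moreover obtain a u b v where "x = (a, u)" "y = (b, v)" by (metis surj_pair)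
  ultimately show "x \<otimes>\<^bsub>quaternion_group\<^esub> y \<in> carrier quaternion_group"
    by (cases u; cases v) (auto simp: quaternion_group_def)
qed (auto simp: quaternion_group_def)

lemma order_quaternion_group: "order quaternion_group = 8"
proof -
  have "(UNIV :: quat_unit set) = {Q1, Qi, Qj, Qk}"
    using quat_unit.exhaust by blast
  then have "card (UNIV :: quat_unit set) = card {Q1, Qi, Qj, Qk}" by (rule arg_cong)
  then have "card (UNIV :: quat_unit set) = 4" by simp
  then show ?thesis by (simp add: order_def quaternion_group_def card_cartesian_product)
qed

end

theory Submission
  imports Defs
begin

text \<open>
  An \<open>s\<close>-factor associated with \<open>A\<close> is a maximal packing by \<open>A\<close>: a maximal set of elements \<open>b\<close> with
  disjoint translates \<open>A b\<close>. A maximal packing splits along the cosets of a subgroup containing \<open>A\<close>,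
  so stability passes to subgroups, and a small unstable group is excluded by a witness. Cyclic
  groups allow only the element orders \<open>1, 2, 3, 4, 5, 7\<close>. Normalisers growing in \<open>p\<close>-groups and Sylow
  counting then either produce one of finitely many unstable groups with a presentation
  \<open>\<langle>a, b, x\<rangle>\<close>, in which \<open>x\<close> normalises the abelian group \<open>\<langle>a, b\<rangle>\<close>, or leave a group of order \<open>6\<close> or of
  small prime power order, which is identified by its presentation. In most of the remaining groups
  every set \<open>A\<close> generates such strong restrictions that maximal packings have at most three elements.
\<close>

text \<open>Two facts carry the classification. Enlarging \<open>A\<close> only destroys separation,
  so if a set \<open>{\<one>, g, h}\<close> admits no three pairwise separated elements, every
  larger set containing it is settled as well; a pair \<open>{\<one>, g}\<close> leads to a cycle.
  This turns the stability of most listed groups into a finite check. In the other direction, no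
  element order of a stable group is divisible by two different primes. So commuting elements of
  prime order have equal order, the centralizer of an element of prime order \<open>r\<close> is an
  \<open>r\<close>-group, and an element of prime order \<open>q \<noteq> r\<close> acts without
  fixed points on every \<open>r\<close>-subgroup that it normalizes. For odd \<open>r\<close> the
  Sylow \<open>r\<close>-subgroups are abelian by the bounds on \<open>r\<close>-groups, hence meet
  trivially, and their elements can be counted. Presentations serve twice: a group satisfying the
  relations contains a copy of a concrete multiplication table, which transfers a witness of
  instability, and two groups of the right order with the same relations are isomorphic.\<close>

section \<open>Disjoint translates and packings\<close>

definition separated :: "('a, 'b) monoid_scheme \<Rightarrow> 'a set \<Rightarrow> 'a \<Rightarrow> 'a \<Rightarrow> bool" where
  "separated G A x y \<longleftrightarrow> (\<forall>a\<in>A. \<forall>a'\<in>A. a \<otimes>\<^bsub>G\<^esub> x \<noteq> a' \<otimes>\<^bsub>G\<^esub> y)"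

definition packing :: "('a, 'b) monoid_scheme \<Rightarrow> 'a set \<Rightarrow> 'a set \<Rightarrow> bool" where
  "packing G A B \<longleftrightarrow> (\<forall>b\<in>B. \<forall>b'\<in>B. b \<noteq> b' \<longrightarrow> separated G A b b')"

text \<open>The ambient set \<open>K\<close> is a parameter because packings are also compared
  inside a subgroup and inside its complement. Maximality is tested against single further elements;
  for non-empty \<open>K\<close> it already forces \<open>B\<close> to be non-empty.\<close>

definition maximal_packing :: "('a, 'b) monoid_scheme \<Rightarrow> 'a set \<Rightarrow> 'a set \<Rightarrow> 'a set \<Rightarrow> bool" where
  "maximal_packing G K A B \<longleftrightarrow>
     B \<subseteq> K \<and> packing G A B \<and> (\<forall>x\<in>K - B. \<exists>b\<in>B. \<not> separated G A x b)"

lemma separated_sym: "separated G A x y \<longleftrightarrow> separated G A y x"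
  by (auto simp: separated_def dest: sym)

lemma separated_irrefl: "A \<noteq> {} \<Longrightarrow> \<not> separated G A x x"
  by (auto simp: separated_def)

lemma separated_antimono: "A \<subseteq> A' \<Longrightarrow> separated G A' x y \<Longrightarrow> separated G A x y"
  by (auto simp: separated_def)

lemma packing_insert:
  "packing G A (insert x B) \<longleftrightarrow> packing G A B \<and> (\<forall>b\<in>B. b \<noteq> x \<longrightarrow> separated G A x b)"
  unfolding packing_def by (metis insert_iff separated_sym)

lemma packing_extends:
  assumes "finite K" "B \<subseteq> K" "packing G A B"
  obtains B' where "B \<subseteq> B'" "maximal_packing G K A B'"
proof -
  let ?F = "{B'. B \<subseteq> B' \<and> B' \<subseteq> K \<and> packing G A B'}"
  have "finite ?F"
    using assms(1) by (rule finite_subset[rotated, OF finite_Pow_iff[THEN iffD2]]) auto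
  moreover have "B \<in> ?F" using assms by auto
  ultimately obtain B' where B': "B' \<in> ?F" and max: "\<And>C. C \<in> ?F \<Longrightarrow> B' \<subseteq> C \<Longrightarrow> B' = C"
    by (metis (no_types, lifting) finite_has_maximal2)
  have "\<exists>b\<in>B'. \<not> separated G A x b" if x: "x \<in> K - B'" for x
  proof (rule ccontr)
    assume "\<not> ?thesis"
    then have "insert x B' \<in> ?F" using B' x by (auto simp: packing_insert)
    then show False using max x by blast
  qed
  then show ?thesis using that B' by (auto simp: maximal_packing_def)
qed

section \<open>Maximal packings, subgroups and translations\<close>

context group
begin

text \<open>One of the two symmetries of the problem. Right multiplication moves packings, so
  \<open>\<one> \<in> B\<close> may be assumed; left multiplication moves \<open>A\<close>, so
  \<open>\<one> \<in> A\<close> may be assumed.\<close>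

lemma separated_mult_right:
  assumes "A \<subseteq> carrier G" "x \<in> carrier G" "y \<in> carrier G" "g \<in> carrier G"
  shows "separated G A (x \<otimes> g) (y \<otimes> g) \<longleftrightarrow> separated G A x y"
  unfolding separated_def using assms
  by (intro ball_cong refl) (auto simp: m_assoc[symmetric] subset_eq)

lemma separated_mult_left_set:
  assumes "A \<subseteq> carrier G" "x \<in> carrier G" "y \<in> carrier G" "g \<in> carrier G"
  shows "separated G ((\<otimes>) g ` A) x y \<longleftrightarrow> separated G A x y"
proof -
  have "g \<otimes> a \<otimes> x = g \<otimes> a' \<otimes> y \<longleftrightarrow> a \<otimes> x = a' \<otimes> y" if "a \<in> A" "a' \<in> A" for a a'
    using assms that by (auto simp: m_assoc subset_eq)
  then show ?thesis by (auto simp: separated_def)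
qed

text \<open>For a fixed \<open>b\<close> the factor \<open>a\<close> is determined by cancellation,
  so only coincidences between different elements of \<open>B\<close> matter.\<close>

lemma unique_products_iff_packing:
  assumes "A \<subseteq> carrier G" "B \<subseteq> carrier G"
  shows "unique_products G A B \<longleftrightarrow> packing G A B"
proof
  assume u: "unique_products G A B"
  show "packing G A B"
    unfolding packing_def separated_def
  proof (intro ballI impI notI)
    fix b b' a a' assume h: "b \<in> B" "b' \<in> B" "b \<noteq> b'" "a \<in> A" "a' \<in> A" "a \<otimes> b = a' \<otimes> b'"
    then have "a \<otimes> b \<in> A <#> B" by (auto simp: set_mult_def)
    then have "\<exists>!(c, d). c \<in> A \<and> d \<in> B \<and> a \<otimes> b = c \<otimes> d" using u unfolding unique_products_def by blast
    then have "(a, b) = (a', b')" using h by (elim ex1E) (metis (mono_tags, lifting) case_prodI)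
    then show False using h by simp
  qed
next
  assume p: "packing G A B"
  show "unique_products G A B"
    unfolding unique_products_def
  proof
    fix x assume "x \<in> A <#> B"
    then obtain a b where ab: "a \<in> A" "b \<in> B" "x = a \<otimes> b" by (auto simp: set_mult_def)
    have "c = a \<and> d = b" if "c \<in> A" "d \<in> B" "x = c \<otimes> d" for c d
    proof -
      have "b = d" using p that ab unfolding packing_def separated_def by metis
      then show ?thesis using that ab assms
        by (metis in_mono right_cancel)
    qed
    then show "\<exists>!(a, b). a \<in> A \<and> b \<in> B \<and> x = a \<otimes> b"
      using ab by (intro ex1I[of _ "(a, b)"]) auto
  qed
qed

lemma right_s_factor_iff_maximal_packing:
  assumes "A \<subseteq> carrier G"
  shows "right_s_factor G A B \<longleftrightarrow> maximal_packing G (carrier G) A B"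
proof
  assume r: "right_s_factor G A B"
  then have B: "B \<noteq> {}" "B \<subseteq> carrier G" "packing G A B"
    using assms by (auto simp: right_s_factor_def unique_products_iff_packing)
  have "\<exists>b\<in>B. \<not> separated G A x b" if "x \<in> carrier G - B" for x
  proof (rule ccontr)
    assume "\<not> ?thesis"
    then have "packing G A (insert x B)" using B by (auto simp: packing_insert)
    then have "insert x B = B"
      using r that B assms unfolding right_s_factor_def
      by (metis DiffD1 insert_not_empty insert_subset subset_insertI unique_products_iff_packing)
    then show False using that by blast
  qed
  then show "maximal_packing G (carrier G) A B" using B by (simp add: maximal_packing_def)
next
  assume m: "maximal_packing G (carrier G) A B"
  then have "B \<noteq> {}" using one_closed unfolding maximal_packing_def by (metis DiffI empty_iff)
  moreover have "B' = B" if B': "B' \<subseteq> carrier G" "packing G A B'" "B \<subseteq> B'" for B'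
  proof (rule ccontr)
    assume "B' \<noteq> B"
    then obtain x where x: "x \<in> B'" "x \<notin> B" using B'(3) by blast
    then obtain b where "b \<in> B" "\<not> separated G A x b"
      using m B'(1) unfolding maximal_packing_def by blast
    moreover from this have "b \<in> B'" "b \<noteq> x" using B'(3) x by auto
    ultimately show False using B'(2) x(1) by (auto simp: packing_def)
  qed
  moreover have "B \<subseteq> carrier G" "packing G A B" using m by (simp_all add: maximal_packing_def)
  ultimately show "right_s_factor G A B"
    unfolding right_s_factor_def by (metis unique_products_iff_packing[OF assms])
qed

lemma right_stable_subset_iff:
  assumes "finite (carrier G)" "A \<subseteq> carrier G"
  shows "right_stable_subset G A \<longleftrightarrow>
    (\<forall>B B'. maximal_packing G (carrier G) A B \<longrightarrow> maximal_packing G (carrier G) A B' \<longrightarrow> card B = card B')"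
proof -
  let ?F = "card ` {B. maximal_packing G (carrier G) A B}"
  have "finite {B. maximal_packing G (carrier G) A B}"
    by (rule finite_subset[of _ "Pow (carrier G)"]) (use assms in \<open>auto simp: maximal_packing_def\<close>)
  then have fin: "finite ?F" by simp
  obtain B where "maximal_packing G (carrier G) A B"
    using packing_extends[of "carrier G" "{}"] assms(1) by (auto simp: packing_def)
  then have ne: "?F \<noteq> {}" by auto
  have "right_stable_subset G A \<longleftrightarrow> Max ?F = Min ?F"
    using assms(2) by (simp add: right_stable_subset_def upper_index_def lower_index_def
        right_s_factor_iff_maximal_packing)
  also have "\<dots> \<longleftrightarrow> (\<forall>m\<in>?F. \<forall>n\<in>?F. m = n)"
  proof
    assume "Max ?F = Min ?F"
    then show "\<forall>m\<in>?F. \<forall>n\<in>?F. m = n"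
      using fin by (metis Max_ge Min_le order_antisym)
  next
    assume "\<forall>m\<in>?F. \<forall>n\<in>?F. m = n"
    then show "Max ?F = Min ?F" using Max_in[OF fin ne] Min_in[OF fin ne] by blast
  qed
  also have "\<dots> \<longleftrightarrow> (\<forall>B B'. maximal_packing G (carrier G) A B \<longrightarrow> maximal_packing G (carrier G) A B' \<longrightarrow> card B = card B')"
    by auto
  finally show ?thesis .
qed

lemma stable_groupD:
  assumes "stable_group G" "finite (carrier G)" "A \<subseteq> carrier G" "A \<noteq> {}"
    "maximal_packing G (carrier G) A B" "maximal_packing G (carrier G) A B'"
  shows "card B = card B'"
proof -
  have "right_stable_subset G A" using assms(1,3,4) by (simp add: stable_group_def)
  then show ?thesis using right_stable_subset_iff[OF assms(2,3)] assms(5,6) by metis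
qed

text \<open>An equation \<open>a x = a' y\<close> with \<open>a\<close>, \<open>a'\<close>,
  \<open>x\<close> in \<open>K\<close> puts \<open>y\<close> into \<open>K\<close>. Different cosets
  of \<open>K\<close> therefore do not interact.\<close>

lemma separated_outside_subgroup:
  assumes "subgroup K G" "A \<subseteq> K" "x \<in> K" "y \<in> carrier G - K"
  shows "separated G A x y"
  unfolding separated_def
proof (intro ballI notI)
  fix a a' assume h: "a \<in> A" "a' \<in> A" "a \<otimes> x = a' \<otimes> y"
  interpret K: subgroup K G by fact
  have "y = inv a' \<otimes> (a \<otimes> x)"
    using h assms by (metis DiffD1 K.mem_carrier K.m_closed in_mono inv_solve_left)
  then show False using h assms by (metis DiffD2 K.m_closed K.m_inv_closed in_mono)
qed

text \<open>A maximal packing of the complement of \<open>K\<close> completes every maximal packing of \<open>K\<close>.\<close>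

lemma stable_group_subgroupD:
  assumes st: "stable_group G" "finite (carrier G)" and K: "subgroup K G" and A: "A \<subseteq> K" "A \<noteq> {}"
    and B: "maximal_packing G K A B" "maximal_packing G K A B'"
  shows "card B = card B'"
proof -
  have KG: "K \<subseteq> carrier G" using K by (rule subgroup.subset)
  obtain C where C: "maximal_packing G (carrier G - K) A C"
    using packing_extends[of "carrier G - K" "{}"] st(2) by (auto simp: packing_def)
  have sep: "separated G A x y" "separated G A y x" if "x \<in> K" "y \<in> C" for x y
  proof -
    show "separated G A x y"
      using that C separated_outside_subgroup[OF K A(1)] by (auto simp: maximal_packing_def)
    then show "separated G A y x" by (simp add: separated_sym)
  qed
  have max: "maximal_packing G (carrier G) A (D \<union> C)" and card: "card (D \<union> C) = card D + card C"
    if D: "maximal_packing G K A D" for D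
  proof -
    have "D \<subseteq> K" using D by (simp add: maximal_packing_def)
    moreover have "packing G A (D \<union> C)"
      using D C sep \<open>D \<subseteq> K\<close> unfolding packing_def maximal_packing_def
      by (metis Un_iff subsetD)
    moreover have "\<exists>b\<in>D \<union> C. \<not> separated G A x b" if "x \<in> carrier G - (D \<union> C)" for x
      using D C that unfolding maximal_packing_def by (cases "x \<in> K") (metis DiffD1 DiffD2 DiffI UnCI)+
    ultimately show "maximal_packing G (carrier G) A (D \<union> C)"
      using KG C by (auto simp: maximal_packing_def)
    show "card (D \<union> C) = card D + card C"
      using D C KG st(2) by (intro card_Un_disjoint) (auto simp: maximal_packing_def intro: finite_subset)
  qed
  have "card (B \<union> C) = card (B' \<union> C)"
    using stable_groupD[OF st] max B A KG by (meson order_trans)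
  then show ?thesis using card B by simp
qed

text \<open>A witness consists of one maximal packing and one larger packing. The larger one may
  fail to be maximal, since extending it does not decrease its size.\<close>

lemma not_stable_groupI:
  assumes "finite (carrier G)" "subgroup K G" "A \<subseteq> K" "A \<noteq> {}" "maximal_packing G K A B"
    and C: "C \<subseteq> K" "packing G A C" "card B < card C"
  shows "\<not> stable_group G"
proof
  assume st: "stable_group G"
  have "finite K" using assms(1) subgroup.subset[OF assms(2)] by (rule finite_subset[rotated])
  then obtain C' where C': "C \<subseteq> C'" "maximal_packing G K A C'"
    using packing_extends[OF _ C(1,2)] by blast
  have "finite C'" using C' \<open>finite K\<close> by (auto simp: maximal_packing_def intro: finite_subset)
  then have "card C \<le> card C'" using C' by (simp add: card_mono)
  then show False using stable_group_subgroupD[OF st assms(1-5) C'(2)] C(3) by simp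
qed

lemma maximal_packing_translate:
  assumes K: "subgroup K G" "A \<subseteq> K" "maximal_packing G K A B" "g \<in> K"
  shows "maximal_packing G K A ((\<lambda>x. x \<otimes> g) ` B)"
proof -
  interpret K: subgroup K G by fact
  have A: "A \<subseteq> carrier G" using K.subset assms by blast
  have BK: "B \<subseteq> K" using assms by (simp add: maximal_packing_def)
  have sep: "separated G A (x \<otimes> g) (y \<otimes> g) \<longleftrightarrow> separated G A x y" if "x \<in> K" "y \<in> K" for x y
    using that assms A K.subset by (intro separated_mult_right) auto
  have "\<exists>b\<in>(\<lambda>x. x \<otimes> g) ` B. \<not> separated G A x b" if x: "x \<in> K - (\<lambda>x. x \<otimes> g) ` B" for x
  proof -
    have e: "x \<otimes> inv g \<otimes> g = x" using x K assms by (simp add: m_assoc)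
    then have "x \<otimes> inv g \<in> K - B"
      using x assms by (metis Diff_iff K.m_closed K.m_inv_closed image_eqI)
    then obtain b where "b \<in> B" "\<not> separated G A (x \<otimes> inv g) b"
      using assms unfolding maximal_packing_def by blast
    then have "\<not> separated G A x (b \<otimes> g)"
      using sep[of "x \<otimes> inv g" b] \<open>x \<otimes> inv g \<in> K - B\<close> BK e by auto
    then show ?thesis using \<open>b \<in> B\<close> by blast
  qed
  moreover have "packing G A ((\<lambda>x. x \<otimes> g) ` B)"
    using assms BK sep unfolding packing_def maximal_packing_def
    by (auto simp: subset_eq)
  ultimately show ?thesis using BK assms by (auto simp: maximal_packing_def)
qed

lemma maximal_packing_card_wlog_one:
  assumes "subgroup K G" "A \<subseteq> K"
    and one: "\<And>B. maximal_packing G K A B \<Longrightarrow> \<one> \<in> B \<Longrightarrow> card B = k"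
    and B: "maximal_packing G K A B"
  shows "card B = k"
proof -
  interpret K: subgroup K G by fact
  obtain b where b: "b \<in> B" using B K.one_closed unfolding maximal_packing_def by blast
  have BK: "B \<subseteq> K" using B by (simp add: maximal_packing_def)
  let ?B = "(\<lambda>x. x \<otimes> inv b) ` B"
  have "maximal_packing G K A ?B" using maximal_packing_translate b BK B assms by blast
  moreover have "\<one> \<in> ?B" using b BK by (force intro: image_eqI[of _ _ b])
  moreover have "card ?B = card B"
    using BK b by (intro card_image inj_onI) (auto simp: subset_eq)
  ultimately show ?thesis using one by metis
qed

text \<open>A converse to the passage to subgroups. A maximal packing of \<open>G\<close> meets each
  coset \<open>K r\<close> in the translate by \<open>r\<close> of a maximal packing of
  \<open>K\<close>, so its size is \<open>k\<close> times the index of \<open>K\<close>.\<close>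

lemma right_stable_subset_if_stable_in_subgroup:
  assumes fin: "finite (carrier G)" and K: "subgroup K G" "A \<subseteq> K" "A \<noteq> {}"
    and k: "\<And>B. maximal_packing G K A B \<Longrightarrow> card B = k"
  shows "right_stable_subset G A"
proof -
  interpret K: subgroup K G by fact
  have A: "A \<subseteq> carrier G" using K K.subset by blast
  have "card B = k * card (rcosets K)" if B: "maximal_packing G (carrier G) A B" for B
  proof -
    have BG: "B \<subseteq> carrier G" using B by (simp add: maximal_packing_def)
    have "card (B \<inter> C) = k" if C: "C \<in> rcosets K" for C
    proof -
      obtain r where r: "r \<in> carrier G" "C = K #> r" using C by (auto simp: RCOSETS_def)
      let ?D = "{x \<in> K. x \<otimes> r \<in> B}"
      have im: "(\<lambda>x. x \<otimes> r) ` ?D = B \<inter> C" using r by (auto simp: r_coset_def)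
      have sep: "separated G A (x \<otimes> r) (y \<otimes> r) \<longleftrightarrow> separated G A x y" if "x \<in> carrier G" "y \<in> carrier G" for x y
        using that A r by (intro separated_mult_right) auto
      have "maximal_packing G K A ?D"
        unfolding maximal_packing_def
      proof (intro conjI ballI)
        show "packing G A ?D"
          unfolding packing_def
        proof (intro ballI impI)
          fix x y assume "x \<in> ?D" "y \<in> ?D" "x \<noteq> y"
          then have "separated G A (x \<otimes> r) (y \<otimes> r)"
            using B r unfolding maximal_packing_def packing_def by (auto simp: K.mem_carrier)
          then show "separated G A x y" using sep \<open>x \<in> ?D\<close> \<open>y \<in> ?D\<close> K.mem_carrier by auto
        qed
      next
        fix x assume x: "x \<in> K - ?D"
        then have "x \<otimes> r \<in> carrier G - B" using r by auto
        then obtain b where b: "b \<in> B" "\<not> separated G A (x \<otimes> r) b"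
          using B unfolding maximal_packing_def by blast
        let ?y = "b \<otimes> inv r"
        have yr: "?y \<otimes> r = b" "?y \<in> carrier G" using b BG r by (auto simp: m_assoc)
        then have ns: "\<not> separated G A x ?y" using sep[of x ?y] x b by auto
        then have "?y \<in> K"
          using separated_outside_subgroup[OF K(1,2), of x ?y] x yr by blast
        then show "\<exists>b\<in>?D. \<not> separated G A x b" using ns yr b by auto
      qed auto
      then have "card ?D = k" by (rule k)
      moreover have "inj_on (\<lambda>x. x \<otimes> r) ?D" using r by (intro inj_onI) (auto simp: K.mem_carrier)
      ultimately show ?thesis using im card_image by metis
    qed
    then have sum: "(\<Sum>C\<in>rcosets K. card (B \<inter> C)) = k * card (rcosets K)" by simp
    have "B = (\<Union>C\<in>rcosets K. B \<inter> C)"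
      using BG rcosets_part_G[OF K(1)] by blast
    then have "card B = card (\<Union>C\<in>rcosets K. B \<inter> C)" by (rule arg_cong)
    also have "\<dots> = (\<Sum>C\<in>rcosets K. card (B \<inter> C))"
    proof (rule card_UN_disjoint)
      show "finite (rcosets K)"
        using rcosets_part_G[OF K(1)] fin by (metis finite_UnionD)
      show "\<forall>C\<in>rcosets K. finite (B \<inter> C)" using BG fin by (meson finite_Int finite_subset)
      show "\<forall>C\<in>rcosets K. \<forall>D\<in>rcosets K. C \<noteq> D \<longrightarrow> B \<inter> C \<inter> (B \<inter> D) = {}"
        using rcos_disjoint[OF K(1)] by (auto simp: disjoint_def pairwise_def disjnt_def)
    qed
    finally show ?thesis using sum by simp
  qed
  then show ?thesis by (simp add: right_stable_subset_iff[OF fin A])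
qed

text \<open>Packings are the cliques of the graph on \<open>K\<close> whose edges are the separated
  pairs, and right translations act transitively on its vertices. Without a triangle at
  \<open>\<one>\<close> the maximal cliques are all edges or all single vertices.\<close>

lemma maximal_packing_card_le_2:
  assumes K: "subgroup K G" "A \<subseteq> K" "A \<noteq> {}"
    and no: "\<And>t u. \<lbrakk>t \<in> K; u \<in> K; separated G A \<one> t; separated G A \<one> u\<rbrakk> \<Longrightarrow> \<not> separated G A t u"
    and B: "maximal_packing G K A B"
  shows "card B = (if \<exists>t\<in>K. separated G A \<one> t then 2 else 1)"
proof -
  have one: "card B = (if \<exists>t\<in>K. separated G A \<one> t then 2 else 1)" if B: "maximal_packing G K A B" "\<one> \<in> B" for B
  proof -
  have BK: "B \<subseteq> K" using B by (simp add: maximal_packing_def)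
  have sep: "separated G A x y" if "x \<in> B" "y \<in> B" "x \<noteq> y" for x y
    using B that by (auto simp: maximal_packing_def packing_def)
  show ?thesis
  proof (cases "B = {\<one>}")
    case True
    then have "\<not> separated G A \<one> t" if "t \<in> K" for t
      using B that K(3) separated_irrefl unfolding maximal_packing_def
      by (metis DiffI separated_sym singletonD)
    then show ?thesis using True by auto
  next
    case False
    then obtain t where t: "t \<in> B" "t \<noteq> \<one>" using B by blast
    have "u = t" if "u \<in> B" "u \<noteq> \<one>" for u
      using no[of t u] that t sep BK B(2) by blast
    then have "B = {\<one>, t}" using t B by blast
    then show ?thesis using t sep[of \<one> t] B BK by auto
  qed
  qed
  from maximal_packing_card_wlog_one[OF K(1,2) this B] show ?thesis .
qed

text \<open>In the same graph: if there are edges, every edge lies in a triangle, and there is no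
  complete subgraph on four vertices, then every maximal clique is a triangle.\<close>

lemma maximal_packing_card_eq_3:
  assumes K: "subgroup K G" "A \<subseteq> K" "A \<noteq> {}"
    and ex: "\<exists>t\<in>K. separated G A \<one> t"
    and ext: "\<And>t. \<lbrakk>t \<in> K; separated G A \<one> t\<rbrakk> \<Longrightarrow> \<exists>u\<in>K. separated G A \<one> u \<and> separated G A t u"
    and no: "\<And>t u v. \<lbrakk>t \<in> K; u \<in> K; v \<in> K; separated G A \<one> t; separated G A \<one> u; separated G A \<one> v;
        separated G A t u; separated G A t v\<rbrakk> \<Longrightarrow> \<not> separated G A u v"
    and B: "maximal_packing G K A B"
  shows "card B = 3"
proof -
  have one: "card B = 3" if B: "maximal_packing G K A B" "\<one> \<in> B" for B
  proof -
  have BK: "B \<subseteq> K" using B by (simp add: maximal_packing_def)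
  have irr: "separated G A x y \<Longrightarrow> x \<noteq> y" for x y using separated_irrefl[OF K(3)] by metis
  have sep: "separated G A x y" if "x \<in> B" "y \<in> B" "x \<noteq> y" for x y
    using B that by (auto simp: maximal_packing_def packing_def)
  have blocked: "\<exists>b\<in>B. \<not> separated G A b x" if "x \<in> K" "x \<notin> B" for x
    using B that unfolding maximal_packing_def by (metis DiffI separated_sym)
  obtain t where t: "t \<in> B" "t \<noteq> \<one>"
    using ex blocked irr B(2) by metis
  obtain u0 where u0: "u0 \<in> K" "separated G A \<one> u0" "separated G A t u0"
    using ext[of t] t sep[of \<one> t] B BK by blast
  obtain u where u: "u \<in> B" "u \<noteq> \<one>" "u \<noteq> t"
  proof (cases "u0 \<in> B")
    case True
    then show ?thesis using that u0 irr by blast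
  next
    case False
    then show ?thesis using blocked[OF u0(1)] u0 that by metis
  qed
  have "v = t \<or> v = u" if "v \<in> B" "v \<noteq> \<one>" for v
    using no[of t u v] that t u sep BK B(2) by blast
  then have "B = {\<one>, t, u}" using t u B by blast
  then show ?thesis using t u by simp
  qed
  from maximal_packing_card_wlog_one[OF K(1,2) this B] show ?thesis .
qed

end

text \<open>Monomorphisms cover both restriction to a subgroup and transport along an isomorphism,
  and they fit the embeddings of multiplication tables used later.\<close>

lemma stable_group_mon:
  assumes "group G" "group H" "finite (carrier G)" "stable_group G"
    and f: "f \<in> hom H G" "inj_on f (carrier H)"
  shows "stable_group H"
proof -
  interpret G: group G by fact
  interpret H: group H by fact
  interpret group_hom H G f using f by unfold_locales
  have finH: "finite (carrier H)" using f assms(3) by (metis finite_imageD finite_subset hom_carrier)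
  have K: "subgroup (f ` carrier H) G" by (rule img_is_subgroup)
  have "card B = card B'"
    if A: "A \<noteq> {}" "A \<subseteq> carrier H"
      and B: "maximal_packing H (carrier H) A B" "maximal_packing H (carrier H) A B'" for A B B'
  proof -
    have sep: "separated G (f ` A) (f x) (f y) \<longleftrightarrow> separated H A x y"
      if "x \<in> carrier H" "y \<in> carrier H" for x y
    proof -
      have "f a \<otimes>\<^bsub>G\<^esub> f x = f a' \<otimes>\<^bsub>G\<^esub> f y \<longleftrightarrow> a \<otimes>\<^bsub>H\<^esub> x = a' \<otimes>\<^bsub>H\<^esub> y" if "a \<in> A" "a' \<in> A" for a a'
        using that A \<open>x \<in> carrier H\<close> \<open>y \<in> carrier H\<close> f(2)
        by (metis H.m_closed hom_mult inj_on_eq_iff subsetD)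
      then show ?thesis by (auto simp: separated_def)
    qed
    have max: "maximal_packing G (f ` carrier H) (f ` A) (f ` D)"
      if D: "maximal_packing H (carrier H) A D" for D
    proof -
      have DH: "D \<subseteq> carrier H" using D by (simp add: maximal_packing_def)
      then have "packing G (f ` A) (f ` D)"
        using D sep unfolding maximal_packing_def packing_def by (auto simp: subset_eq)
      moreover have "\<exists>b\<in>f ` D. \<not> separated G (f ` A) x b" if x: "x \<in> f ` carrier H - f ` D" for x
      proof -
        obtain x' where x': "x' \<in> carrier H - D" "x = f x'" using x by blast
        then obtain b where "b \<in> D" "\<not> separated H A x' b"
          using D unfolding maximal_packing_def by blast
        then show ?thesis using x' DH sep[of x' b] by blast
      qed
      ultimately show ?thesis using DH by (auto simp: maximal_packing_def)
    qed
    have "card (f ` B) = card (f ` B')"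
      by (rule G.stable_group_subgroupD[OF assms(4,3) K _ _ max[OF B(1)] max[OF B(2)]]) (use A in auto)
    moreover have "inj_on f B" "inj_on f B'"
      using f(2) B by (auto simp: maximal_packing_def intro: inj_on_subset)
    ultimately show ?thesis by (simp add: card_image)
  qed
  then show ?thesis using finH by (auto simp: stable_group_def H.right_stable_subset_iff)
qed

lemma stable_group_subgroup:
  assumes "group G" "finite (carrier G)" "stable_group G" "subgroup K G"
  shows "stable_group (G\<lparr>carrier := K\<rparr>)"
proof (rule stable_group_mon[OF assms(1) _ assms(2,3), where f = id])
  show "group (G\<lparr>carrier := K\<rparr>)" using assms by (simp add: group.subgroup_imp_group)
  show "id \<in> hom (G\<lparr>carrier := K\<rparr>) G" using assms(4) by (auto simp: hom_def subgroup.mem_carrier)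
qed auto

lemma stable_group_iso:
  assumes "group G" "group H" "finite (carrier G)" "stable_group G" "G \<cong> H"
  shows "stable_group H"
proof -
  obtain f where "f \<in> iso H G" using assms group.iso_sym unfolding is_iso_def by blast
  then show ?thesis using assms stable_group_mon[of G H f] by (auto simp: iso_def bij_betw_def)
qed

section \<open>Pairs and the element orders of a stable group\<close>

text \<open>For \<open>A = {\<one>, g}\<close> with \<open>g\<close> of order \<open>n\<close>, the
  translates of \<open>g^i\<close> and \<open>g^j\<close> are disjoint iff \<open>i\<close> and
  \<open>j\<close> are distinct and non-adjacent on the cycle of length \<open>n\<close>. Packings
  inside the group generated by \<open>g\<close> are thus the independent sets of this
  cycle.\<close>

definition cycle_separated :: "nat \<Rightarrow> nat \<Rightarrow> nat \<Rightarrow> bool" where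
  "cycle_separated n i j \<longleftrightarrow>
     i \<noteq> j \<and> Suc i \<noteq> j \<and> Suc j \<noteq> i \<and> \<not> (i = 0 \<and> Suc j = n) \<and> \<not> (j = 0 \<and> Suc i = n)"

context group
begin

lemma pow_eq_pow_iff:
  assumes "finite (carrier G)" "x \<in> carrier G"
  shows "x [^] (i::nat) = x [^] (j::nat) \<longleftrightarrow> i mod ord x = j mod ord x"
proof -
  have "x [^] i = x [^] j \<longleftrightarrow> x [^] int i = x [^] int j" by (simp add: int_pow_int)
  also have "\<dots> \<longleftrightarrow> int (ord x) dvd int j - int i" by (rule int_pow_eq[OF assms(2)])
  also have "\<dots> \<longleftrightarrow> i mod ord x = j mod ord x"
    by (metis mod_eq_dvd_iff of_nat_eq_iff of_nat_mod)
  finally show ?thesis .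
qed

lemma generate_singleton_eq:
  assumes "finite (carrier G)" "g \<in> carrier G"
  shows "generate G {g} = (\<lambda>i::nat. g [^] i) ` {..<ord g}"
proof -
  have "g [^] (k::nat) = g [^] (k mod ord g)" for k
    by (simp add: pow_eq_pow_iff[OF assms])
  moreover have "k mod ord g < ord g" for k :: nat
    using ord_ge_1[OF assms] by simp
  ultimately show ?thesis
    using generate_pow_on_finite_carrier[OF assms] by (auto simp: image_iff)
qed

lemma separated_pow:
  assumes "finite (carrier G)" "g \<in> carrier G" "i < ord g" "j < ord g"
  shows "separated G {\<one>, g} (g [^] i) (g [^] j) \<longleftrightarrow> cycle_separated (ord g) i j"
proof -
  let ?s = "\<lambda>k. if Suc k = ord g then 0 else Suc k"
  have suc: "g \<otimes> g [^] k = g [^] ?s k" if "k < ord g" for k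
  proof -
    have "g \<otimes> g [^] k = g [^] Suc k" using assms(2) by (rule nat_pow_Suc2[symmetric])
    then show ?thesis using assms(2) by (cases "Suc k = ord g") (simp_all del: nat_pow_Suc)
  qed
  have eq: "g [^] k = g [^] k' \<longleftrightarrow> k = k'" if "k < ord g" "k' < ord g" for k k'
    using that by (simp add: pow_eq_pow_iff[OF assms(1,2)])
  have lt: "?s i < ord g" "?s j < ord g" using assms(3,4) by auto
  have "separated G {\<one>, g} (g [^] i) (g [^] j) \<longleftrightarrow> i \<noteq> j \<and> i \<noteq> ?s j \<and> ?s i \<noteq> j \<and> ?s i \<noteq> ?s j"
    using assms(2) by (simp add: separated_def suc[OF assms(3)] suc[OF assms(4)] eq[OF assms(3,4)]
        eq[OF assms(3) lt(2)] eq[OF lt(1) assms(4)] eq[OF lt] del: nat_pow_Suc split del: if_split)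
  also have "\<dots> \<longleftrightarrow> cycle_separated (ord g) i j"
    using assms(3,4) by (auto simp: cycle_separated_def)
  finally show ?thesis .
qed

lemma inj_on_pow:
  assumes "finite (carrier G)" "g \<in> carrier G"
  shows "inj_on (\<lambda>i::nat. g [^] i) {..<ord g}"
  by (auto simp: inj_on_def pow_eq_pow_iff[OF assms])

lemma packing_pow:
  assumes "finite (carrier G)" "g \<in> carrier G" "I \<subseteq> {..<ord g}"
    and "\<And>i j. i \<in> I \<Longrightarrow> j \<in> I \<Longrightarrow> i \<noteq> j \<Longrightarrow> cycle_separated (ord g) i j"
  shows "packing G {\<one>, g} ((\<lambda>i. g [^] i) ` I)"
  unfolding packing_def
proof (intro ballI impI)
  fix x y assume "x \<in> (\<lambda>i. g [^] i) ` I" "y \<in> (\<lambda>i. g [^] i) ` I" "x \<noteq> y"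
  then obtain i j where "i \<in> I" "j \<in> I" "x = g [^] i" "y = g [^] j" "i \<noteq> j" by auto
  then show "separated G {\<one>, g} x y" using assms separated_pow[OF assms(1,2), of i j] by auto
qed

lemma not_stable_if_cycle:
  assumes fin: "finite (carrier G)" and g: "g \<in> carrier G"
    and I: "I \<subseteq> {..<ord g}" "\<And>i j. i \<in> I \<Longrightarrow> j \<in> I \<Longrightarrow> i \<noteq> j \<Longrightarrow> cycle_separated (ord g) i j"
      "\<And>x. x < ord g \<Longrightarrow> x \<notin> I \<Longrightarrow> \<exists>i\<in>I. \<not> cycle_separated (ord g) x i"
    and J: "J \<subseteq> {..<ord g}" "\<And>i j. i \<in> J \<Longrightarrow> j \<in> J \<Longrightarrow> i \<noteq> j \<Longrightarrow> cycle_separated (ord g) i j"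
    and card: "card I < card J"
  shows "\<not> stable_group G"
proof (rule not_stable_groupI[OF fin])
  let ?f = "\<lambda>i::nat. g [^] i"
  note gen = generate_singleton_eq[OF fin g] and inj = inj_on_pow[OF fin g]
  show "subgroup (generate G {g}) G" using g by (simp add: generate_is_subgroup)
  show "{\<one>, g} \<subseteq> generate G {g}" by (auto intro: generate.intros)
  show "maximal_packing G (generate G {g}) {\<one>, g} (?f ` I)"
    unfolding maximal_packing_def
  proof (intro conjI ballI)
    show "?f ` I \<subseteq> generate G {g}" using I(1) gen by auto
    show "packing G {\<one>, g} (?f ` I)" by (rule packing_pow[OF fin g I(1,2)])
    fix x assume "x \<in> generate G {g} - ?f ` I"
    then obtain k where k: "k < ord g" "k \<notin> I" "x = g [^] k" using gen by auto
    then obtain i where "i \<in> I" "\<not> cycle_separated (ord g) k i" using I(3) by blast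
    then show "\<exists>b\<in>?f ` I. \<not> separated G {\<one>, g} x b"
      using k I(1) separated_pow[OF fin g, of k i] by (intro bexI[of _ "g [^] i"]) auto
  qed
  show "?f ` J \<subseteq> generate G {g}" using J(1) gen by auto
  show "packing G {\<one>, g} (?f ` J)" by (rule packing_pow[OF fin g J])
  have "card (?f ` I) = card I" "card (?f ` J) = card J"
    using inj I(1) J(1) by (auto intro!: card_image intro: inj_on_subset)
  then show "card (?f ` I) < card (?f ` J)" using card by simp
qed simp

text \<open>In a cycle of length \<open>n\<close> the gaps of a maximal packing are \<open>2\<close> or \<open>3\<close>, so three gaps \<open>3\<close> can
  be traded for four gaps \<open>2\<close> (with a wrap-around gap \<open>3\<close> when \<open>n\<close> is odd).\<close>

lemma not_stable_if_long_cycle: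
  assumes fin: "finite (carrier G)" and g: "g \<in> carrier G"
    and n: "ord g = 6 \<or> ord g \<ge> 8"
  shows "\<not> stable_group G"
proof (cases "even (ord g)")
  case True
  then obtain m where m: "ord g = 2 * m" by blast
  have "card ({0, 3} \<union> (\<lambda>i. 2 * i) ` {3..<m}) \<le> card {0, 3::nat} + card ((\<lambda>i. 2 * i) ` {3..<m})"
    by (rule card_Un_le)
  also have "card ((\<lambda>i::nat. 2 * i) ` {3..<m}) = m - 3" by (subst card_image) (auto simp: inj_on_def)
  finally have card1: "card ({0, 3} \<union> (\<lambda>i. 2 * i) ` {3..<m}) \<le> 2 + (m - 3)" by simp
  have card2: "card ((\<lambda>i::nat. 2 * i) ` {..<m}) = m" by (subst card_image) (auto simp: inj_on_def)
  \<comment> \<open>The small packing has the gaps 3, 3 and then only gaps 2, hence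
    \<open>m - 1\<close> elements; the even exponents form a packing with \<open>m\<close> elements.
    For order 6 only the two gaps 3 remain.\<close>
  show ?thesis
  proof (rule not_stable_if_cycle[OF fin g, of "{0, 3} \<union> (\<lambda>i. 2 * i) ` {3..<m}" "(\<lambda>i. 2 * i) ` {..<m}"])
    fix x assume x: "x < ord g" "x \<notin> {0, 3} \<union> (\<lambda>i. 2 * i) ` {3..<m}"
    have "x = 1 \<or> x = 2 \<or> x = 4 \<or> x = 5 \<or> x \<ge> 6" using x by auto
    moreover have "\<exists>i\<in>{0, 3} \<union> (\<lambda>i. 2 * i) ` {3..<m}. \<not> cycle_separated (ord g) x i" if "x \<ge> 6"
    proof -
      have "odd x"
      proof
        assume "even x"
        then obtain i where "x = 2 * i" by blast
        then show False using x that m by auto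
      qed
      then obtain i where "x = 2 * i + 1" by (rule oddE)
      then show ?thesis using x that m
        by (intro bexI[of _ "2 * i"]) (auto simp: cycle_separated_def)
    qed
    ultimately show "\<exists>i\<in>{0, 3} \<union> (\<lambda>i. 2 * i) ` {3..<m}. \<not> cycle_separated (ord g) x i"
    proof (elim disjE)
      assume "x = 5"
      then show ?thesis using n m by (cases "m = 3") (auto simp: cycle_separated_def)
    qed (auto simp: cycle_separated_def)
  next
    show "card ({0, 3} \<union> (\<lambda>i. 2 * i) ` {3..<m}) < card ((\<lambda>i. 2 * i) ` {..<m})"
      using card1 card2 n m by linarith
  qed (use n m in \<open>auto simp: cycle_separated_def, presburger+\<close>)
next
  case False
  then obtain m where m: "ord g = 2 * m + 1" by (rule oddE)
  then have "m \<ge> 4" using n by presburger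
  have "card ({0, 3, 6} \<union> (\<lambda>i. 2 * i + 1) ` {4..<m}) \<le> card {0, 3, 6::nat} + card ((\<lambda>i. 2 * i + 1) ` {4..<m})"
    by (rule card_Un_le)
  also have "card ((\<lambda>i::nat. 2 * i + 1) ` {4..<m}) = m - 4" by (subst card_image) (auto simp: inj_on_def)
  finally have card1: "card ({0, 3, 6} \<union> (\<lambda>i. 2 * i + 1) ` {4..<m}) \<le> 3 + (m - 4)" by simp
  have card2: "card ((\<lambda>i::nat. 2 * i) ` {..<m}) = m" by (subst card_image) (auto simp: inj_on_def)
  \<comment> \<open>Here the gaps are 3, 3, 3 and then 2, which gives \<open>m - 1\<close> elements;
    the larger packing of \<open>m\<close> elements has gaps 2 and one final gap 3. Three gaps 3 fit
    only from order 9 on, so order 7 survives.\<close>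
  show ?thesis
  proof (rule not_stable_if_cycle[OF fin g, of "{0, 3, 6} \<union> (\<lambda>i. 2 * i + 1) ` {4..<m}" "(\<lambda>i. 2 * i) ` {..<m}"])
    fix x assume x: "x < ord g" "x \<notin> {0, 3, 6} \<union> (\<lambda>i. 2 * i + 1) ` {4..<m}"
    have "x = 1 \<or> x = 2 \<or> x = 4 \<or> x = 5 \<or> x = 7 \<or> x = 8 \<or> x \<ge> 9" using x by auto
    moreover have "\<exists>i\<in>{0, 3, 6} \<union> (\<lambda>i. 2 * i + 1) ` {4..<m}. \<not> cycle_separated (ord g) x i" if "x \<ge> 9"
    proof -
      have "even x"
      proof (rule ccontr)
        assume "odd x"
        then obtain i where "x = 2 * i + 1" by (rule oddE)
        then show False using x that m by auto
      qed
      then have "x = 2 * ((x - 2) div 2) + 2" using that by presburger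
      then obtain i where i: "x = 2 * i + 2" by blast
      then have "2 * i + 1 \<in> (\<lambda>i. 2 * i + 1) ` {4..<m}" using x that m by auto
      then show ?thesis using i by (intro bexI[of _ "2 * i + 1"]) (auto simp: cycle_separated_def)
    qed
    ultimately show "\<exists>i\<in>{0, 3, 6} \<union> (\<lambda>i. 2 * i + 1) ` {4..<m}. \<not> cycle_separated (ord g) x i"
    proof (elim disjE)
      assume "x = 8"
      then show ?thesis using n m x by (cases "m = 4") (auto simp: cycle_separated_def)
    qed (auto simp: cycle_separated_def)
  next
    show "card ({0, 3, 6} \<union> (\<lambda>i. 2 * i + 1) ` {4..<m}) < card ((\<lambda>i. 2 * i) ` {..<m})"
      using card1 card2 \<open>m \<ge> 4\<close> by linarith
  qed (use \<open>m \<ge> 4\<close> m in \<open>auto simp: cycle_separated_def, presburger+\<close>)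
qed

text \<open>For \<open>n \<ge> 2\<close> these are the lengths whose decompositions into parts 2 and
  3 all have equally many parts. The first failures are 6 = 2 + 2 + 2 = 3 + 3 and 8 = 2 + 2 + 2 + 2
  = 3 + 3 + 2.\<close>

lemma stable_group_ord:
  assumes "stable_group G" "finite (carrier G)" "g \<in> carrier G"
  shows "ord g \<in> {1, 2, 3, 4, 5, 7}"
proof -
  have "ord g \<noteq> 6" "\<not> ord g \<ge> 8" "ord g \<ge> 1"
    using not_stable_if_long_cycle[OF assms(2,3)] assms(1) ord_ge_1[OF assms(2,3)] by auto
  then have "ord g = 1 \<or> ord g = 2 \<or> ord g = 3 \<or> ord g = 4 \<or> ord g = 5 \<or> ord g = 7" by presburger
  then show ?thesis by auto
qed

text \<open>Three pairwise non-adjacent vertices need a cycle of length at least 6.\<close>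

lemma cycle_separated_triangle_free:
  assumes "n \<in> {1, 2, 3, 4, 5}" "i < n" "j < n" "cycle_separated n 0 i" "cycle_separated n 0 j"
  shows "\<not> cycle_separated n i j"
  using assms unfolding cycle_separated_def by (elim insertE emptyE; hypsubst; presburger)

text \<open>On the cycle of length 7 the gaps of a maximal packing are 2, 2 and 3. The vertices not
  adjacent to 0 are 2 to 5; for \<open>i \<le> 3\<close> the vertex 5 is still free, otherwise 2
  is.\<close>

lemma cycle_separated_7_extends:
  assumes "i < 7" "cycle_separated 7 0 i"
  shows "\<exists>j<7. cycle_separated 7 0 j \<and> cycle_separated 7 i j"
  using assms unfolding cycle_separated_def
  by (intro exI[of _ "if i \<le> 3 then 5 else 2"]) (auto split: if_splits)

lemma cycle_separated_7_no_K4: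
  assumes "i < 7" "j < 7" "k < 7" "cycle_separated 7 0 i" "cycle_separated 7 0 j" "cycle_separated 7 0 k"
    "cycle_separated 7 i j" "cycle_separated 7 i k"
  shows "\<not> cycle_separated 7 j k"
  using assms unfolding cycle_separated_def by presburger

lemma right_stable_subset_pair:
  assumes fin: "finite (carrier G)" and g: "g \<in> carrier G" and n: "ord g \<in> {1, 2, 3, 4, 5, 7}"
  shows "right_stable_subset G {\<one>, g}"
proof -
  let ?K = "generate G {g}" and ?A = "{\<one>, g}"
  have K: "subgroup ?K G" "?A \<subseteq> ?K" "?A \<noteq> {}"
    using g by (auto simp: generate_is_subgroup intro: generate.intros)
  note gen = generate_singleton_eq[OF fin g]
  have sep: "separated G ?A (g [^] i) (g [^] j) \<longleftrightarrow> cycle_separated (ord g) i j"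
    if "i < ord g" "j < ord g" for i j :: nat using separated_pow[OF fin g that] .
  have sep1: "separated G ?A \<one> (g [^] j) \<longleftrightarrow> cycle_separated (ord g) 0 j"
    if "j < ord g" for j :: nat using sep[of 0 j] that by simp
  have "\<exists>k. \<forall>B. maximal_packing G ?K ?A B \<longrightarrow> card B = k"
  proof (cases "ord g = 7")
    case True
    have "\<forall>B. maximal_packing G ?K ?A B \<longrightarrow> card B = 3"
    proof (intro allI impI, rule maximal_packing_card_eq_3[OF K])
      show "\<exists>t\<in>?K. separated G ?A \<one> t"
        using sep1[of 2] True gen by (intro bexI[of _ "g [^] (2::nat)"]) (auto simp: cycle_separated_def)
    next
      fix t assume "t \<in> ?K" "separated G ?A \<one> t"
      then obtain i where i: "i < 7" "t = g [^] i" "cycle_separated 7 0 i" using gen sep1 True by auto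
      then obtain j where "j < 7" "cycle_separated 7 0 j" "cycle_separated 7 i j"
        using cycle_separated_7_extends by blast
      then show "\<exists>u\<in>?K. separated G ?A \<one> u \<and> separated G ?A t u"
        using i gen sep sep1 True by (intro bexI[of _ "g [^] j"]) auto
    next
      fix t u v assume "t \<in> ?K" "u \<in> ?K" "v \<in> ?K" and s: "separated G ?A \<one> t" "separated G ?A \<one> u"
        "separated G ?A \<one> v" "separated G ?A t u" "separated G ?A t v"
      then obtain i j k :: nat where "i < 7" "t = g [^] i" "j < 7" "u = g [^] j" "k < 7" "v = g [^] k"
        using gen True by auto
      then show "\<not> separated G ?A u v"
        using s sep sep1 True cycle_separated_7_no_K4[of i j k] by simp
    qed
    then show ?thesis by blast
  next
    case False
    have "\<forall>B. maximal_packing G ?K ?A B \<longrightarrow> card B = (if \<exists>t\<in>?K. separated G ?A \<one> t then 2 else 1)"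
    proof (intro allI impI, rule maximal_packing_card_le_2[OF K])
      fix t u assume "t \<in> ?K" "u \<in> ?K" and s: "separated G ?A \<one> t" "separated G ?A \<one> u"
      then obtain i j where "i < ord g" "t = g [^] i" "j < ord g" "u = g [^] j"
        using gen by auto
      then show "\<not> separated G ?A t u"
        using s sep sep1 n False cycle_separated_triangle_free[of "ord g" i j] by simp
    qed
    then show ?thesis by blast
  qed
  then show ?thesis using right_stable_subset_if_stable_in_subgroup[OF fin K] by blast
qed

end

section \<open>Groups given by a presentation\<close>

text \<open>Lets a concrete multiplication table inherit associativity from a group into which it
  embeds. Left inverses come from finiteness: right multiplication is injective on the finite
  carrier, hence surjective.\<close>

lemma group_if_mon:
  assumes "group G" "finite (carrier H)" "\<one>\<^bsub>H\<^esub> \<in> carrier H"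
    and closed: "\<And>x y. x \<in> carrier H \<Longrightarrow> y \<in> carrier H \<Longrightarrow> x \<otimes>\<^bsub>H\<^esub> y \<in> carrier H"
    and f: "f \<in> hom H G" "inj_on f (carrier H)" "f \<one>\<^bsub>H\<^esub> = \<one>\<^bsub>G\<^esub>"
  shows "group H"
proof -
  interpret G: group G by fact
  have fG: "f x \<in> carrier G" if "x \<in> carrier H" for x using f(1) that by (auto simp: hom_def)
  have fm: "f (x \<otimes>\<^bsub>H\<^esub> y) = f x \<otimes>\<^bsub>G\<^esub> f y" if "x \<in> carrier H" "y \<in> carrier H" for x y
    using f(1) that by (simp add: hom_mult)
  have eq: "x = y" if "f x = f y" "x \<in> carrier H" "y \<in> carrier H" for x y
    using f(2) that by (meson inj_onD)
  show ?thesis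
  proof (rule groupI)
    fix x assume x: "x \<in> carrier H"
    have "inj_on (\<lambda>y. y \<otimes>\<^bsub>H\<^esub> x) (carrier H)"
    proof (rule inj_onI)
      fix y z assume yz: "y \<in> carrier H" "z \<in> carrier H" "y \<otimes>\<^bsub>H\<^esub> x = z \<otimes>\<^bsub>H\<^esub> x"
      then have "f y \<otimes>\<^bsub>G\<^esub> f x = f z \<otimes>\<^bsub>G\<^esub> f x" using x fm by metis
      then show "y = z" using x yz fG eq by simp
    qed
    moreover have "(\<lambda>y. y \<otimes>\<^bsub>H\<^esub> x) ` carrier H \<subseteq> carrier H" using closed x by auto
    ultimately have "(\<lambda>y. y \<otimes>\<^bsub>H\<^esub> x) ` carrier H = carrier H"
      using assms(2) by (simp add: endo_inj_surj)
    then show "\<exists>y\<in>carrier H. y \<otimes>\<^bsub>H\<^esub> x = \<one>\<^bsub>H\<^esub>" using assms(3) by (metis imageE)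
  next
    fix x y z assume "x \<in> carrier H" "y \<in> carrier H" "z \<in> carrier H"
    then show "x \<otimes>\<^bsub>H\<^esub> y \<otimes>\<^bsub>H\<^esub> z = x \<otimes>\<^bsub>H\<^esub> (y \<otimes>\<^bsub>H\<^esub> z)"
      by (intro eq) (simp_all add: closed fm fG G.m_assoc)
  next
    fix x assume "x \<in> carrier H"
    then show "\<one>\<^bsub>H\<^esub> \<otimes>\<^bsub>H\<^esub> x = x"
      using assms(3) by (intro eq) (simp_all add: closed fm fG f(3))
  qed (use assms closed in auto)
qed

definition pc_act :: "nat \<Rightarrow> nat \<Rightarrow> nat \<times> nat \<Rightarrow> nat \<times> nat \<Rightarrow> nat \<times> nat \<Rightarrow> nat \<times> nat" where
  "pc_act l m P Q x = ((fst P * fst x + fst Q * snd x) mod l, (snd P * fst x + snd Q * snd x) mod m)"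

text \<open>The element \<open>((i, j), k)\<close> stands for \<open>a\<^sup>i b\<^sup>j x\<^sup>k\<close>, where \<open>a\<close> and \<open>b\<close> commute and have orders \<open>l\<close>
  and \<open>m\<close>, conjugation by \<open>x\<close> maps \<open>a\<close> and \<open>b\<close> to the words with exponents \<open>P\<close> and \<open>Q\<close>, and \<open>x\<^sup>n\<close> is
  the word with exponents \<open>C\<close>. For unsuitable parameters this is not a group.\<close>

definition pc_monoid ::
  "nat \<Rightarrow> nat \<Rightarrow> nat \<Rightarrow> nat \<times> nat \<Rightarrow> nat \<times> nat \<Rightarrow> nat \<times> nat \<Rightarrow> ((nat \<times> nat) \<times> nat) monoid" where
  "pc_monoid l m n P Q C =
    \<lparr>carrier = ({..<l} \<times> {..<m}) \<times> {..<n},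
     monoid.mult = (\<lambda>(x, k) (y, k').
       let z = (pc_act l m P Q ^^ k) y; c = (if k + k' < n then (0, 0) else C)
       in (((fst x + fst z + fst c) mod l, (snd x + snd z + snd c) mod m), (k + k') mod n)),
     one = ((0, 0), 0)\<rparr>"

text \<open>The last two clauses say that nothing collapses: the words in \<open>a\<close> and
  \<open>b\<close> have independent exponents, and no \<open>x^k\<close> with
  \<open>0 < k < n\<close> lies in the group generated by \<open>a\<close> and \<open>b\<close>.
  They make the normal form \<open>a^i b^j x^k\<close> unique.\<close>

definition pc_relations ::
  "('a, 'b) monoid_scheme \<Rightarrow> 'a \<Rightarrow> 'a \<Rightarrow> 'a \<Rightarrow> nat \<Rightarrow> nat \<Rightarrow> nat \<Rightarrow> nat \<times> nat \<Rightarrow> nat \<times> nat \<Rightarrow> nat \<times> nat \<Rightarrow> bool" where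
  "pc_relations G a b x l m n P Q C \<longleftrightarrow>
     a \<in> carrier G \<and> b \<in> carrier G \<and> x \<in> carrier G \<and> 0 < l \<and> 0 < m \<and> 0 < n \<and>
     a \<otimes>\<^bsub>G\<^esub> b = b \<otimes>\<^bsub>G\<^esub> a \<and> a [^]\<^bsub>G\<^esub> l = \<one>\<^bsub>G\<^esub> \<and> b [^]\<^bsub>G\<^esub> m = \<one>\<^bsub>G\<^esub> \<and>
     x \<otimes>\<^bsub>G\<^esub> a = a [^]\<^bsub>G\<^esub> fst P \<otimes>\<^bsub>G\<^esub> b [^]\<^bsub>G\<^esub> snd P \<otimes>\<^bsub>G\<^esub> x \<and>
     x \<otimes>\<^bsub>G\<^esub> b = a [^]\<^bsub>G\<^esub> fst Q \<otimes>\<^bsub>G\<^esub> b [^]\<^bsub>G\<^esub> snd Q \<otimes>\<^bsub>G\<^esub> x \<and>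
     x [^]\<^bsub>G\<^esub> n = a [^]\<^bsub>G\<^esub> fst C \<otimes>\<^bsub>G\<^esub> b [^]\<^bsub>G\<^esub> snd C \<and>
     (\<forall>(i::nat) (j::nat). a [^]\<^bsub>G\<^esub> i \<otimes>\<^bsub>G\<^esub> b [^]\<^bsub>G\<^esub> j = \<one>\<^bsub>G\<^esub> \<longrightarrow> l dvd i \<and> m dvd j) \<and>
     (\<forall>k. 0 < k \<and> k < n \<longrightarrow> (\<forall>(i::nat) (j::nat). x [^]\<^bsub>G\<^esub> k \<noteq> a [^]\<^bsub>G\<^esub> i \<otimes>\<^bsub>G\<^esub> b [^]\<^bsub>G\<^esub> j))"

context group
begin

lemma pow_mod_eq:
  assumes "a \<in> carrier G" "a [^] (l::nat) = \<one>"
  shows "a [^] (i mod l) = a [^] (i::nat)"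
proof -
  have "a [^] i = a [^] (l * (i div l) + i mod l)" by simp
  also have "\<dots> = (a [^] l) [^] (i div l) \<otimes> a [^] (i mod l)"
    using assms(1) by (simp only: nat_pow_mult[symmetric] nat_pow_pow)
  also have "\<dots> = a [^] (i mod l)" using assms by simp
  finally show ?thesis by simp
qed

lemma pow_commutes:
  assumes "x \<in> carrier G" "y \<in> carrier G" "x \<otimes> y = y \<otimes> x"
  shows "x [^] (i::nat) \<otimes> y [^] (j::nat) = y [^] j \<otimes> x [^] i"
proof -
  have "x [^] i \<otimes> y = y \<otimes> x [^] i"
  proof (induction i)
    case (Suc i)
    have "x [^] Suc i \<otimes> y = x [^] i \<otimes> (x \<otimes> y)" using assms by (simp add: m_assoc)
    also have "\<dots> = x [^] i \<otimes> y \<otimes> x" using assms by (simp add: m_assoc)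
    also have "\<dots> = y \<otimes> x [^] Suc i" using assms by (simp add: Suc.IH m_assoc)
    finally show ?case .
  qed (use assms in simp)
  note 1 = this
  show ?thesis
  proof (induction j)
    case (Suc j)
    have "x [^] i \<otimes> y [^] Suc j = x [^] i \<otimes> y [^] j \<otimes> y" using assms by (simp add: m_assoc)
    also have "\<dots> = y [^] j \<otimes> (x [^] i \<otimes> y)" using assms by (simp add: Suc.IH m_assoc)
    also have "\<dots> = y [^] Suc j \<otimes> x [^] i" using assms by (simp add: 1 m_assoc)
    finally show ?case .
  qed (use assms in simp)
qed

lemma conj_pow:
  assumes "x \<in> carrier G" "y \<in> carrier G" "z \<in> carrier G" "x \<otimes> y = z \<otimes> x"
  shows "x \<otimes> y [^] (i::nat) = z [^] i \<otimes> x"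
proof (induction i)
  case (Suc i)
  have "x \<otimes> y [^] Suc i = x \<otimes> y [^] i \<otimes> y" using assms by (simp add: m_assoc)
  also have "\<dots> = z [^] i \<otimes> (x \<otimes> y)" using assms by (simp add: Suc.IH m_assoc)
  also have "\<dots> = z [^] Suc i \<otimes> x" using assms by (simp add: m_assoc)
  finally show ?case .
qed (use assms in simp)

text \<open>Collecting \<open>x\<close> to the right multiplies normal forms exactly as the table
  does. That the parameters define a group at all is concluded from the embedding, so no consistency
  conditions on \<open>P\<close>, \<open>Q\<close> and \<open>C\<close> have to be solved.\<close>

lemma pc_embedding:
  assumes rel: "pc_relations G a b x l m n P Q C"
  defines "f \<equiv> (\<lambda>((i, j), k). a [^] (i::nat) \<otimes> b [^] (j::nat) \<otimes> x [^] (k::nat))"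
  shows "f \<in> hom (pc_monoid l m n P Q C) G" "inj_on f (carrier (pc_monoid l m n P Q C))"
    "group (pc_monoid l m n P Q C)"
proof -
  let ?M = "pc_monoid l m n P Q C" and ?A = "pc_act l m P Q"
  have c: "a \<in> carrier G" "b \<in> carrier G" "x \<in> carrier G" and pos: "0 < l" "0 < m" "0 < n"
    and ab: "a \<otimes> b = b \<otimes> a" and al: "a [^] l = \<one>" and bm: "b [^] m = \<one>"
    and xa: "x \<otimes> a = a [^] fst P \<otimes> b [^] snd P \<otimes> x"
    and xb: "x \<otimes> b = a [^] fst Q \<otimes> b [^] snd Q \<otimes> x"
    and xn: "x [^] n = a [^] fst C \<otimes> b [^] snd C"
    and inj1: "\<And>(i::nat) (j::nat). a [^] i \<otimes> b [^] j = \<one> \<Longrightarrow> l dvd i \<and> m dvd j"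
    and inj2: "\<And>k (i::nat) (j::nat). 0 < k \<Longrightarrow> k < n \<Longrightarrow> x [^] k \<noteq> a [^] i \<otimes> b [^] j"
    using rel unfolding pc_relations_def by auto
  define e where "e y = a [^] fst y \<otimes> b [^] snd y" for y :: "nat \<times> nat"
  have ec: "e y \<in> carrier G" for y using c by (simp add: e_def)
  have amod: "a [^] (i mod l) = a [^] i" for i :: nat using c al by (simp add: pow_mod_eq)
  have bmod: "b [^] (j mod m) = b [^] j" for j :: nat using c bm by (simp add: pow_mod_eq)
  have emod: "e (i mod l, j mod m) = e (i, j)" for i j by (simp add: e_def amod bmod)
  have e_mult: "e (i, j) \<otimes> e (i', j') = e (i + i', j + j')" for i j i' j'
  proof -
    have "e (i, j) \<otimes> e (i', j') = a [^] i \<otimes> (b [^] j \<otimes> a [^] i') \<otimes> b [^] j'"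
      using c by (simp add: e_def m_assoc)
    also have "b [^] j \<otimes> a [^] i' = a [^] i' \<otimes> b [^] j" using c ab by (simp add: pow_commutes)
    finally show ?thesis using c by (simp add: e_def m_assoc nat_pow_mult[symmetric])
  qed
  have e_pow: "e (i, j) [^] (k::nat) = e (i * k, j * k)" for i j k
    by (induction k) (simp_all add: e_mult, simp_all add: e_def add.commute)
  have act: "x \<otimes> e y = e (?A y) \<otimes> x" for y
  proof -
    obtain i j where y: "y = (i, j)" by (cases y)
    have "x \<otimes> e y = x \<otimes> a [^] i \<otimes> b [^] j" using c by (simp add: e_def y m_assoc)
    also have "x \<otimes> a [^] i = e P [^] i \<otimes> x"
      using c xa by (intro conj_pow) (simp_all add: e_def)
    also have "e P [^] i \<otimes> x \<otimes> b [^] j = e P [^] i \<otimes> (x \<otimes> b [^] j)" using c ec by (simp add: m_assoc)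
    also have "x \<otimes> b [^] j = e Q [^] j \<otimes> x"
      using c xb by (intro conj_pow) (simp_all add: e_def)
    also have "e P [^] i \<otimes> (e Q [^] j \<otimes> x) = e P [^] i \<otimes> e Q [^] j \<otimes> x" using c ec by (simp add: m_assoc)
    also have "e P [^] i \<otimes> e Q [^] j = e (?A y)"
      using e_pow[of "fst P" "snd P"] e_pow[of "fst Q" "snd Q"] by (simp add: e_mult pc_act_def emod y)
    finally show ?thesis .
  qed
  have actk: "x [^] k \<otimes> e y = e ((?A ^^ k) y) \<otimes> x [^] k" for k y
  proof (induction k)
    case (Suc k)
    have "x [^] Suc k \<otimes> e y = x \<otimes> (x [^] k \<otimes> e y)"
      using c ec nat_pow_Suc2[of x k] by (simp add: m_assoc)
    also have "\<dots> = x \<otimes> e ((?A ^^ k) y) \<otimes> x [^] k" using c ec by (simp add: Suc.IH m_assoc)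
    also have "\<dots> = e ((?A ^^ Suc k) y) \<otimes> (x \<otimes> x [^] k)" using c ec by (simp add: act m_assoc)
    also have "x \<otimes> x [^] k = x [^] Suc k" using c nat_pow_Suc2[of x k] by simp
    finally show ?case .
  qed (use c ec in simp)
  have f: "f (y, k) = e y \<otimes> x [^] k" for y k by (auto simp: f_def e_def split: prod.split)
  have fc: "f y \<in> carrier G" for y using c ec by (cases y) (simp add: f)
  have "f (g \<otimes>\<^bsub>?M\<^esub> h) = f g \<otimes> f h" if gh: "g \<in> carrier ?M" "h \<in> carrier ?M" for g h
  proof -
    obtain y k z k' where g: "g = (y, k)" and h: "h = (z, k')" by (cases g, cases h)
    have k: "k < n" "k' < n" using gh by (auto simp: g h pc_monoid_def)
    let ?z = "(?A ^^ k) z" and ?c = "if k + k' < n then (0, 0) else C"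
    have xk: "x [^] (k + k') = e ?c \<otimes> x [^] ((k + k') mod n)"
    proof (cases "k + k' < n")
      case False
      then have "x [^] (k + k') = x [^] (n + (k + k' - n))" by simp
      also have "\<dots> = x [^] n \<otimes> x [^] (k + k' - n)" using c by (simp add: nat_pow_mult)
      finally show ?thesis using False k xn by (simp add: e_def mod_if)
    qed (use c in \<open>simp add: e_def\<close>)
    have "f g \<otimes> f h = e y \<otimes> (x [^] k \<otimes> e z) \<otimes> x [^] k'"
      using c ec by (simp add: g h f m_assoc)
    also have "\<dots> = e y \<otimes> e ?z \<otimes> (x [^] k \<otimes> x [^] k')" using c ec by (simp add: actk m_assoc)
    also have "x [^] k \<otimes> x [^] k' = e ?c \<otimes> x [^] ((k + k') mod n)" using c xk by (simp add: nat_pow_mult)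
    also have "e y \<otimes> e ?z \<otimes> (e ?c \<otimes> x [^] ((k + k') mod n)) = e y \<otimes> e ?z \<otimes> e ?c \<otimes> x [^] ((k + k') mod n)"
      using c ec by (simp add: m_assoc)
    also have "e y \<otimes> e ?z \<otimes> e ?c = e (fst y + fst ?z + fst ?c, snd y + snd ?z + snd ?c)"
      using e_mult[of "fst y" "snd y" "fst ?z" "snd ?z"]
        e_mult[of "fst y + fst ?z" "snd y + snd ?z" "fst ?c" "snd ?c"] by simp
    also have "e (fst y + fst ?z + fst ?c, snd y + snd ?z + snd ?c) \<otimes> x [^] ((k + k') mod n) = f (g \<otimes>\<^bsub>?M\<^esub> h)"
      by (simp add: g h pc_monoid_def Let_def f emod)
    finally show ?thesis by simp
  qed
  then show hom: "f \<in> hom ?M G" using fc by (auto simp: hom_def)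
  have le: "y = z \<and> k = k'" if "f (y, k) = f (z, k')" "k \<le> k'" "k' < n" "y \<in> {..<l} \<times> {..<m}" "z \<in> {..<l} \<times> {..<m}"
    for y z k k'
  proof -
    have "e y \<otimes> x [^] k = e z \<otimes> (x [^] (k' - k) \<otimes> x [^] k)"
      using that c by (simp add: f nat_pow_mult)
    then have "e y = e z \<otimes> x [^] (k' - k)" using c ec by (simp add: m_assoc[symmetric])
    then have "e (l - fst z, m - snd z) \<otimes> e y = e (l - fst z, m - snd z) \<otimes> e z \<otimes> x [^] (k' - k)"
      using c ec by (simp add: m_assoc)
    moreover have "e (l - fst z, m - snd z) \<otimes> e z = \<one>"
      using e_mult[of "l - fst z" "m - snd z" "fst z" "snd z"] that al bm by (auto simp: e_def)
    ultimately have eq: "e (l - fst z + fst y, m - snd z + snd y) = x [^] (k' - k)"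
      using e_mult[of "l - fst z" "m - snd z" "fst y" "snd y"] c by simp
    then have "x [^] (k' - k) = a [^] (l - fst z + fst y) \<otimes> b [^] (m - snd z + snd y)"
      by (simp add: e_def)
    then have "\<not> (0 < k' - k \<and> k' - k < n)" using inj2 by metis
    then have "k = k'" using that(2,3) by auto
    then have dvd: "l dvd l - fst z + fst y" "m dvd m - snd z + snd y"
      using eq inj1[of "l - fst z + fst y" "m - snd z + snd y"] by (simp_all add: e_def)
    \<comment> \<open>Inverting a word with natural exponents shifts them by \<open>l\<close> and
      \<open>m\<close>. A shifted difference \<open>q - s + r\<close> lies strictly between 0 and
      \<open>2 q\<close>, so divisibility by \<open>q\<close> leaves only the value
      \<open>q\<close>.\<close>
    have "r = s" if rs: "q dvd q - s + r" "r < q" "s < q" for r s q :: nat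
    proof -
      obtain c where c: "q - s + r = q * c" using rs(1) by blast
      have "0 < q * c" "q * c < q * 2" using rs(2,3) c[symmetric] by auto
      then have "c = 1" by auto
      then show ?thesis using c rs by auto
    qed
    from this[OF dvd(1)] this[OF dvd(2)] show ?thesis
      using that \<open>k = k'\<close> by (auto simp: prod_eq_iff)
  qed
  show inj: "inj_on f (carrier ?M)"
  proof (rule inj_onI)
    fix g h assume gh: "g \<in> carrier ?M" "h \<in> carrier ?M" "f g = f h"
    obtain y k z k' where "g = (y, k)" "h = (z, k')" by (cases g, cases h)
    then show "g = h"
      using gh le[of y k z k'] le[of z k' y k] by (cases "k \<le> k'") (auto simp: pc_monoid_def)
  qed
  show "group ?M"
  proof (rule group_if_mon[OF is_group _ _ _ hom inj])
    show "f \<one>\<^bsub>?M\<^esub> = \<one>" by (simp add: pc_monoid_def f e_def)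
  qed (use pos in \<open>auto simp: pc_monoid_def Let_def\<close>)
qed

lemma pc_not_stable:
  assumes "finite (carrier G)" "pc_relations G a b x l m n P Q C"
    "\<not> stable_group (pc_monoid l m n P Q C)"
  shows "\<not> stable_group G"
  using stable_group_mon[OF is_group pc_embedding(3)[OF assms(2)] assms(1) _ pc_embedding(1,2)[OF assms(2)]]
    assms(3) by blast

lemma pc_iso:
  assumes rel: "pc_relations G a b x l m n P Q C" and "order G = l * m * n"
  shows "pc_monoid l m n P Q C \<cong> G"
proof -
  let ?M = "pc_monoid l m n P Q C" and ?f = "(\<lambda>((i, j), k). a [^] (i::nat) \<otimes> b [^] (j::nat) \<otimes> x [^] (k::nat))"
  note emb = pc_embedding[OF rel]
  have pos: "0 < l * m * n" using rel by (simp add: pc_relations_def)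
  have "card (?f ` carrier ?M) = card (carrier G)"
    using emb(2) assms(2) by (simp add: card_image order_def pc_monoid_def card_cartesian_product)
  moreover have "?f ` carrier ?M \<subseteq> carrier G" using hom_carrier[OF emb(1)] .
  moreover have "finite (carrier G)" using pos assms(2) by (metis card_ge_0_finite order_def)
  ultimately have "?f ` carrier ?M = carrier G" by (simp add: card_subset_eq)
  then have "?f \<in> iso ?M G" using emb by (simp add: iso_def bij_betw_def)
  then show ?thesis by (auto simp: is_iso_def)
qed

end

lemma pc_unique:
  assumes "group G" "group H" "pc_relations G a b x l m n P Q C" "order G = l * m * n"
    "pc_relations H a' b' x' l m n P Q C" "order H = l * m * n"
  shows "G \<cong> H"
  using group.iso_sym[OF group.pc_embedding(3)[OF assms(1,3)] group.pc_iso[OF assms(1,3,4)]]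
    group.pc_iso[OF assms(2,5,6)] iso_trans by blast

section \<open>Small unstable groups\<close>

text \<open>The condition quantifies over finite sets only, so it can be decided by evaluation in a
  concrete \<open>pc_monoid\<close>, even before this is known to be a group.\<close>

definition unstable_witness :: "('a, 'b) monoid_scheme \<Rightarrow> 'a set \<Rightarrow> 'a set \<Rightarrow> 'a set \<Rightarrow> bool" where
  "unstable_witness G A B B' \<longleftrightarrow> A \<noteq> {} \<and> A \<subseteq> carrier G \<and> maximal_packing G (carrier G) A B \<and>
     B' \<subseteq> carrier G \<and> packing G A B' \<and> card B < card B'"

lemma (in group) pc_not_stable_witness:
  assumes "finite (carrier G)" and rel: "pc_relations G a b x l m n P Q C"
    and w: "unstable_witness (pc_monoid l m n P Q C) A B B'"
  shows "\<not> stable_group G"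
proof (rule pc_not_stable[OF assms(1) rel])
  let ?M = "pc_monoid l m n P Q C"
  have "group ?M" by (rule pc_embedding(3)[OF rel])
  moreover have "finite (carrier ?M)" by (simp add: pc_monoid_def)
  ultimately show "\<not> stable_group ?M"
    using w unfolding unstable_witness_def
    by (metis group.not_stable_groupI group.subgroup_self)
qed

text \<open>The table is the dihedral group of order 10. The tables that follow are the dihedral
  group of order 14, the Frobenius group of order 21, the group of order 18 in which an involution
  inverts \<open>C3 x C3\<close>, then \<open>C5 x C5\<close>, \<open>C7 x C7\<close> and the groups
  of order 27 and exponent 3.\<close>

lemma unstable_pc_D5: "unstable_witness (pc_monoid 5 1 2 (4, 0) (0, 1) (0, 0))
  {((0, 0), 0), ((0, 0), 1), ((1, 0), 0)}
  {((0, 0), 0), ((2, 0), 1)}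
  {((0, 0), 0), ((3, 0), 0), ((3, 0), 1)}"
  by code_simp

lemma unstable_pc_D7: "unstable_witness (pc_monoid 7 1 2 (6, 0) (0, 1) (0, 0))
  {((0, 0), 0), ((0, 0), 1), ((1, 0), 0)}
  {((0, 0), 0), ((2, 0), 1), ((4, 0), 1)}
  {((0, 0), 0), ((2, 0), 1), ((3, 0), 0), ((5, 0), 1)}"
  by code_simp

lemma unstable_pc_F21: "unstable_witness (pc_monoid 7 1 3 (2, 0) (0, 1) (0, 0))
  {((0, 0), 0), ((0, 0), 1), ((1, 0), 0)}
  {((0, 0), 0), ((2, 0), 2), ((3, 0), 1)}
  {((0, 0), 0), ((1, 0), 1), ((5, 0), 1), ((3, 0), 1)}"
  by code_simp

lemma unstable_pc_Dih33: "unstable_witness (pc_monoid 3 3 2 (2, 0) (0, 2) (0, 0))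
  {((0, 0), 0), ((0, 0), 1), ((0, 1), 0), ((1, 0), 1)}
  {((0, 0), 0), ((2, 1), 1)}
  {((0, 0), 0), ((1, 2), 0), ((2, 1), 0)}"
  by code_simp

lemma unstable_pc_C55: "unstable_witness (pc_monoid 5 5 1 (1, 0) (0, 1) (0, 0))
  {((0, 0), 0), ((0, 1), 0), ((1, 0), 0)}
  {((0, 0), 0), ((1, 2), 0), ((3, 0), 0), ((3, 3), 0)}
  {((0, 0), 0), ((1, 2), 0), ((3, 0), 0), ((2, 4), 0), ((4, 2), 0)}"
  by code_simp

text \<open>The small packing is the subgroup generated by \<open>a b\<close>. The six quotients of
  distinct elements of \<open>A = {\<one>, a, b^2}\<close> represent its six nontrivial cosets, so
  it blocks everything else; this is the reason for the exponent 2 in \<open>A\<close>.\<close>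

lemma unstable_pc_C77: "unstable_witness (pc_monoid 7 7 1 (1, 0) (0, 1) (0, 0))
  {((0, 0), 0), ((0, 2), 0), ((1, 0), 0)}
  {((0, 0), 0), ((1, 1), 0), ((3, 3), 0), ((4, 4), 0), ((6, 6), 0), ((5, 5), 0), ((2, 2), 0)}
  {((0, 0), 0), ((1, 1), 0), ((3, 3), 0), ((4, 4), 0), ((5, 1), 0), ((0, 4), 0), ((5, 5), 0), ((2, 2), 0)}"
  by code_simp

text \<open>The small packing is the subgroup of order 3 generated by \<open>a b^2 x\<close>.
  Quotients of elements of \<open>A\<close> represent all its eight nontrivial cosets.\<close>

lemma unstable_pc_27_0: "unstable_witness (pc_monoid 3 3 3 (1, 0) (0, 1) (0, 0))
  {((0, 0), 0), ((0, 0), 1), ((0, 1), 0), ((1, 0), 0)}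
  {((0, 0), 0), ((1, 2), 1), ((2, 1), 2)}
  {((0, 0), 0), ((1, 2), 1), ((2, 0), 2), ((1, 1), 0)}"
  by code_simp

lemma unstable_pc_27_1: "unstable_witness (pc_monoid 3 3 3 (1, 1) (0, 1) (0, 0))
  {((0, 0), 0), ((0, 0), 1), ((1, 0), 0)}
  {((0, 0), 0), ((1, 2), 1), ((2, 1), 0), ((2, 1), 2), ((2, 2), 0)}
  {((0, 0), 0), ((1, 2), 1), ((2, 1), 0), ((2, 1), 2), ((2, 1), 1), ((0, 2), 0)}"
  by code_simp

text \<open>The same nonabelian group as in the previous table, with \<open>b\<close> replaced by
  its inverse. A separate witness spares a change of generators.\<close>

lemma unstable_pc_27_2: "unstable_witness (pc_monoid 3 3 3 (1, 2) (0, 1) (0, 0))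
  {((0, 0), 0), ((0, 0), 1), ((1, 0), 0)}
  {((0, 0), 0), ((1, 2), 1), ((2, 0), 2), ((0, 2), 2), ((0, 1), 1)}
  {((0, 0), 0), ((1, 2), 1), ((2, 0), 2), ((1, 0), 1), ((2, 1), 1), ((1, 2), 0)}"
  by code_simp

text \<open>An entry consists of \<open>P\<close>, \<open>Q\<close>, \<open>C\<close>, the set
  \<open>A\<close>, a maximal packing and a larger packing. Of the 32 parameter choices left by
  \<open>pc_16_not_stable'\<close> these 20 are the consistent ones; many entries present isomorphic
  groups.\<close>

definition unstable_table_16 :: "((nat \<times> nat) \<times> (nat \<times> nat) \<times> (nat \<times> nat) \<times>
    ((nat \<times> nat) \<times> nat) set \<times> ((nat \<times> nat) \<times> nat) set \<times> ((nat \<times> nat) \<times> nat) set) list" where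
  "unstable_table_16 = [
   ((1, 0), (0, 1), (0, 0),
     {((0, 0), 0), ((0, 0), 1), ((0, 1), 0), ((1, 0), 0)},
     {((0, 0), 0), ((2, 1), 0)}, {((0, 0), 0), ((2, 0), 0), ((1, 1), 1)}),
   ((1, 0), (0, 1), (0, 1),
     {((0, 0), 0), ((0, 0), 1), ((1, 0), 0)},
     {((0, 0), 0), ((2, 1), 1), ((1, 0), 1)}, {((0, 0), 0), ((2, 1), 1), ((2, 0), 1), ((0, 1), 0)}),
   ((1, 0), (0, 1), (2, 0),
     {((0, 0), 0), ((0, 0), 1), ((0, 1), 0), ((1, 0), 1)},
     {((0, 0), 0), ((2, 1), 0)}, {((0, 0), 0), ((1, 1), 0), ((3, 1), 0)}),
   ((1, 0), (0, 1), (2, 1),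
     {((0, 0), 0), ((0, 0), 1), ((1, 0), 0)},
     {((0, 0), 0), ((1, 0), 1), ((1, 1), 0)}, {((0, 0), 0), ((1, 0), 1), ((1, 1), 1), ((0, 1), 0)}),
   ((1, 0), (2, 1), (0, 0),
     {((0, 0), 0), ((0, 0), 1), ((0, 1), 0), ((1, 0), 0)},
     {((0, 0), 0), ((2, 1), 0)}, {((0, 0), 0), ((2, 0), 0), ((1, 1), 1)}),
   ((1, 0), (2, 1), (2, 0),
     {((0, 0), 0), ((0, 0), 1), ((0, 1), 0), ((1, 0), 0)},
     {((0, 0), 0), ((2, 1), 1)}, {((0, 0), 0), ((1, 0), 1), ((2, 1), 0)}),
   ((1, 1), (0, 1), (0, 0),
     {((0, 0), 0), ((0, 0), 1), ((0, 1), 0), ((1, 0), 0)},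
     {((0, 0), 0), ((2, 0), 1)}, {((0, 0), 0), ((1, 0), 1), ((2, 1), 0)}),
   ((1, 1), (0, 1), (0, 1),
     {((0, 0), 0), ((0, 0), 1), ((0, 1), 0), ((1, 0), 0)},
     {((0, 0), 0), ((2, 1), 0)}, {((0, 0), 0), ((2, 0), 0), ((1, 1), 1)}),
   ((1, 1), (0, 1), (2, 0),
     {((0, 0), 0), ((0, 0), 1), ((0, 1), 0), ((1, 0), 1)},
     {((0, 0), 0), ((2, 1), 0)}, {((0, 0), 0), ((1, 0), 0), ((3, 0), 0)}),
   ((1, 1), (0, 1), (2, 1),
     {((0, 0), 0), ((0, 0), 1), ((0, 1), 0), ((1, 0), 1)},
     {((0, 0), 0), ((2, 1), 0)}, {((0, 0), 0), ((1, 0), 0), ((3, 0), 0)}),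
   ((3, 0), (0, 1), (0, 0),
     {((0, 0), 0), ((0, 0), 1), ((0, 1), 0), ((1, 0), 0)},
     {((0, 0), 0), ((2, 0), 1)}, {((0, 0), 0), ((3, 1), 1), ((2, 1), 0)}),
   ((3, 0), (0, 1), (0, 1),
     {((0, 0), 0), ((0, 0), 1), ((0, 1), 0), ((1, 0), 1)},
     {((0, 0), 0), ((2, 1), 0)}, {((0, 0), 0), ((3, 0), 1), ((2, 1), 1)}),
   ((3, 0), (0, 1), (2, 0),
     {((0, 0), 0), ((0, 0), 1), ((0, 1), 0), ((1, 0), 0)},
     {((0, 0), 0), ((2, 1), 0)}, {((0, 0), 0), ((3, 1), 1), ((1, 1), 1)}),
   ((3, 0), (0, 1), (2, 1),
     {((0, 0), 0), ((0, 0), 1), ((0, 1), 0), ((1, 0), 0)},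
     {((0, 0), 0), ((2, 0), 0)}, {((0, 0), 0), ((2, 1), 0), ((1, 0), 1)}),
   ((3, 0), (2, 1), (0, 0),
     {((0, 0), 0), ((0, 0), 1), ((0, 1), 0), ((1, 0), 0)},
     {((0, 0), 0), ((2, 0), 1)}, {((0, 0), 0), ((1, 0), 1), ((2, 1), 0)}),
   ((3, 0), (2, 1), (2, 0),
     {((0, 0), 0), ((0, 0), 1), ((0, 1), 0), ((1, 0), 0)},
     {((0, 0), 0), ((2, 1), 0)}, {((0, 0), 0), ((2, 0), 0), ((1, 1), 1)}),
   ((3, 1), (0, 1), (0, 0),
     {((0, 0), 0), ((0, 0), 1), ((0, 1), 0), ((1, 0), 1)},
     {((0, 0), 0), ((2, 1), 0)}, {((0, 0), 0), ((2, 1), 1), ((1, 0), 0)}),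
   ((3, 1), (0, 1), (0, 1),
     {((0, 0), 0), ((0, 0), 1), ((0, 1), 0), ((1, 0), 0)},
     {((0, 0), 0), ((2, 0), 1)}, {((0, 0), 0), ((3, 1), 1), ((2, 1), 0)}),
   ((3, 1), (0, 1), (2, 0),
     {((0, 0), 0), ((0, 0), 1), ((0, 1), 0), ((1, 0), 0)},
     {((0, 0), 0), ((2, 0), 0)}, {((0, 0), 0), ((2, 1), 0), ((1, 0), 1)}),
   ((3, 1), (0, 1), (2, 1),
     {((0, 0), 0), ((0, 0), 1), ((0, 1), 0), ((1, 0), 0)},
     {((0, 0), 0), ((2, 1), 0)}, {((0, 0), 0), ((3, 1), 1), ((1, 1), 1)})]"

lemma unstable_table_16_correct:
  "list_all (\<lambda>(P, Q, C, A, B, B'). unstable_witness (pc_monoid 4 2 2 P Q C) A B B') unstable_table_16"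
  by code_simp

lemma unstable_table_16_complete:
  "\<forall>p\<in>{1, 3}. \<forall>q\<in>{0, 1}. \<forall>r\<in>{0, 2}. \<forall>u\<in>{0, 2}. \<forall>v\<in>{0, 1}.
     (q, r, v) \<in> {(0, 2, 1), (1, 2, 0), (1, 2, 1)} \<or>
     ((p, q), (r, 1), (u, v)) \<in> set (map (\<lambda>(P, Q, C, A, B, B'). (P, Q, C)) unstable_table_16)"
  by code_simp

text \<open>If \<open>r = 2\<close> and \<open>v = 1\<close>, then \<open>x\<close> would not
  commute with its own square \<open>a^u b\<close>. If \<open>q = 1\<close>, \<open>r = 2\<close>
  and \<open>v = 0\<close>, conjugating twice by \<open>x\<close> would send \<open>a\<close> to
  \<open>a^3\<close>, although \<open>x^2\<close> is a power of \<open>a\<close>.\<close>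

lemma pc_16_not_associative:
  "\<forall>p\<in>{1, 3}. \<forall>u\<in>{0, 2}. \<forall>(q, r, v)\<in>{(0, 2, 1), (1, 2, 0), (1, 2, 1)}.
     (let M = pc_monoid 4 2 2 (p, q) (r, 1) (u, v); a = ((1, 0), 0); x = ((0, 0), 1) in
      x \<otimes>\<^bsub>M\<^esub> x \<otimes>\<^bsub>M\<^esub> x \<noteq> x \<otimes>\<^bsub>M\<^esub> (x \<otimes>\<^bsub>M\<^esub> x) \<or> x \<otimes>\<^bsub>M\<^esub> x \<otimes>\<^bsub>M\<^esub> a \<noteq> x \<otimes>\<^bsub>M\<^esub> (x \<otimes>\<^bsub>M\<^esub> a))"
  by code_simp

lemma (in group) pc_16_not_stable:
  assumes fin: "finite (carrier G)" and rel: "pc_relations G a b x 4 2 2 (p, q) (r, 1) (u, v)"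
    and par: "p \<in> {1, 3}" "q \<in> {0, 1}" "r \<in> {0, 2}" "u \<in> {0, 2}" "v \<in> {0, 1}"
  shows "\<not> stable_group G"
proof -
  interpret M: group "pc_monoid 4 2 2 (p, q) (r, 1) (u, v)" by (rule pc_embedding(3)[OF rel])
  let ?a = "((1, 0), 0)" and ?x = "((0, 0), 1)"
  have c: "?a \<in> carrier (pc_monoid 4 2 2 (p, q) (r, 1) (u, v))" "?x \<in> carrier (pc_monoid 4 2 2 (p, q) (r, 1) (u, v))"
    by (auto simp: pc_monoid_def)
  have "(q, r, v) \<notin> {(0, 2, 1), (1, 2, 0), (1, 2, 1)}"
    using pc_16_not_associative par M.m_assoc[OF c(2) c(2) c(2)] M.m_assoc[OF c(2) c(2) c(1)]
    by (metis (mono_tags, lifting) case_prodD)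
  moreover have "(q, r, v) \<in> {(0, 2, 1), (1, 2, 0), (1, 2, 1)} \<or>
      ((p, q), (r, 1), (u, v)) \<in> set (map (\<lambda>(P, Q, C, A, B, B'). (P, Q, C)) unstable_table_16)"
    using par by (intro unstable_table_16_complete[rule_format])
  ultimately have "((p, q), (r, 1), (u, v)) \<in> set (map (\<lambda>(P, Q, C, A, B, B'). (P, Q, C)) unstable_table_16)"
    by (simp only: simp_thms)
  then obtain A B B' where "((p, q), (r, 1), (u, v), A, B, B') \<in> set unstable_table_16" by auto
  then have "unstable_witness (pc_monoid 4 2 2 (p, q) (r, 1) (u, v)) A B B'"
    using unstable_table_16_correct by (force simp: list_all_iff)
  then show ?thesis by (rule pc_not_stable_witness[OF fin rel])
qed

section \<open>A finite test for stability\<close>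

definition triangle_free :: "('a, 'b) monoid_scheme \<Rightarrow> 'a set \<Rightarrow> bool" where
  "triangle_free G A \<longleftrightarrow> (let T = Set.filter (separated G A \<one>\<^bsub>G\<^esub>) (carrier G)
     in \<forall>t\<in>T. \<forall>u\<in>T. \<not> separated G A t u)"

text \<open>The four equations are \<open>g^3 = \<one>\<close>, \<open>g^4 = \<one>\<close>,
  \<open>g^5 = \<one>\<close> and \<open>g^7 = \<one>\<close>. The divisors of 3, 4, 5 and 7 are
  exactly the orders for which pairs are harmless.\<close>

definition small_exponents :: "('a, 'b) monoid_scheme \<Rightarrow> bool" where
  "small_exponents G \<longleftrightarrow> (\<forall>g\<in>carrier G. let g2 = g \<otimes>\<^bsub>G\<^esub> g; g3 = g2 \<otimes>\<^bsub>G\<^esub> g; g4 = g2 \<otimes>\<^bsub>G\<^esub> g2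
     in g3 = \<one>\<^bsub>G\<^esub> \<or> g4 = \<one>\<^bsub>G\<^esub> \<or> g2 \<otimes>\<^bsub>G\<^esub> g3 = \<one>\<^bsub>G\<^esub> \<or> g3 \<otimes>\<^bsub>G\<^esub> g4 = \<one>\<^bsub>G\<^esub>)"

text \<open>After translating \<open>A\<close> to contain \<open>\<one>\<close>, either
  \<open>A\<close> has at most two elements and the cycle decides, or \<open>A\<close> contains some
  \<open>{\<one>, g, h}\<close>. A larger set separates less, so freedom from triangles passes from
  the triple to \<open>A\<close>.\<close>

definition stable_check :: "('a, 'b) monoid_scheme \<Rightarrow> bool" where
  "stable_check G \<longleftrightarrow> small_exponents G \<and>
     (\<forall>g\<in>carrier G. \<forall>h\<in>carrier G. g = \<one>\<^bsub>G\<^esub> \<or> h = \<one>\<^bsub>G\<^esub> \<or> g = h \<or> triangle_free G {\<one>\<^bsub>G\<^esub>, g, h})"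

context group
begin

lemma right_stable_subset_translate:
  assumes fin: "finite (carrier G)" and A: "A \<subseteq> carrier G" "g \<in> carrier G"
    and st: "right_stable_subset G ((\<otimes>) g ` A)"
  shows "right_stable_subset G A"
proof -
  have gA: "(\<otimes>) g ` A \<subseteq> carrier G" using A by auto
  have "maximal_packing G (carrier G) ((\<otimes>) g ` A) B" if B: "maximal_packing G (carrier G) A B" for B
    using B separated_mult_left_set[OF A(1) _ _ A(2)]
    unfolding maximal_packing_def packing_def by (metis DiffD1 subsetD)
  then show ?thesis
    using st unfolding right_stable_subset_iff[OF fin A(1)] right_stable_subset_iff[OF fin gA] by metis
qed

lemma stable_groupI:
  assumes fin: "finite (carrier G)"
    and one: "\<And>A. A \<subseteq> carrier G \<Longrightarrow> \<one> \<in> A \<Longrightarrow> right_stable_subset G A"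
  shows "stable_group G"
  unfolding stable_group_def
proof (intro allI impI)
  fix A assume A: "A \<noteq> {} \<and> A \<subseteq> carrier G"
  then obtain a where a: "a \<in> A" "a \<in> carrier G" by blast
  have "\<one> \<in> (\<otimes>) (inv a) ` A" using a by (force intro: image_eqI[of _ _ a])
  then have "right_stable_subset G ((\<otimes>) (inv a) ` A)" using A a by (intro one) auto
  then show "right_stable_subset G A" using right_stable_subset_translate[OF fin _ _] A a by blast
qed

lemma right_stable_subset_triangle_free:
  assumes fin: "finite (carrier G)" and A: "A \<subseteq> carrier G" "A' \<subseteq> A" "A' \<noteq> {}" and tf: "triangle_free G A'"
  shows "right_stable_subset G A"
proof -
  have A0: "A \<noteq> {}" using A by blast
  have "\<not> separated G A t u" if "t \<in> carrier G" "u \<in> carrier G" "separated G A \<one> t" "separated G A \<one> u" for t u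
  proof
    assume "separated G A t u"
    then have "separated G A' t u" "separated G A' \<one> t" "separated G A' \<one> u"
      using that separated_antimono[OF A(2)] by auto
    then show False using tf that by (auto simp: triangle_free_def)
  qed
  from maximal_packing_card_le_2[OF subgroup_self A(1) A0 this]
  have "\<exists>k. \<forall>B. maximal_packing G (carrier G) A B \<longrightarrow> card B = k" by blast
  then show ?thesis using right_stable_subset_iff[OF fin A(1)] by metis
qed

lemma stable_group_if_check:
  assumes fin: "finite (carrier G)" and chk: "stable_check G"
  shows "stable_group G"
proof (rule stable_groupI[OF fin])
  fix A assume A: "A \<subseteq> carrier G" "\<one> \<in> A"
  have ord: "ord g \<in> {1, 2, 3, 4, 5, 7}" if g: "g \<in> carrier G" for g
  proof -
    have "g [^] (3::nat) = \<one> \<or> g [^] (4::nat) = \<one> \<or> g [^] (5::nat) = \<one> \<or> g [^] (7::nat) = \<one>"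
      using chk g unfolding stable_check_def small_exponents_def Let_def
      by (simp add: numeral_eq_Suc m_assoc)
    then have "ord g dvd 3 \<or> ord g dvd 4 \<or> ord g dvd 5 \<or> ord g dvd 7"
      using pow_eq_id[OF g] by metis
    moreover have "n \<in> {1, 2, 3, 4, 5, 7}" if n: "n dvd 3 \<or> n dvd 4 \<or> n dvd 5 \<or> n dvd 7" for n :: nat
    proof -
      have "0 < n" using n by (auto intro: Nat.gr0I)
      moreover have "n \<le> 7" using n by (auto dest: dvd_imp_le)
      ultimately have "n = 1 \<or> n = 2 \<or> n = 3 \<or> n = 4 \<or> n = 5 \<or> n = 6 \<or> n = 7" by linarith
      then show ?thesis using n by auto
    qed
    ultimately show ?thesis by blast
  qed
  show "right_stable_subset G A"
  proof (cases "\<exists>g h. g \<in> A \<and> h \<in> A \<and> g \<noteq> \<one> \<and> h \<noteq> \<one> \<and> g \<noteq> h")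
    case True
    then obtain g h where gh: "g \<in> A" "h \<in> A" "g \<noteq> \<one>" "h \<noteq> \<one>" "g \<noteq> h" by blast
    then have "triangle_free G {\<one>, g, h}" using chk A unfolding stable_check_def by blast
    then show ?thesis using right_stable_subset_triangle_free[OF fin A(1), of "{\<one>, g, h}"] gh A(2) by auto
  next
    case False
    then obtain g where "g \<in> carrier G" "A = {\<one>, g}" using A by blast
    then show ?thesis using right_stable_subset_pair[OF fin _ ord] by simp
  qed
qed

end

text \<open>The parameters describe \<open>C3\<close>, \<open>C4\<close>, \<open>C4 x C2\<close>,
  \<open>C5\<close>, \<open>C7\<close>, \<open>S3\<close>, \<open>D4\<close> and \<open>Q8\<close>.
  The group \<open>C3 x C3\<close> fails this test: for independent \<open>g\<close> and
  \<open>h\<close> the powers of \<open>g h\<close> form a packing of size 3 for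
  \<open>{\<one>, g, h}\<close>.\<close>

lemma stable_check_pc:
  "\<forall>(l, m, n, P, C)\<in>{(3, 1, 1, (1, 0), (0, 0)), (4, 1, 1, (1, 0), (0, 0)), (4, 2, 1, (1, 0), (0, 0)),
     (5, 1, 1, (1, 0), (0, 0)), (7, 1, 1, (1, 0), (0, 0)), (3, 1, 2, (2, 0), (0, 0)),
     (4, 1, 2, (3, 0), (0, 0)), (4, 1, 2, (3, 0), (2, 0))}.
     stable_check (pc_monoid l m n P (0, 1) C)"
  by code_simp

text \<open>For independent \<open>g\<close> and \<open>h\<close> the quotients of elements of
  \<open>{\<one>, g, h}\<close> are seven of the nine group elements. The other two are
  \<open>g h\<close> and its square.\<close>

lemma pc_33_separated:
  "\<forall>g\<in>carrier (pc_monoid 3 3 1 (1, 0) (0, 1) (0, 0)). \<forall>h\<in>carrier (pc_monoid 3 3 1 (1, 0) (0, 1) (0, 0)).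
   let M = pc_monoid 3 3 1 (1, 0) (0, 1) (0, 0) in
   if g = \<one>\<^bsub>M\<^esub> \<or> h = \<one>\<^bsub>M\<^esub> \<or> h = g \<or> h = g \<otimes>\<^bsub>M\<^esub> g then True
   else \<forall>t\<in>carrier M. if separated M {\<one>\<^bsub>M\<^esub>, g, h} \<one>\<^bsub>M\<^esub> t then t = g \<otimes>\<^bsub>M\<^esub> h \<or> t = (g \<otimes>\<^bsub>M\<^esub> h) \<otimes>\<^bsub>M\<^esub> (g \<otimes>\<^bsub>M\<^esub> h) else True"
  by code_simp

section \<open>Fixed points of p-groups, normalizers and elements of prime order\<close>

lemma group_actionI:
  fixes G (structure)
  assumes "group G"
    and closed: "\<And>g x. g \<in> carrier G \<Longrightarrow> x \<in> E \<Longrightarrow> act g x \<in> E"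
    and one: "\<And>x. x \<in> E \<Longrightarrow> act \<one>\<^bsub>G\<^esub> x = x"
    and mult: "\<And>g h x. g \<in> carrier G \<Longrightarrow> h \<in> carrier G \<Longrightarrow> x \<in> E \<Longrightarrow> act (g \<otimes>\<^bsub>G\<^esub> h) x = act g (act h x)"
  shows "group_action G E (\<lambda>g. \<lambda>x\<in>E. act g x)"
proof -
  interpret group G by fact
  have inverse: "act (inv g) (act g x) = x" "act g (act (inv g) x) = x" if "g \<in> carrier G" "x \<in> E" for g x
    using that mult[of "inv g" g x] mult[of g "inv g" x] one by simp_all
  have bij: "bij_betw (\<lambda>x\<in>E. act g x) E E" if g: "g \<in> carrier G" for g
  proof (rule bij_betwI[of _ _ _ "\<lambda>x\<in>E. act (inv g) x"])
    show "(\<lambda>x\<in>E. act g x) \<in> E \<rightarrow> E" "(\<lambda>x\<in>E. act (inv g) x) \<in> E \<rightarrow> E" using closed g by auto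
  qed (use closed inverse g in auto)
  have "(\<lambda>g. \<lambda>x\<in>E. act g x) \<in> hom G (BijGroup E)"
  proof (rule homI)
    fix g assume "g \<in> carrier G"
    then show "(\<lambda>x\<in>E. act g x) \<in> carrier (BijGroup E)"
      using bij by (simp add: BijGroup_def Bij_def)
  next
    fix g h assume gh: "g \<in> carrier G" "h \<in> carrier G"
    then have "(\<lambda>x\<in>E. act g x) \<in> Bij E" "(\<lambda>x\<in>E. act h x) \<in> Bij E" using bij by (simp_all add: Bij_def)
    then show "(\<lambda>x\<in>E. act (g \<otimes> h) x) = (\<lambda>x\<in>E. act g x) \<otimes>\<^bsub>BijGroup E\<^esub> (\<lambda>x\<in>E. act h x)"
      using gh mult closed by (auto simp: BijGroup_def compose_def restrict_def fun_eq_iff)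
  qed
  then show ?thesis
    by (simp add: group_action_def group_hom_def group_hom_axioms_def is_group group_BijGroup)
qed

text \<open>The fixed points are the one-element orbits; every other orbit has a size that divides
  \<open>p^k\<close> and exceeds 1, hence is a multiple of \<open>p\<close>.\<close>

lemma card_fixed_points_mod:
  assumes "group G" and ord: "order G = p ^ k" and p: "Factorial_Ring.prime (p::nat)" and fin: "finite E"
    and closed: "\<And>g x. g \<in> carrier G \<Longrightarrow> x \<in> E \<Longrightarrow> act g x \<in> E"
    and one: "\<And>x. x \<in> E \<Longrightarrow> act \<one>\<^bsub>G\<^esub> x = x"
    and mult: "\<And>g h x. g \<in> carrier G \<Longrightarrow> h \<in> carrier G \<Longrightarrow> x \<in> E \<Longrightarrow> act (g \<otimes>\<^bsub>G\<^esub> h) x = act g (act h x)"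
  shows "card E mod p = card {x \<in> E. \<forall>g\<in>carrier G. act g x = x} mod p"
proof -
  let ?\<phi> = "\<lambda>g. \<lambda>x\<in>E. act g x" and ?F = "{x \<in> E. \<forall>g\<in>carrier G. act g x = x}"
  interpret group G by fact
  interpret A: group_action G E ?\<phi> using group_actionI[OF assms(1) closed one mult] .
  let ?O = "orbits G E ?\<phi>"
  have orb: "orbit G ?\<phi> x = {act g x | g. g \<in> carrier G}" if "x \<in> E" for x
    using that by (auto simp: orbit_def)
  have finO: "finite ?O"
    by (rule finite_subset[of _ "Pow E"]) (use A.orbits_coverture fin in auto)
  have "card E = (\<Sum>x\<in>E. 1)" by simp
  also have "\<dots> = (\<Sum>C\<in>?O. \<Sum>x\<in>C. 1)" using A.disjoint_sum[OF fin] by metis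
  also have "\<dots> = (\<Sum>C\<in>?O. card C)" by simp
  also have "\<dots> = (\<Sum>C\<in>{C\<in>?O. card C = 1}. card C) + (\<Sum>C\<in>{C\<in>?O. card C \<noteq> 1}. card C)"
    using finO by (subst sum.union_disjoint[symmetric]) (auto intro: sum.cong)
  also have "(\<Sum>C\<in>{C\<in>?O. card C = 1}. card C) = card {C\<in>?O. card C = 1}" by simp
  also have "{C\<in>?O. card C = 1} = (\<lambda>x. {x}) ` ?F"
  proof (intro equalityI subsetI)
    fix C assume C: "C \<in> {C\<in>?O. card C = 1}"
    then obtain x where x: "x \<in> E" "C = orbit G ?\<phi> x" by (auto simp: orbits_def)
    obtain y where y: "C = {y}" using C card_1_singletonE by blast
    have "act g x = y" if "g \<in> carrier G" for g using x y orb that by auto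
    then have "x \<in> ?F" "y = x" using one[OF x(1)] x(1) by force+
    then show "C \<in> (\<lambda>x. {x}) ` ?F" using y by simp
  next
    fix C assume "C \<in> (\<lambda>x. {x}) ` ?F"
    then obtain x where x: "x \<in> ?F" "C = {x}" by blast
    then have "act \<one>\<^bsub>G\<^esub> x = x" by simp
    then have "orbit G ?\<phi> x = {x}" using x orb[of x] one_closed by (auto intro: exI[of _ "\<one>\<^bsub>G\<^esub>"])
    then show "C \<in> {C\<in>?O. card C = 1}" using x by (auto simp: orbits_def)
  qed
  also have "card ((\<lambda>x. {x}) ` ?F) = card ?F" by (rule card_image) simp
  finally have eq: "card E = card ?F + (\<Sum>C\<in>{C\<in>?O. card C \<noteq> 1}. card C)" .
  have "p dvd card C" if C: "C \<in> {C\<in>?O. card C \<noteq> 1}" for C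
  proof -
    obtain x where x: "x \<in> E" "C = orbit G ?\<phi> x" using C by (auto simp: orbits_def)
    have "card C dvd p ^ k" using A.orbit_stabilizer_theorem[OF x(1)] x ord by (metis dvd_triv_left)
    then obtain i where "card C = p ^ i" using p by (auto simp: divides_primepow_nat)
    then show ?thesis using C by (cases i) auto
  qed
  then have "p dvd (\<Sum>C\<in>{C\<in>?O. card C \<noteq> 1}. card C)" by (rule dvd_sum)
  then show ?thesis using eq by (auto elim!: dvdE)
qed

lemma power_of_prime_if_unique_prime_divisor:
  fixes n p :: nat
  assumes "n > 0" "\<And>q. Factorial_Ring.prime q \<Longrightarrow> q dvd n \<Longrightarrow> q = p"
  shows "\<exists>k. n = p ^ k"
  using assms
proof (induction n rule: less_induct)
  case (less n)
  show ?case
  proof (cases "n = 1")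
    case True
    then show ?thesis by (intro exI[of _ 0]) simp
  next
    case False
    then obtain q where q: "Factorial_Ring.prime q" "q dvd n" using prime_factor_nat by blast
    then have "q = p" using less.prems by blast
    then obtain m where m: "n = p * m" using q by blast
    then have "m < n" "m > 0" using less.prems(1) q \<open>q = p\<close> prime_gt_1_nat[of p] by auto
    then obtain k where "m = p ^ k" using less.IH[of m] less.prems(2) m by (metis dvd_mult)
    then show ?thesis using m by (intro exI[of _ "Suc k"]) simp
  qed
qed

context group
begin

lemma center_nontrivial:
  assumes fin: "finite (carrier G)" and ord: "order G = p ^ k" "k > 0" and p: "Factorial_Ring.prime (p::nat)"
  obtains z where "z \<in> carrier G" "z \<noteq> \<one>" "\<And>g. g \<in> carrier G \<Longrightarrow> g \<otimes> z = z \<otimes> g"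
proof -
  let ?F = "{x \<in> carrier G. \<forall>g\<in>carrier G. g \<otimes> x \<otimes> inv g = x}"
  have "card (carrier G) mod p = card ?F mod p"
    by (rule card_fixed_points_mod[OF is_group ord(1) p fin]) (auto simp: m_assoc inv_mult_group)
  then have "p dvd card ?F" using ord by (simp add: order_def dvd_eq_mod_eq_0) (metis dvd_imp_mod_0 dvd_power)
  then have "card ?F \<noteq> 1" using p prime_gt_1_nat by (metis nat_dvd_1_iff_1 less_irrefl)
  then have "?F \<noteq> {\<one>}" by (metis card_1_singleton_iff One_nat_def)
  moreover have "\<one> \<in> ?F" by simp
  ultimately obtain z where z: "z \<in> ?F" "z \<noteq> \<one>" by blast
  then have zG: "z \<in> carrier G" and conj: "\<And>g. g \<in> carrier G \<Longrightarrow> g \<otimes> z \<otimes> inv g = z" by auto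
  have "g \<otimes> z = z \<otimes> g" if g: "g \<in> carrier G" for g
  proof -
    have "g \<otimes> z = g \<otimes> z \<otimes> inv g \<otimes> g" using g zG by (simp add: m_assoc)
    then show ?thesis using conj[OF g] by simp
  qed
  then show ?thesis using that z by blast
qed

text \<open>Let \<open>H\<close> act on its own right cosets by right multiplication. A coset
  \<open>H x\<close> is fixed iff \<open>x\<close> conjugates \<open>H\<close> into itself. The
  number of fixed cosets is divisible by \<open>p\<close> and \<open>H\<close> is one of them, so
  there is another.\<close>

lemma normalizer_grows:
  assumes fin: "finite (carrier G)" and ord: "order G = p ^ k" and p: "Factorial_Ring.prime (p::nat)"
    and H: "subgroup H G" "H \<noteq> carrier G"
  obtains x where "x \<in> carrier G" "x \<notin> H" "\<And>h. h \<in> H \<Longrightarrow> x \<otimes> h \<otimes> inv x \<in> H"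
proof -
  interpret H: subgroup H G by fact
  let ?H = "G\<lparr>carrier := H\<rparr>" and ?E = "rcosets H"
  let ?F = "{C \<in> ?E. \<forall>h\<in>carrier ?H. C #> inv h = C}"
  have lag: "card ?E * card H = p ^ k" using lagrange[OF H(1)] ord by simp
  have grp: "group ?H" using H(1) by (simp add: subgroup_imp_group)
  obtain j where j: "card H = p ^ j" using lag p by (metis divides_primepow_nat dvd_triv_right)
  have finE: "finite ?E" using rcosets_part_G[OF H(1)] fin by (metis finite_UnionD)
  have CG: "C \<subseteq> carrier G" if "C \<in> ?E" for C using that rcosets_part_G[OF H(1)] by blast
  have "card ?E \<noteq> 1"
  proof
    assume "card ?E = 1"
    then have "card H = card (carrier G)" using lag ord by (simp add: order_def)
    then show False using H fin by (metis card_subset_eq H.subset)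
  qed
  moreover obtain i where "card ?E = p ^ i" using lag p by (metis divides_primepow_nat dvd_triv_left)
  ultimately have "p dvd card ?E" by (cases i) auto
  moreover have "card ?E mod p = card ?F mod p"
  proof (rule card_fixed_points_mod[OF grp _ p finE])
    show "order ?H = p ^ j" using j by (simp add: order_def)
  next
    fix h C assume "h \<in> carrier ?H" "C \<in> ?E"
    then obtain x where "x \<in> carrier G" "C = H #> x" by (auto simp: RCOSETS_def)
    then show "C #> inv h \<in> ?E" using \<open>h \<in> carrier ?H\<close> H.subset
      by (auto simp: coset_mult_assoc RCOSETS_def)
  next
    fix C assume "C \<in> ?E"
    then show "C #> inv \<one>\<^bsub>?H\<^esub> = C" using CG by (simp add: coset_mult_one)
  next
    fix g h C assume "g \<in> carrier ?H" "h \<in> carrier ?H" "C \<in> ?E"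
    then show "C #> inv (g \<otimes>\<^bsub>?H\<^esub> h) = C #> inv h #> inv g"
      using CG by (simp add: coset_mult_assoc inv_mult_group)
  qed
  ultimately have "p dvd card ?F" by (simp add: dvd_eq_mod_eq_0)
  then have "card ?F \<noteq> 1" using p prime_gt_1_nat by (metis nat_dvd_1_iff_1 less_irrefl)
  then have "?F \<noteq> {H}" by (metis card_1_singleton_iff One_nat_def)
  moreover have "H \<in> ?F"
    using H.subgroup_in_rcosets[OF is_group] coset_join2[OF _ H(1)] by auto
  ultimately obtain C where C: "C \<in> ?F" "C \<noteq> H" by blast
  then obtain x where x: "x \<in> carrier G" "C = H #> x" by (auto simp: RCOSETS_def)
  have "x \<notin> H" using C(2) x coset_join2[OF x(1) H(1)] by blast
  moreover have "x \<otimes> h \<otimes> inv x \<in> H" if h: "h \<in> H" for h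
  proof -
    have "\<forall>h\<in>H. C #> inv h = C" using C(1) by simp
    then have "C #> inv (inv h) = C" using h H.m_inv_closed by blast
    then have "H #> x #> inv (inv h) = H #> x" using x by simp
    then have "H #> (x \<otimes> h) = H #> x" using x h H.subset by (simp add: coset_mult_assoc)
    then have "x \<otimes> h \<in> H #> x" using rcos_self[OF _ H(1), of "x \<otimes> h"] x h by auto
    then obtain h' where "h' \<in> H" "x \<otimes> h = h' \<otimes> x" by (auto simp: r_coset_def)
    then show ?thesis using x h by (simp add: m_assoc)
  qed
  ultimately show ?thesis using that x by blast
qed

text \<open>Cauchy's theorem, from the Sylow existence theorem applied to the first power of
  \<open>q\<close>.\<close>

lemma element_of_prime_order:
  assumes fin: "finite (carrier G)" and q: "Factorial_Ring.prime (q::nat)" "q dvd order G"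
  obtains y where "y \<in> carrier G" "ord y = q"
proof -
  obtain m where "order G = q ^ 1 * m" using q by auto
  from sylow_thm[OF q(1) is_group this fin] obtain H where H: "subgroup H G" "card H = q" by auto
  have "card H \<noteq> 1" using H q prime_gt_1_nat by force
  then have "H \<noteq> {\<one>}" by auto
  then obtain y where y: "y \<in> H" "y \<noteq> \<one>" using subgroup.one_closed[OF H(1)] by blast
  have yG: "y \<in> carrier G" using y H by (simp add: subgroup.mem_carrier)
  have "y [^]\<^bsub>G\<lparr>carrier := H\<rparr>\<^esub> order (G\<lparr>carrier := H\<rparr>) = \<one>\<^bsub>G\<lparr>carrier := H\<rparr>\<^esub>"
    by (rule group.pow_order_eq_1[OF subgroup_imp_group[OF H(1)]]) (use y in simp)
  then have "y [^] q = \<one>" using H by (simp add: order_def nat_pow_consistent[symmetric])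
  then have "ord y dvd q" using yG pow_eq_id by blast
  then have "ord y = 1 \<or> ord y = q" using q(1) by (simp add: prime_nat_iff)
  then have "ord y = q" using ord_eq_1[OF yG] y by auto
  then show ?thesis using that yG by blast
qed

lemma ord_power_prime_power:
  assumes "finite (carrier G)" "z \<in> carrier G" "Factorial_Ring.prime (p::nat)" "ord z = p ^ Suc j"
  shows "ord (z [^] (p ^ j)) = p"
proof -
  have "p ^ j \<noteq> 0" using assms(3) by (simp add: prime_gt_0_nat)
  then have "ord (z [^] (p ^ j)) = p ^ Suc j div gcd (p ^ Suc j) (p ^ j)"
    using ord_pow_gen[OF assms(2), of "p ^ j"] assms(4) by simp
  also have "gcd (p ^ Suc j) (p ^ j) = p ^ j" by (simp add: gcd_nat.absorb2)
  finally show ?thesis using \<open>p ^ j \<noteq> 0\<close> by simp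
qed

lemma central_element_of_prime_order:
  assumes fin: "finite (carrier G)" and ord: "order G = p ^ k" "k > 0" and p: "Factorial_Ring.prime (p::nat)"
  obtains z where "z \<in> carrier G" "ord z = p" "\<And>g. g \<in> carrier G \<Longrightarrow> g \<otimes> z = z \<otimes> g"
proof -
  obtain z where z: "z \<in> carrier G" "z \<noteq> \<one>" "\<And>g. g \<in> carrier G \<Longrightarrow> g \<otimes> z = z \<otimes> g"
    using center_nontrivial[OF fin ord p] by metis
  have "ord z dvd p ^ k" using ord_dvd_group_order[OF z(1)] ord by simp
  then obtain i where i: "ord z = p ^ i" using p by (auto simp: divides_primepow_nat)
  have "i \<noteq> 0" using i z ord_eq_1[OF z(1)] by (metis power_0)
  then obtain j where j: "i = Suc j" using not0_implies_Suc by blast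
  have "g \<otimes> z [^] (p ^ j) = z [^] (p ^ j) \<otimes> g" if "g \<in> carrier G" for g
    using pow_commutes[of g z 1 "p ^ j"] that z by simp
  then show ?thesis
    using that[of "z [^] (p ^ j)"] ord_power_prime_power[OF fin z(1) p] i j z(1) by simp
qed

text \<open>If the order of \<open>b\<close> did not divide \<open>j\<close>, then \<open>j\<close>
  would be invertible modulo this prime, and a power of the given relation would express
  \<open>b\<close> itself as a power of \<open>a\<close>.\<close>

lemma independent_powers:
  assumes fin: "finite (carrier G)" and a: "a \<in> carrier G" and b: "b \<in> carrier G" and ab: "a \<otimes> b = b \<otimes> a"
    and p: "Factorial_Ring.prime (ord b)" and nb: "\<And>i::nat. b \<noteq> a [^] i"
    and eq: "a [^] (i::nat) \<otimes> b [^] (j::nat) = \<one>"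
  shows "ord a dvd i \<and> ord b dvd j"
proof -
  have "ord b dvd j"
  proof (rule ccontr)
    assume "\<not> ord b dvd j"
    then have "coprime j (ord b)" using p by (metis coprime_commute prime_imp_coprime)
    moreover have "ord b > 1" using p prime_gt_1_nat by blast
    moreover have "j \<noteq> 0" using \<open>\<not> ord b dvd j\<close> by (metis dvd_0_right)
    ultimately obtain c d where jc: "j * c = ord b * d + 1"
      using bezout_nat[of j "ord b"] by (auto simp: coprime_iff_gcd_eq_1)
    have "b [^] (j * c) = (b [^] ord b) [^] d \<otimes> b"
      unfolding jc using b by (simp add: nat_pow_pow del: pow_ord_eq_1)
    then have bc: "b [^] (j * c) = b" using b by simp
    have "\<one> = (a [^] i \<otimes> b [^] j) [^] c" using eq by simp
    also have "\<dots> = (a [^] i) [^] c \<otimes> (b [^] j) [^] c"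
      using a b by (intro pow_mult_distrib pow_commutes[OF a b ab]) auto
    also have "\<dots> = a [^] (i * c) \<otimes> b" using a b bc by (simp add: nat_pow_pow)
    finally have "b = inv (a [^] (i * c))" using a b by (metis inv_equality inv_inv nat_pow_closed inv_closed)
    moreover have "inv (a [^] n) = a [^] (n * (ord a - 1))" for n :: nat
    proof -
      have "ord a \<noteq> 0" using ord_ge_1[OF fin a] by simp
      then have "a [^] (n * (ord a - 1)) \<otimes> a [^] n = a [^] (n * ord a)"
        using a by (simp add: nat_pow_mult algebra_simps)
      also have "\<dots> = \<one>" using a by (metis mult.commute nat_pow_one nat_pow_pow pow_ord_eq_1)
      finally show ?thesis using a by (simp add: inv_equality)
    qed
    ultimately show False using nb by metis
  qed
  moreover from this have "b [^] j = \<one>" using b pow_eq_id by blast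
  then have "a [^] i = \<one>" using eq a by simp
  then have "ord a dvd i" using a pow_eq_id by blast
  ultimately show ?thesis by simp
qed

lemma centralizer_subgroup:
  assumes "x \<in> carrier G"
  shows "subgroup {g \<in> carrier G. g \<otimes> x = x \<otimes> g} G"
proof (rule subgroupI)
  fix g assume g: "g \<in> {g \<in> carrier G. g \<otimes> x = x \<otimes> g}"
  then have gG: "g \<in> carrier G" and gx: "g \<otimes> x = x \<otimes> g" by auto
  have "x \<otimes> inv g = inv g \<otimes> (g \<otimes> x) \<otimes> inv g" using gG assms by (simp add: m_assoc[symmetric])
  also have "\<dots> = inv g \<otimes> x" unfolding gx using gG assms by (simp add: m_assoc)
  finally have "x \<otimes> inv g = inv g \<otimes> x" .
  then show "inv g \<in> {g \<in> carrier G. g \<otimes> x = x \<otimes> g}" using g by simp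
next
  fix g h assume gh: "g \<in> {g \<in> carrier G. g \<otimes> x = x \<otimes> g}" "h \<in> {g \<in> carrier G. g \<otimes> x = x \<otimes> g}"
  then have cG: "g \<in> carrier G" "h \<in> carrier G" and gx: "g \<otimes> x = x \<otimes> g" and hx: "h \<otimes> x = x \<otimes> h" by auto
  have "g \<otimes> h \<otimes> x = g \<otimes> (h \<otimes> x)" using cG assms by (simp add: m_assoc)
  also have "\<dots> = (g \<otimes> x) \<otimes> h" unfolding hx using cG assms by (simp add: m_assoc)
  also have "\<dots> = x \<otimes> (g \<otimes> h)" unfolding gx using cG assms by (simp add: m_assoc)
  finally show "g \<otimes> h \<in> {g \<in> carrier G. g \<otimes> x = x \<otimes> g}" using cG by simp
qed (use assms in auto)

lemma powers_product_subgroup: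
  assumes fin: "finite (carrier G)" and ab: "a \<in> carrier G" "b \<in> carrier G" "a \<otimes> b = b \<otimes> a"
  shows "subgroup {a [^] (i::nat) \<otimes> b [^] (j::nat) | i j. i < ord a \<and> j < ord b} G"
    (is "subgroup ?K G")
proof -
  have pos: "ord a > 0" "ord b > 0" using ord_ge_1[OF fin] ab by (simp_all add: Suc_le_eq)
  have mem: "a [^] (i::nat) \<otimes> b [^] (j::nat) \<in> ?K" for i j
  proof -
    have "a [^] i \<otimes> b [^] j = a [^] (i mod ord a) \<otimes> b [^] (j mod ord b)"
      using ab pow_mod_eq[OF ab(1) pow_ord_eq_1[OF ab(1)]] pow_mod_eq[OF ab(2) pow_ord_eq_1[OF ab(2)]] by simp
    moreover have "i mod ord a < ord a" "j mod ord b < ord b" using pos by simp_all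
    ultimately show ?thesis by blast
  qed
  have mult: "a [^] i \<otimes> b [^] j \<otimes> (a [^] i' \<otimes> b [^] j') = a [^] (i + i') \<otimes> b [^] (j + j')" for i j i' j' :: nat
  proof -
    have "a [^] i \<otimes> b [^] j \<otimes> (a [^] i' \<otimes> b [^] j') = a [^] i \<otimes> (b [^] j \<otimes> a [^] i') \<otimes> b [^] j'"
      using ab by (simp add: m_assoc)
    also have "b [^] j \<otimes> a [^] i' = a [^] i' \<otimes> b [^] j" using pow_commutes[OF ab] by simp
    finally show ?thesis using ab by (simp add: m_assoc nat_pow_mult[symmetric])
  qed
  show ?thesis
  proof (rule subgroupI)
    fix x y assume "x \<in> ?K" "y \<in> ?K"
    then show "x \<otimes> y \<in> ?K" using mult mem by force
  next
    fix x assume "x \<in> ?K"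
    then obtain i j where x: "x = a [^] i \<otimes> b [^] j" "i < ord a" "j < ord b" by blast
    have "a [^] (ord a - i) \<otimes> b [^] (ord b - j) \<otimes> x = \<one>"
      unfolding x(1) mult using x(2,3) ab by simp
    then have "inv x = a [^] (ord a - i) \<otimes> b [^] (ord b - j)"
      using x ab by (simp add: inv_equality)
    then show "inv x \<in> ?K" using mem by simp
  qed (use ab pos in auto)
qed

end

section \<open>Presentations from normalizing elements\<close>

context group
begin

text \<open>Conjugation by \<open>x\<close> preserves orders, which restricts the parameters to
  those of the table: \<open>a^2\<close> goes to \<open>a^(2p)\<close>, so \<open>p\<close> is odd;
  \<open>b^2 = \<one>\<close> goes to \<open>a^(2r)\<close>, so \<open>r\<close> is even;
  \<open>s = 0\<close> would give \<open>b = a^r\<close>; and \<open>x^4 = a^(2u)\<close> makes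
  \<open>u\<close> even.\<close>

lemma pc_16_not_stable':
  assumes fin: "finite (carrier G)" and rel: "pc_relations G a b x 4 2 2 (p, q) (r, s) (u, v)"
    and x4: "x [^] (4::nat) = \<one>"
    and par: "p < 4" "q < 2" "r < 4" "s < 2" "u < 4" "v < 2"
  shows "\<not> stable_group G"
proof -
  have c: "a \<in> carrier G" "b \<in> carrier G" "x \<in> carrier G" and ab: "a \<otimes> b = b \<otimes> a"
    and b2: "b [^] (2::nat) = \<one>"
    and xa: "x \<otimes> a = a [^] p \<otimes> b [^] q \<otimes> x" and xb: "x \<otimes> b = a [^] r \<otimes> b [^] s \<otimes> x"
    and x2: "x [^] (2::nat) = a [^] u \<otimes> b [^] v"
    and indep: "\<And>(i::nat) (j::nat). a [^] i \<otimes> b [^] j = \<one> \<Longrightarrow> 4 dvd i \<and> 2 dvd j"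
    and a4: "a [^] (4::nat) = \<one>"
    using rel unfolding pc_relations_def by auto
  have square: "(a [^] i \<otimes> b [^] j) [^] (2::nat) = a [^] (i * 2)" for i j :: nat
  proof -
    have "(a [^] i \<otimes> b [^] j) [^] (2::nat) = a [^] (i * 2) \<otimes> b [^] (j * 2)"
      using c pow_mult_distrib[OF pow_commutes[OF c(1,2) ab], of i j 2] by (simp add: nat_pow_pow)
    also have "b [^] (j * 2) = (b [^] (2::nat)) [^] j" using c by (simp add: nat_pow_pow mult.commute)
    finally show ?thesis using b2 c by simp
  qed
  have a_dvd: "4 dvd i" if "a [^] (i::nat) = \<one>" for i using indep[of i 0] that c by simp
  have a_mod: "a [^] (i mod 4) = a [^] i" for i :: nat using pow_mod_eq[OF c(1) a4] .
  have xa2: "x \<otimes> a [^] (2::nat) = a [^] (p * 2) \<otimes> x"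
    using conj_pow[OF c(3,1) _ xa, of 2] c by (simp only: square nat_pow_closed m_closed)
  have "odd p"
  proof
    assume "even p"
    then have "a [^] (p * 2) = \<one>" using a_mod[of "p * 2"] by auto
    then have "x \<otimes> a [^] (2::nat) = x \<otimes> \<one>" using xa2 c by simp
    then have "a [^] (2::nat) = \<one>" using c by (simp only: l_cancel nat_pow_closed one_closed)
    then show False using a_dvd[of 2] by simp
  qed
  then have p: "p \<in> {1, 3}" using par(1) by (auto, presburger)
  have "a [^] (p * 2) = a [^] (2::nat)" using a_mod[of "p * 2"] p by auto
  then have xa2': "x \<otimes> a [^] (2::nat) = a [^] (2::nat) \<otimes> x" using xa2 by simp
  have "x \<otimes> b [^] (2::nat) = a [^] (r * 2) \<otimes> x"
    using conj_pow[OF c(3,2) _ xb, of 2] c by (simp only: square nat_pow_closed m_closed)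
  then have "a [^] (r * 2) \<otimes> x = \<one> \<otimes> x" using b2 c by simp
  then have "a [^] (r * 2) = \<one>" using c by (simp only: r_cancel nat_pow_closed one_closed)
  then have "4 dvd r * 2" by (rule a_dvd)
  then have "r = 0 \<or> r = 2" using par(3) by presburger
  then have r: "r \<in> {0, 2}" by simp
  have "s \<noteq> 0"
  proof
    assume "s = 0"
    then have "x \<otimes> b = a [^] r \<otimes> x" using xb c by simp
    also have "\<dots> = x \<otimes> a [^] r" using r xa2' c by auto
    finally have "b = a [^] r" using c by (simp only: l_cancel nat_pow_closed)
    then have "a [^] r \<otimes> b [^] (1::nat) = \<one>" using b2 c by (simp add: numeral_2_eq_2)
    then show False using indep[of r 1] by simp
  qed
  then have s: "s = 1" using par(4) by simp
  have "a [^] (u * 2) = (x [^] (2::nat)) [^] (2::nat)" unfolding x2 square ..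
  also have "\<dots> = \<one>" using x4 c by (simp add: nat_pow_pow)
  finally have "4 dvd u * 2" by (rule a_dvd)
  then have "u = 0 \<or> u = 2" using par(5) by presburger
  then have u: "u \<in> {0, 2}" by simp
  have "q \<in> {0, 1}" "v \<in> {0, 1}" using par(2,6) by auto
  then show ?thesis using pc_16_not_stable[OF fin rel[unfolded s] p _ r u] by blast
qed

lemma nat_pow_mem_subgroup: "subgroup K G \<Longrightarrow> x \<in> K \<Longrightarrow> x [^] (n::nat) \<in> K"
  by (induction n) (auto simp: subgroup.one_closed subgroup.m_closed)

definition powers_product :: "'a \<Rightarrow> 'a \<Rightarrow> 'a set" where
  "powers_product a b = {a [^] (i::nat) \<otimes> b [^] (j::nat) | i j. i < ord a \<and> j < ord b}"

lemma powers_productE: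
  assumes "x \<in> powers_product a b"
  obtains i j :: nat where "x = a [^] i \<otimes> b [^] j" "i < ord a" "j < ord b"
  using assms unfolding powers_product_def by blast

lemma subgroup_powers_product:
  assumes "finite (carrier G)" "a \<in> carrier G" "b \<in> carrier G" "a \<otimes> b = b \<otimes> a"
  shows "subgroup (powers_product a b) G"
  unfolding powers_product_def by (rule powers_product_subgroup[OF assms])

lemma powers_product_mem:
  assumes "finite (carrier G)" "a \<in> carrier G" "b \<in> carrier G"
  shows "a [^] (i::nat) \<otimes> b [^] (j::nat) \<in> powers_product a b"
proof -
  have "a [^] i \<otimes> b [^] j = a [^] (i mod ord a) \<otimes> b [^] (j mod ord b)"
    using assms pow_mod_eq[of a "ord a" i] pow_mod_eq[of b "ord b" j] by simp
  moreover have "i mod ord a < ord a" "j mod ord b < ord b"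
    using ord_ge_1[OF assms(1)] assms by (simp_all add: Suc_le_eq)
  ultimately show ?thesis unfolding powers_product_def by blast
qed

lemma card_powers_product: "card (powers_product a b) \<le> ord a * ord b"
proof -
  have "powers_product a b = (\<lambda>(i, j). a [^] i \<otimes> b [^] j) ` ({..<ord a} \<times> {..<ord b})"
    by (auto simp: powers_product_def)
  also have "card \<dots> \<le> card ({..<ord a} \<times> {..<ord b})" by (rule card_image_le) simp
  finally show ?thesis by (simp add: card_cartesian_product)
qed

text \<open>As \<open>n\<close> is prime, \<open>x\<close> alone has to be tested: if
  \<open>x^k\<close> with \<open>0 < k < n\<close> lay in the subgroup of words in \<open>a\<close>
  and \<open>b\<close>, which contains \<open>x^n\<close>, Bezout would put \<open>x\<close> there
  too.\<close>

lemma pc_relationsI: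
  assumes fin: "finite (carrier G)" and c: "a \<in> carrier G" "b \<in> carrier G" "x \<in> carrier G"
    and ab: "a \<otimes> b = b \<otimes> a"
    and indep: "\<And>(i::nat) (j::nat). a [^] i \<otimes> b [^] j = \<one> \<Longrightarrow> ord a dvd i \<and> ord b dvd j"
    and n: "Factorial_Ring.prime n" and x: "x \<notin> powers_product a b"
    and xa: "x \<otimes> a = a [^] p \<otimes> b [^] q \<otimes> x" and xb: "x \<otimes> b = a [^] r \<otimes> b [^] s \<otimes> x"
    and xn: "x [^] n = a [^] u \<otimes> b [^] v"
  shows "pc_relations G a b x (ord a) (ord b) n (p, q) (r, s) (u, v)"
proof -
  have K: "subgroup (powers_product a b) G" by (rule subgroup_powers_product[OF fin c(1,2) ab])
  have "x [^] k \<noteq> a [^] i \<otimes> b [^] j" if k: "0 < k" "k < n" for k i j :: nat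
  proof
    assume "x [^] k = a [^] i \<otimes> b [^] j"
    then have xk: "x [^] k \<in> powers_product a b" by (simp only: powers_product_mem[OF fin c(1,2)])
    have "coprime n k" using n k by (metis dvd_imp_le leD prime_imp_coprime)
    then obtain c' d where "k * c' = n * d + 1"
      using bezout_nat[of k n] k by (auto simp: coprime_iff_gcd_eq_1 gcd.commute)
    then have "x [^] (k * c') = x [^] (n * d) \<otimes> x" by simp
    then have "(x [^] k) [^] c' = (x [^] n) [^] d \<otimes> x" using c by (simp add: nat_pow_pow)
    then have eq: "x = inv ((x [^] n) [^] d) \<otimes> (x [^] k) [^] c'"
      using c by (metis inv_solve_left nat_pow_closed)
    have "x [^] n \<in> powers_product a b" unfolding xn by (rule powers_product_mem[OF fin c(1,2)])
    then have "inv ((x [^] n) [^] d) \<in> powers_product a b"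
      by (rule subgroup.m_inv_closed[OF K nat_pow_mem_subgroup[OF K]])
    then have "inv ((x [^] n) [^] d) \<otimes> (x [^] k) [^] c' \<in> powers_product a b"
      by (rule subgroup.m_closed[OF K _ nat_pow_mem_subgroup[OF K xk]])
    then show False using x eq by simp
  qed
  moreover have "ord a > 0" "ord b > 0" "n > 0"
    using ord_ge_1[OF fin] c n prime_gt_0_nat by (auto simp: Suc_le_eq)
  ultimately show ?thesis using c ab indep xa xb xn by (simp add: pc_relations_def)
qed

lemma pc_relations_exist:
  assumes fin: "finite (carrier G)" and c: "a \<in> carrier G" "b \<in> carrier G" "x \<in> carrier G"
    and ab: "a \<otimes> b = b \<otimes> a"
    and indep: "\<And>(i::nat) (j::nat). a [^] i \<otimes> b [^] j = \<one> \<Longrightarrow> ord a dvd i \<and> ord b dvd j"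
    and n: "Factorial_Ring.prime n" and x: "x \<notin> powers_product a b"
    and norm: "\<And>h. h \<in> powers_product a b \<Longrightarrow> x \<otimes> h \<otimes> inv x \<in> powers_product a b"
    and xn: "x [^] n \<in> powers_product a b"
  obtains p q r s u v where "pc_relations G a b x (ord a) (ord b) n (p, q) (r, s) (u, v)"
    "p < ord a" "q < ord b" "r < ord a" "s < ord b" "u < ord a" "v < ord b"
    "x \<otimes> a = a [^] p \<otimes> b [^] q \<otimes> x"
proof -
  have mem: "a \<in> powers_product a b" "b \<in> powers_product a b"
    using powers_product_mem[OF fin c(1,2), of 1 0] powers_product_mem[OF fin c(1,2), of 0 1] c by simp_all
  obtain p q where pq: "x \<otimes> a \<otimes> inv x = a [^] p \<otimes> b [^] q" "p < ord a" "q < ord b"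
    using norm[OF mem(1)] by (elim powers_productE)
  obtain r s where rs: "x \<otimes> b \<otimes> inv x = a [^] r \<otimes> b [^] s" "r < ord a" "s < ord b"
    using norm[OF mem(2)] by (elim powers_productE)
  obtain u v where uv: "x [^] n = a [^] u \<otimes> b [^] v" "u < ord a" "v < ord b" using xn by (elim powers_productE)
  have eq: "x \<otimes> y = x \<otimes> y \<otimes> inv x \<otimes> x" if "y \<in> carrier G" for y using c that by (simp add: m_assoc)
  have xa: "x \<otimes> a = a [^] p \<otimes> b [^] q \<otimes> x" using eq[OF c(1)] pq by simp
  have xb: "x \<otimes> b = a [^] r \<otimes> b [^] s \<otimes> x" using eq[OF c(2)] rs by simp
  show ?thesis
    by (rule that[OF pc_relationsI[OF fin c ab indep n x xa xb uv(1)] pq(2,3) rs(2,3) uv(2,3) xa])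
qed

text \<open>Smaller numbers of generators are squeezed into the same format by trivial ones:
  \<open>x = \<one>\<close> with \<open>n = 1\<close> for abelian groups, and
  \<open>b = \<one>\<close> with \<open>m = 1\<close> in the cyclic and metacyclic cases.\<close>

lemma pc_relations_abelianI:
  assumes fin: "finite (carrier G)" and c: "a \<in> carrier G" "b \<in> carrier G"
    and ab: "a \<otimes> b = b \<otimes> a"
    and indep: "\<And>(i::nat) (j::nat). a [^] i \<otimes> b [^] j = \<one> \<Longrightarrow> ord a dvd i \<and> ord b dvd j"
  shows "pc_relations G a b \<one> (ord a) (ord b) 1 (1, 0) (0, 1) (0, 0)"
  using c ab indep ord_ge_1[OF fin c(1)] ord_ge_1[OF fin c(2)] by (simp add: pc_relations_def)

lemma pc_relations_cyclicI:
  assumes fin: "finite (carrier G)" and c: "a \<in> carrier G"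
  shows "pc_relations G a \<one> \<one> (ord a) 1 1 (1, 0) (0, 1) (0, 0)"
proof -
  have "pc_relations G a \<one> \<one> (ord a) (ord \<one>) 1 (1, 0) (0, 1) (0, 0)"
    by (rule pc_relations_abelianI[OF fin c]) (use c pow_eq_id[OF c] in simp_all)
  then show ?thesis by simp
qed

lemma pc_relations_metacyclicI:
  assumes fin: "finite (carrier G)" and c: "a \<in> carrier G" "x \<in> carrier G"
    and n: "Factorial_Ring.prime n" and x: "\<And>i::nat. x \<noteq> a [^] i"
    and xa: "x \<otimes> a = a [^] p \<otimes> x" and xn: "x [^] n = a [^] (u::nat)"
  shows "pc_relations G a \<one> x (ord a) 1 n (p, 0) (0, 1) (u, 0)"
proof -
  have "pc_relations G a \<one> x (ord a) (ord \<one>) n (p, 0) (0, 1) (u, 0)"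
    by (rule pc_relationsI[OF fin c(1) _ c(2) _ _ n]) (use c pow_eq_id[OF c(1)] x xa xn in \<open>simp_all add: powers_product_def\<close>)
  then show ?thesis by simp
qed

section \<open>Stable p-groups for odd p\<close>

lemma stable_prime_divisor:
  assumes "stable_group G" "finite (carrier G)" "Factorial_Ring.prime q" "q dvd order G"
  shows "q \<in> {2, 3, 5, 7}"
proof -
  obtain y where "y \<in> carrier G" "ord y = q" using element_of_prime_order[OF assms(2-4)] by blast
  then have "q \<in> {1, 2, 3, 4, 5, 7}" using stable_group_ord[OF assms(1,2)] by blast
  moreover have "q \<noteq> 1" using assms(3) by auto
  moreover have "q \<noteq> 4" using assms(3) prime_nat_iff[of q] by (metis dvd_triv_left mult_2 numeral_Bit0 numeral_eq_one_iff numeral_eq_iff semiring_norm(85) semiring_norm(87) mult_2_right)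
  ultimately show ?thesis by blast
qed

text \<open>The square of an odd prime is at least 9, which exceeds every admissible element
  order.\<close>

lemma ord_odd_p_group:
  assumes "stable_group G" "finite (carrier G)" "order G = p ^ k" "Factorial_Ring.prime p" "p \<noteq> 2"
    "g \<in> carrier G" "g \<noteq> \<one>"
  shows "ord g = p"
proof -
  have "ord g dvd p ^ k" using ord_dvd_group_order[OF assms(6)] assms(3) by simp
  then obtain i where i: "ord g = p ^ i" using assms(4) by (auto simp: divides_primepow_nat)
  have "i \<noteq> 0" using i ord_eq_1[OF assms(6)] assms(7) by (metis power_0)
  have p3: "p \<ge> 3" using assms(4,5) prime_ge_2_nat[of p] by linarith
  have "i < 2"
  proof (rule ccontr)
    assume "\<not> i < 2"
    then have "p ^ 2 \<le> p ^ i" using p3 by (intro power_increasing) auto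
    moreover have "3 ^ 2 \<le> p ^ 2" using p3 by (intro power_mono) auto
    moreover have "ord g \<le> 7" using stable_group_ord[OF assms(1,2,6)] by auto
    ultimately show False using i by simp
  qed
  then show ?thesis using i \<open>i \<noteq> 0\<close> by (cases i) auto
qed

lemma powers_ne_carrier:
  assumes "finite (carrier G)" "z \<in> carrier G" "ord z < order G"
  obtains a where "a \<in> carrier G" "\<And>i::nat. a \<noteq> z [^] i"
proof -
  have "card (generate G {z}) < card (carrier G)"
    using generate_pow_card[OF assms(2)] assms(3) by (simp add: order_def)
  then have "\<not> carrier G \<subseteq> generate G {z}"
    using generate_incl[of "{z}"] assms card_mono finite_subset by (metis empty_subsetI insert_subset leD)
  then show ?thesis
    using that generate_pow_on_finite_carrier[OF assms(1,2)] by blast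
qed

text \<open>Take \<open>z\<close> central of order \<open>p\<close> and for \<open>a\<close> any
  element outside the powers of \<open>z\<close>; it has order \<open>p\<close> because all
  nontrivial elements do. Independence is recorded for both orders of the generators, as
  \<open>z\<close> comes first in rank 2 and second in the groups of order 27.\<close>

lemma commuting_pair:
  assumes st: "stable_group G" and fin: "finite (carrier G)"
    and p: "order G = p ^ k" "Factorial_Ring.prime p" "p \<noteq> 2" "k \<ge> 2"
  obtains z a where "z \<in> carrier G" "ord z = p" "a \<in> carrier G" "ord a = p" "z \<noteq> \<one>"
    "\<And>g. g \<in> carrier G \<Longrightarrow> g \<otimes> z = z \<otimes> g"
    "\<And>(i::nat) (j::nat). z [^] i \<otimes> a [^] j = \<one> \<Longrightarrow> ord z dvd i \<and> ord a dvd j"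
    "\<And>(i::nat) (j::nat). a [^] i \<otimes> z [^] j = \<one> \<Longrightarrow> ord a dvd i \<and> ord z dvd j"
    "\<And>i::nat. a \<noteq> z [^] i"
proof -
  obtain z where z: "z \<in> carrier G" "ord z = p" "\<And>g. g \<in> carrier G \<Longrightarrow> g \<otimes> z = z \<otimes> g"
    using central_element_of_prime_order[OF fin p(1) _ p(2)] p(4) by (metis less_le_trans zero_less_numeral)
  have "p ^ 1 < p ^ k" using p prime_gt_1_nat by (intro power_strict_increasing) auto
  then obtain a where a: "a \<in> carrier G" "\<And>i::nat. a \<noteq> z [^] i"
    using powers_ne_carrier[OF fin z(1)] z(2) p(1) by auto
  have "a \<noteq> \<one>" using a(2)[of 0] by simp
  then have oa: "ord a = p" using ord_odd_p_group[OF st fin p(1-3) a(1)] by blast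
  have indep: "ord z dvd i \<and> ord a dvd j" if "z [^] i \<otimes> a [^] j = \<one>" for i j :: nat
    using independent_powers[OF fin z(1) a(1) _ _ a(2) that] z(3)[OF a(1)] oa p(2) by simp
  moreover have "ord a dvd i \<and> ord z dvd j" if "a [^] i \<otimes> z [^] j = \<one>" for i j :: nat
    using indep[of j i] that pow_commutes[OF a(1) z(1) z(3)[OF a(1)], of i j] by simp
  moreover have "z \<noteq> \<one>" using z(2) p(2) by auto
  ultimately show ?thesis using that[OF z(1,2) a(1) oa] z(3) a(2) by blast
qed

lemma stable_5_or_7_group:
  assumes st: "stable_group G" and fin: "finite (carrier G)"
    and p: "order G = p ^ k" "p = 5 \<or> p = 7"
  shows "k \<le> 1"
proof (rule ccontr)
  assume "\<not> k \<le> 1"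
  moreover have "Factorial_Ring.prime (5::nat)" "Factorial_Ring.prime (7::nat)" by (simp_all add: prime_nat_numeral_eq)
  ultimately obtain z a where za: "z \<in> carrier G" "ord z = p" "a \<in> carrier G" "ord a = p"
    "\<And>g. g \<in> carrier G \<Longrightarrow> g \<otimes> z = z \<otimes> g"
    "\<And>(i::nat) (j::nat). z [^] i \<otimes> a [^] j = \<one> \<Longrightarrow> ord z dvd i \<and> ord a dvd j"
    using commuting_pair[OF st fin p(1)] p(2) by (metis not_less_eq_eq numeral_2_eq_2 One_nat_def numeral_eq_iff semiring_norm(85,87,88))
  have "pc_relations G z a \<one> p p 1 (1, 0) (0, 1) (0, 0)"
    using pc_relations_abelianI[OF fin za(1,3) _ za(6)] za(5)[OF za(3)] za(2,4) by simp
  then show False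
    using p(2) st pc_not_stable_witness[OF fin _ unstable_pc_C55] pc_not_stable_witness[OF fin _ unstable_pc_C77]
    by metis
qed

text \<open>Some \<open>x\<close> outside the subgroup \<open>C3 x C3\<close> generated by
  \<open>a\<close> and \<open>z\<close> normalizes it, with \<open>x a = a^t z^s x\<close>. Here
  \<open>t = 0\<close> would make \<open>a\<close> a power of \<open>z\<close>, and
  \<open>t = 2\<close> is impossible for an element of order 3. The three values of \<open>s\<close>
  with \<open>t = 1\<close> are the tables of order 27.\<close>

lemma stable_3_group:
  assumes st: "stable_group G" and fin: "finite (carrier G)" and ord: "order G = 3 ^ k"
  shows "k \<le> 2"
proof (rule ccontr)
  assume k: "\<not> k \<le> 2"
  have p3: "Factorial_Ring.prime (3::nat)" by (simp add: prime_nat_numeral_eq)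
  obtain z a where za: "z \<in> carrier G" "ord z = 3" "a \<in> carrier G" "ord a = 3" "z \<noteq> \<one>"
    "\<And>g. g \<in> carrier G \<Longrightarrow> g \<otimes> z = z \<otimes> g"
    "\<And>(i::nat) (j::nat). a [^] i \<otimes> z [^] j = \<one> \<Longrightarrow> ord a dvd i \<and> ord z dvd j"
    "\<And>i::nat. a \<noteq> z [^] i"
    using commuting_pair[OF st fin ord p3] k by (metis nat_le_linear numeral_eq_iff semiring_norm(88))
  note az = za(6)[OF za(3)]
  have K: "subgroup (powers_product a z) G" by (rule subgroup_powers_product[OF fin za(3,1) az])
  have "(3::nat) ^ 3 \<le> 3 ^ k" using k by (intro power_increasing) auto
  then have "powers_product a z \<noteq> carrier G"
    using card_powers_product[of a z] za(2,4) ord by (auto simp: order_def)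
  then obtain x where x: "x \<in> carrier G" "x \<notin> powers_product a z"
    "\<And>h. h \<in> powers_product a z \<Longrightarrow> x \<otimes> h \<otimes> inv x \<in> powers_product a z"
    using normalizer_grows[OF fin ord p3 K] by metis
  have "x \<noteq> \<one>" using x(2) subgroup.one_closed[OF K] by blast
  then have "x [^] (3::nat) = \<one>" using ord_odd_p_group[OF st fin ord p3 _ x(1)] x(1) by (metis pow_ord_eq_1 numeral_eq_iff semiring_norm(88))
  then have x3: "x [^] (3::nat) = a [^] (0::nat) \<otimes> z [^] (0::nat)" by simp
  have "a \<in> powers_product a z" using powers_product_mem[OF fin za(3,1), of 1 0] za(1,3) by simp
  then have "x \<otimes> a \<otimes> inv x \<in> powers_product a z" by (rule x(3))
  then obtain t s :: nat where ts: "x \<otimes> a \<otimes> inv x = a [^] t \<otimes> z [^] s" "t < 3" "s < 3"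
  proof (rule powers_productE)
    fix i j :: nat assume "x \<otimes> a \<otimes> inv x = a [^] i \<otimes> z [^] j" "i < ord a" "j < ord z"
    then show thesis using that za(2,4) by simp
  qed
  have "x \<otimes> a = x \<otimes> a \<otimes> inv x \<otimes> x" using x(1) za(3) by (simp add: m_assoc)
  then have xa: "x \<otimes> a = a [^] t \<otimes> z [^] s \<otimes> x" using ts(1) by simp
  have xz: "x \<otimes> z = a [^] (0::nat) \<otimes> z [^] (1::nat) \<otimes> x" using za(1) za(6)[OF x(1)] by simp
  have rel: "pc_relations G a z x 3 3 3 (t, s) (0, 1) (0, 0)"
    using pc_relationsI[OF fin za(3,1) x(1) az za(7) p3 x(2) xa xz x3] za(2,4) by simp
  have "t \<noteq> 0"
  proof
    assume "t = 0"
    then have "x \<otimes> a = x \<otimes> z [^] s"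
      using xa za(1) x(1) pow_commutes[OF x(1) za(1) za(6)[OF x(1)], of 1 s] by simp
    then have "a = z [^] s" using x(1) za(1,3) by (simp only: l_cancel nat_pow_closed)
    then show False using za(8) by blast
  qed
  \<comment> \<open>With \<open>t = 2\<close>, conjugation by \<open>x\<close> is of order 2 on
    \<open>a\<close> modulo \<open>z\<close>; the powers of \<open>z\<close> cancel as well, so
    \<open>x^2\<close> commutes with \<open>a\<close>. Then so does \<open>x = (x^2)^2\<close>, and
    cancellation gives \<open>a z^s = \<one>\<close>.\<close>
  moreover have "t \<noteq> 2"
  proof
    assume t: "t = 2"
    have zcomm: "y \<otimes> z [^] j = z [^] j \<otimes> y" if "y \<in> carrier G" for y and j :: nat
      using pow_commutes[OF that za(1) za(6)[OF that], of 1 j] that by simp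
    have a3: "a [^] (3::nat) = \<one>" and z3: "z [^] (3::nat) = \<one>"
      using pow_ord_eq_1[OF za(3)] pow_ord_eq_1[OF za(1)] za(2,4) by simp_all
    have z3s: "z [^] (s * 2) \<otimes> z [^] s = \<one>"
    proof -
      have "z [^] (s * 2) \<otimes> z [^] s = (z [^] (3::nat)) [^] s"
        using za(1) by (simp only: nat_pow_mult nat_pow_pow) (simp add: mult.commute)
      then show ?thesis using z3 by simp
    qed
    have "x \<otimes> a [^] (2::nat) = (a [^] (2::nat) \<otimes> z [^] s) [^] (2::nat) \<otimes> x"
      using conj_pow[OF x(1) za(3) _ xa, of 2] x(1) za(1,3) t by simp
    also have "(a [^] (2::nat) \<otimes> z [^] s) [^] (2::nat) = a [^] (4::nat) \<otimes> z [^] (s * 2)"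
      using za(1,3) pow_mult_distrib[OF zcomm, of "a [^] (2::nat)" s 2] by (simp add: nat_pow_pow)
    also have "a [^] (4::nat) = a" using pow_mod_eq[OF za(3) a3, of 4] za(3) by simp
    finally have xaa: "x \<otimes> a [^] (2::nat) = a \<otimes> z [^] (s * 2) \<otimes> x" .
    have "x \<otimes> (x \<otimes> a) = x \<otimes> a [^] (2::nat) \<otimes> (z [^] s \<otimes> x)" unfolding xa t using x(1) za(1,3) by (simp add: m_assoc)
    also have "\<dots> = a \<otimes> z [^] (s * 2) \<otimes> (x \<otimes> z [^] s) \<otimes> x" unfolding xaa using x(1) za(1,3) by (simp add: m_assoc)
    also have "\<dots> = a \<otimes> (z [^] (s * 2) \<otimes> z [^] s) \<otimes> (x \<otimes> x)"
      unfolding zcomm[OF x(1)] using x(1) za(1,3) by (simp add: m_assoc)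
    finally have xxa: "x \<otimes> x \<otimes> a = a \<otimes> (x \<otimes> x)" using z3s x(1) za(3) by (simp add: m_assoc)
    have xx: "(x \<otimes> x) [^] (2::nat) = x"
    proof -
      have "(x \<otimes> x) [^] (2::nat) = x [^] (4::nat)" using x(1) by (simp add: numeral_eq_Suc m_assoc)
      then show ?thesis using pow_mod_eq[OF x(1), of 3 4] x3 x(1) by simp
    qed
    have "x \<otimes> a = a \<otimes> x"
      using pow_commutes[of "x \<otimes> x" a 2 1] x(1) za(3) xxa xx by simp
    then have "a [^] (2::nat) \<otimes> z [^] s \<otimes> x = a \<otimes> x" using xa t by simp
    then have "a [^] (2::nat) \<otimes> z [^] s = a" using x(1) za(1,3) by (simp only: r_cancel nat_pow_closed m_closed)
    then have "a \<otimes> (a \<otimes> z [^] s) = a \<otimes> \<one>" using za(1,3) by (simp add: numeral_2_eq_2 m_assoc)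
    then have "a \<otimes> z [^] s = \<one>" using za(1,3) by (simp only: l_cancel nat_pow_closed m_closed one_closed)
    then show False using za(7)[of 1 s] za(3,4) by simp
  qed
  ultimately have "t = 1" using ts(2) by linarith
  moreover have "s = 0 \<or> s = 1 \<or> s = 2" using ts(3) by linarith
  ultimately show False
    using rel st pc_not_stable_witness[OF fin _ unstable_pc_27_0] pc_not_stable_witness[OF fin _ unstable_pc_27_1]
      pc_not_stable_witness[OF fin _ unstable_pc_27_2] by metis
qed

end

section \<open>Stable 2-groups with an element of order 4\<close>

definition has_pc_presentation ::
  "('a, 'b) monoid_scheme \<Rightarrow> nat \<Rightarrow> nat \<Rightarrow> nat \<Rightarrow> nat \<times> nat \<Rightarrow> nat \<times> nat \<Rightarrow> nat \<times> nat \<Rightarrow> bool" where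
  "has_pc_presentation G l m n P Q C \<longleftrightarrow>
     order G = l * m * n \<and> (\<exists>a b x. pc_relations G a b x l m n P Q C)"

context group
begin

lemma pow_4_two_group:
  assumes "stable_group G" "finite (carrier G)" "order G = 2 ^ k" "x \<in> carrier G"
  shows "x [^] (4::nat) = \<one>" "ord x = 1 \<or> ord x = 2 \<or> ord x = 4"
proof -
  have "ord x dvd 2 ^ k" using ord_dvd_group_order[OF assms(4)] assms(3) by simp
  then obtain i where i: "ord x = 2 ^ i" using divides_primepow_nat[OF two_is_prime_nat] by blast
  have "i < 3"
  proof (rule ccontr)
    assume "\<not> i < 3"
    then have "(2::nat) ^ 3 \<le> 2 ^ i" by (intro power_increasing) auto
    moreover have "ord x \<le> 7" using stable_group_ord[OF assms(1,2,4)] by auto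
    ultimately show False using i by simp
  qed
  then have "i = 0 \<or> i = 1 \<or> i = 2" by linarith
  then show o: "ord x = 1 \<or> ord x = 2 \<or> ord x = 4" using i by auto
  then have "ord x dvd 4" by auto
  then show "x [^] (4::nat) = \<one>" using pow_eq_id[OF assms(4)] by blast
qed

text \<open>If the square of a normalizing element \<open>y\<close> is still outside
  \<open>H\<close>, it can replace \<open>y\<close>, since it also normalizes \<open>H\<close> and
  \<open>y^4 = \<one>\<close> lies in \<open>H\<close>. This yields the parameter
  \<open>n = 2\<close> of the presentation.\<close>

lemma normalizer_grows_square:
  assumes st: "stable_group G" and fin: "finite (carrier G)" and ord: "order G = 2 ^ k"
    and H: "subgroup H G" "H \<noteq> carrier G"
  obtains x where "x \<in> carrier G" "x \<notin> H" "\<And>h. h \<in> H \<Longrightarrow> x \<otimes> h \<otimes> inv x \<in> H" "x [^] (2::nat) \<in> H"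
proof -
  obtain y where y: "y \<in> carrier G" "y \<notin> H" "\<And>h. h \<in> H \<Longrightarrow> y \<otimes> h \<otimes> inv y \<in> H"
    using normalizer_grows[OF fin ord two_is_prime_nat H] by metis
  show ?thesis
  proof (cases "y [^] (2::nat) \<in> H")
    case True
    then show ?thesis using that y by blast
  next
    case False
    have "y [^] (2::nat) \<otimes> h \<otimes> inv (y [^] (2::nat)) \<in> H" if h: "h \<in> H" for h
    proof -
      have "y [^] (2::nat) \<otimes> h \<otimes> inv (y [^] (2::nat)) = y \<otimes> (y \<otimes> h \<otimes> inv y) \<otimes> inv y"
        using y(1) subgroup.mem_carrier[OF H(1) h] by (simp add: numeral_2_eq_2 inv_mult_group m_assoc)
      then show ?thesis using y(3)[OF y(3)[OF h]] by simp
    qed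
    moreover have "(y [^] (2::nat)) [^] (2::nat) = \<one>"
      using pow_4_two_group(1)[OF st fin ord y(1)] y(1) by (simp add: nat_pow_pow)
    ultimately show ?thesis
      using that[of "y [^] (2::nat)"] False y(1) subgroup.one_closed[OF H(1)] by simp
  qed
qed

lemma involution_not_power:
  assumes fin: "finite (carrier G)" and a: "a \<in> carrier G" "ord a = 4"
    and b: "b \<otimes> b = \<one>" "b \<noteq> \<one>" "b \<noteq> a \<otimes> a"
  shows "b \<noteq> a [^] (i::nat)"
proof
  assume bi: "b = a [^] i"
  then have "a [^] (i + i) = \<one>" using a b(1) by (simp add: nat_pow_mult)
  then have "4 dvd i + i" using a pow_eq_id[OF a(1)] by metis
  then have "i mod 4 = 0 \<or> i mod 4 = 2" by presburger
  moreover have "b = a [^] (i mod 4)" using bi pow_mod_eq[OF a(1) pow_ord_eq_1[OF a(1)], of i] a(2) by simp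
  ultimately show False using b a(1) by (auto simp: numeral_2_eq_2)
qed

lemma ord_2_iff: "x \<in> carrier G \<Longrightarrow> ord x = 2 \<longleftrightarrow> x \<noteq> \<one> \<and> x \<otimes> x = \<one>"
proof -
  assume x: "x \<in> carrier G"
  have "x \<otimes> x = x [^] (2::nat)" using x by (simp add: numeral_2_eq_2)
  then have "x \<otimes> x = \<one> \<longleftrightarrow> ord x dvd 2" using pow_eq_id[OF x] by metis
  also have "\<dots> \<longleftrightarrow> ord x = 1 \<or> ord x = 2" using two_is_prime_nat by (auto simp: prime_nat_iff)
  finally show ?thesis using ord_eq_1[OF x] by auto
qed

text \<open>If every element of order \<open>4\<close> squares to the central involution \<open>z\<close>, all commutators lie in
  \<open>{\<one>, z}\<close>, so a conjugacy class has at most two elements and centralizers are large.\<close>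

lemma commuting_involution:
  assumes st: "stable_group G" and fin: "finite (carrier G)" and ord: "order G = 2 ^ k" "k \<ge> 4"
    and g: "g \<in> carrier G" "ord g = 4"
  obtains a b where "a \<in> carrier G" "ord a = 4" "b \<in> carrier G" "ord b = 2" "a \<otimes> b = b \<otimes> a"
    "\<And>i::nat. b \<noteq> a [^] i"
proof -
  obtain z where z: "z \<in> carrier G" "ord z = 2" and zc: "\<And>g. g \<in> carrier G \<Longrightarrow> g \<otimes> z = z \<otimes> g"
    using central_element_of_prime_order[OF fin ord(1) _ two_is_prime_nat] ord(2) by (metis less_le_trans zero_less_numeral)
  have zz: "z \<otimes> z = \<one>" "z \<noteq> \<one>" using z ord_2_iff by blast+
  show ?thesis
  proof (cases "\<exists>a\<in>carrier G. ord a = 4 \<and> a \<otimes> a \<noteq> z")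
    case True
    then obtain a where a: "a \<in> carrier G" "ord a = 4" "a \<otimes> a \<noteq> z" by blast
    then show ?thesis
      using that[OF a(1,2) z zc[OF a(1)]] involution_not_power[OF fin a(1,2) zz(1,2)] by metis
  next
    case False
    have sq: "x \<otimes> x \<in> {\<one>, z}" if x: "x \<in> carrier G" for x
    proof -
      have "x \<otimes> x = \<one>" if "ord x = 1" using that ord_eq_1[OF x] by simp
      then show ?thesis using pow_4_two_group(2)[OF st fin ord(1) x] ord_2_iff[OF x] False x by blast
    qed
    have gg: "g \<otimes> g = z" using False g by blast
    have cm: "y \<otimes> w \<otimes> v = y \<otimes> v \<otimes> w" if "y \<in> carrier G" "v \<in> carrier G" "w \<in> {\<one>, z}" for y v w
    proof -
      have "w \<in> carrier G" "w \<otimes> v = v \<otimes> w" using that z zc by auto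
      then show ?thesis using that(1,2) by (simp only: m_assoc)
    qed
    have inv_g: "inv g = g \<otimes> z"
    proof (rule inv_equality)
      have "g \<otimes> z \<otimes> g = g \<otimes> g \<otimes> z" using cm g(1) by simp
      then show "g \<otimes> z \<otimes> g = \<one>" using gg zz by simp
    qed (use g z in auto)
    \<comment> \<open>Each of \<open>h g\<close>, \<open>h\<close> and \<open>g\<close> equals its
      inverse up to its square, and all squares lie in the central set \<open>{\<one>, z}\<close>.
      Inverting \<open>h g\<close> therefore interchanges the factors up to such an element.\<close>
    have comm: "h \<otimes> g = g \<otimes> h \<or> h \<otimes> g = z \<otimes> g \<otimes> h" if h: "h \<in> carrier G" for h
    proof -
      obtain c where c: "h \<otimes> g \<otimes> (h \<otimes> g) = c" "c \<in> {\<one>, z}" using sq[of "h \<otimes> g"] h g by simp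
      obtain d where d: "h \<otimes> h = d" "d \<in> {\<one>, z}" using sq[OF h] by simp
      have cd: "c \<in> carrier G" "d \<in> carrier G" "d \<otimes> d = \<one>" using c d z zz by auto
      have "h \<otimes> d \<otimes> h = h \<otimes> h \<otimes> d" using cm d(2) h by blast
      then have inv_h: "inv h = h \<otimes> d" using d cd h by (intro inv_equality) auto
      have "h \<otimes> g = c \<otimes> inv (h \<otimes> g)" using c(1) h g by (metis inv_solve_right m_closed)
      also have "\<dots> = c \<otimes> (g \<otimes> z \<otimes> (h \<otimes> d))" using h g by (simp add: inv_mult_group inv_g inv_h)
      also have "\<dots> = c \<otimes> z \<otimes> d \<otimes> (g \<otimes> h)"
      proof -
        have dc: "y \<otimes> d = d \<otimes> y" if "y \<in> carrier G" for y using d(2) zc[OF that] that by auto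
        have "g \<otimes> z \<otimes> (h \<otimes> d) = z \<otimes> g \<otimes> (d \<otimes> h)" using zc[OF g(1)] dc[OF h] by simp
        also have "\<dots> = z \<otimes> (g \<otimes> d) \<otimes> h" using z g cd h by (simp add: m_assoc)
        also have "\<dots> = z \<otimes> d \<otimes> (g \<otimes> h)" using z g cd h dc[OF g(1)] by (simp add: m_assoc)
        finally show ?thesis using cd z g h by (simp add: m_assoc)
      qed
      finally have "h \<otimes> g = c \<otimes> z \<otimes> d \<otimes> (g \<otimes> h)" .
      moreover have "c \<otimes> z \<otimes> d \<in> {\<one>, z}" using c(2) d(2) zz z by (auto simp: m_assoc)
      ultimately show ?thesis using g h z by (auto simp: m_assoc)
    qed
    have ex: "\<exists>h\<in>carrier G. h \<otimes> g = g \<otimes> h \<and> (\<forall>i::nat. h \<noteq> g [^] i)"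
    proof -
      let ?C = "generate G {g}"
      have C: "subgroup ?C G" using g by (simp add: generate_is_subgroup)
      have mem: "g [^] (i::nat) \<in> ?C" for i using generate_pow_on_finite_carrier[OF fin g(1)] by blast
      have "card ?C = 4" using generate_pow_card[OF g(1)] g(2) by simp
      have "(2::nat) ^ 4 \<le> 2 ^ k" using ord(2) by (intro power_increasing) auto
      then have big: "card (carrier G) \<ge> 16" using ord(1) by (simp add: order_def)
      have CG: "?C \<subseteq> carrier G" using C by (rule subgroup.subset)
      then have finC: "finite ?C" using fin finite_subset by blast
      obtain x where x: "x \<in> carrier G" "x \<notin> ?C"
        using card_mono[OF finC, of "carrier G"] \<open>card ?C = 4\<close> big by fastforce
      show ?thesis
      proof (cases "x \<otimes> g = g \<otimes> x")
        case True
        then show ?thesis using x mem by metis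
      next
        case xg: False
        \<comment> \<open>If neither \<open>x\<close> nor \<open>y\<close> centralizes
          \<open>g\<close>, both conjugate \<open>g\<close> to \<open>z g\<close>, so
          \<open>inv x \<otimes> y\<close> centralizes \<open>g\<close>. Choosing \<open>y\<close>
          outside the coset of \<open>x\<close> keeps this product out of the powers of
          \<open>g\<close>. The two cosets have at most 8 elements, so order 16 leaves room for
          \<open>y\<close>.\<close>
        let ?D = "?C \<union> (\<lambda>c. x \<otimes> c) ` ?C"
        have "card ?D \<le> 8"
          using card_Un_le[of ?C "(\<lambda>c. x \<otimes> c) ` ?C"] card_image_le[OF finC, of "\<lambda>c. x \<otimes> c"] \<open>card ?C = 4\<close> by linarith
        moreover have "finite ?D" using finC by simp
        ultimately obtain y where y: "y \<in> carrier G" "y \<notin> ?D"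
          using card_mono[of ?D "carrier G"] big by fastforce
        show ?thesis
        proof (cases "y \<otimes> g = g \<otimes> y")
          case True
          then show ?thesis using y mem by (metis UnCI)
        next
          case yg: False
          have xz: "x \<otimes> g = z \<otimes> g \<otimes> x" and yz: "y \<otimes> g = z \<otimes> g \<otimes> y" using comm x y xg yg by blast+
          have "g \<otimes> inv x = inv x \<otimes> (x \<otimes> g) \<otimes> inv x" using g x by (simp add: m_assoc[symmetric])
          also have "\<dots> = inv x \<otimes> (z \<otimes> g)" unfolding xz using g x z by (simp add: m_assoc)
          finally have gx: "g \<otimes> inv x = inv x \<otimes> (z \<otimes> g)" .
          have "inv x \<otimes> y \<otimes> g = inv x \<otimes> (z \<otimes> g \<otimes> y)" using yz x y g by (simp add: m_assoc)
          also have "\<dots> = inv x \<otimes> (z \<otimes> g) \<otimes> y" using x y g z by (simp add: m_assoc)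
          also have "\<dots> = g \<otimes> (inv x \<otimes> y)" unfolding gx[symmetric] using x y g by (simp add: m_assoc)
          finally have "inv x \<otimes> y \<otimes> g = g \<otimes> (inv x \<otimes> y)" .
          moreover have "inv x \<otimes> y \<noteq> g [^] (i::nat)" for i
          proof
            assume "inv x \<otimes> y = g [^] i"
            then have "y = x \<otimes> g [^] i" using x y by (metis inv_solve_left' nat_pow_closed g(1))
            then show False using y(2) mem by blast
          qed
          ultimately show ?thesis using x y by (intro bexI[of _ "inv x \<otimes> y"]) auto
        qed
      qed
    qed
    then obtain h where h: "h \<in> carrier G" "h \<otimes> g = g \<otimes> h" "\<And>i::nat. h \<noteq> g [^] i" by blast
    show ?thesis
    proof (cases "h \<otimes> h = \<one>")
      case True
      moreover have "h \<noteq> \<one>" using h(3)[of 0] by simp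
      ultimately show ?thesis using that[OF g h(1) _ h(2)[symmetric] h(3)] ord_2_iff[OF h(1)] by blast
    next
      case False
      \<comment> \<open>Now \<open>g\<close> and \<open>h\<close> both square to \<open>z\<close>
        and commute, so \<open>h g\<close> squares to \<open>\<one>\<close> and serves as the
        involution.\<close>
      then have hh: "h \<otimes> h = z" using sq[OF h(1)] by simp
      have hg: "h \<otimes> g \<noteq> g [^] (i::nat)" for i
      proof
        assume "h \<otimes> g = g [^] i"
        then have "h \<otimes> g \<otimes> g [^] (3::nat) = g [^] i \<otimes> g [^] (3::nat)" by simp
        moreover have "g \<otimes> g [^] (3::nat) = \<one>"
          using pow_ord_eq_1[OF g(1)] g nat_pow_Suc2[of g 3] by (simp add: numeral_eq_Suc)
        ultimately have "h = g [^] (i + 3)" using g h(1) by (simp add: m_assoc nat_pow_mult)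
        then show False using h(3) by blast
      qed
      have "h \<otimes> g \<otimes> (h \<otimes> g) = h \<otimes> (g \<otimes> h) \<otimes> g" using g h(1) by (simp add: m_assoc)
      also have "\<dots> = h \<otimes> h \<otimes> (g \<otimes> g)" unfolding h(2)[symmetric] using g h(1) by (simp add: m_assoc)
      also have "\<dots> = \<one>" using hh gg zz by simp
      finally have "h \<otimes> g \<otimes> (h \<otimes> g) = \<one>" .
      moreover have "h \<otimes> g \<noteq> \<one>" using hg[of 0] by simp
      ultimately have "ord (h \<otimes> g) = 2" using ord_2_iff g h by simp
      moreover have "g \<otimes> (h \<otimes> g) = h \<otimes> g \<otimes> g" using g(1) h(1,2) by (metis m_assoc)
      ultimately show ?thesis using that[OF g _ _ _ hg] g h by simp
    qed
  qed
qed

text \<open>A commuting pair of orders 4 and 2 gives \<open>C4 x C2\<close>. In a 2-group of order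
  at least 16 it is normalized by some outer \<open>x\<close> with square inside, so all its
  extensions of order 16 have to be unstable, which is the content of the table.\<close>

lemma not_stable_large_2_group:
  assumes fin: "finite (carrier G)" and ord: "order G = 2 ^ k" "k \<ge> 4"
    and g: "g \<in> carrier G" "ord g = 4"
  shows "\<not> stable_group G"
proof
  assume st: "stable_group G"
  obtain a b where ab: "a \<in> carrier G" "ord a = 4" "b \<in> carrier G" "ord b = 2" "a \<otimes> b = b \<otimes> a"
    "\<And>i::nat. b \<noteq> a [^] i" using commuting_involution[OF st fin ord g] by metis
  have indep: "ord a dvd i \<and> ord b dvd j" if "a [^] i \<otimes> b [^] j = \<one>" for i j :: nat
    using independent_powers[OF fin ab(1,3,5) _ ab(6) that] ab(4) two_is_prime_nat by simp
  have K: "subgroup (powers_product a b) G" by (rule subgroup_powers_product[OF fin ab(1,3,5)])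
  have "(2::nat) ^ 4 \<le> 2 ^ k" using ord(2) by (intro power_increasing) auto
  then have ne: "powers_product a b \<noteq> carrier G"
    using card_powers_product[of a b] ab(2,4) ord by (auto simp: order_def)
  obtain x where x: "x \<in> carrier G" "x \<notin> powers_product a b"
    "\<And>h. h \<in> powers_product a b \<Longrightarrow> x \<otimes> h \<otimes> inv x \<in> powers_product a b" "x [^] (2::nat) \<in> powers_product a b"
    using normalizer_grows_square[OF st fin ord(1) K ne] by metis
  obtain p q r s u v where "pc_relations G a b x (ord a) (ord b) 2 (p, q) (r, s) (u, v)"
    "p < ord a" "q < ord b" "r < ord a" "s < ord b" "u < ord a" "v < ord b"
    using pc_relations_exist[OF fin ab(1,3) x(1) ab(5) indep two_is_prime_nat x(2,3,4)] by metis
  then show False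
    using pc_16_not_stable'[OF fin _ pow_4_two_group(1)[OF st fin ord(1) x(1)]] ab(2,4) st by metis
qed

lemma pc_presentation_cyclic:
  assumes "finite (carrier G)" "g \<in> carrier G" "ord g = order G"
  shows "has_pc_presentation G (order G) 1 1 (1, 0) (0, 1) (0, 0)"
  using pc_relations_cyclicI[OF assms(1,2)] assms(3) unfolding has_pc_presentation_def by auto

text \<open>An outer element \<open>x\<close> normalizes the cyclic subgroup of order 4. If
  \<open>x\<close> inverts it, the group is \<open>D4\<close> or \<open>Q8\<close> according to
  whether \<open>x^2\<close> is \<open>g^0\<close> or \<open>g^2\<close>; if \<open>x\<close>
  centralizes it, the group is \<open>C4 x C2\<close>.\<close>

lemma pc_presentation_order_8:
  assumes st: "stable_group G" and fin: "finite (carrier G)" and ord: "order G = 8"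
    and g: "g \<in> carrier G" "ord g = 4"
  shows "has_pc_presentation G 4 2 1 (1, 0) (0, 1) (0, 0) \<or>
    has_pc_presentation G 4 1 2 (3, 0) (0, 1) (0, 0) \<or> has_pc_presentation G 4 1 2 (3, 0) (0, 1) (2, 0)"
proof -
  let ?C = "generate G {g}"
  have C: "subgroup ?C G" using g by (simp add: generate_is_subgroup)
  note gen = generate_singleton_eq[OF fin g(1), unfolded g(2)]
  have mem: "g [^] (i::nat) \<in> ?C" for i using generate_pow_on_finite_carrier[OF fin g(1)] by blast
  have "card ?C = 4" using generate_pow_card[OF g(1)] g(2) by simp
  then have "?C \<noteq> carrier G" using ord by (auto simp: order_def)
  moreover have ord': "order G = 2 ^ 3" using ord by simp
  ultimately obtain x where x: "x \<in> carrier G" "x \<notin> ?C" "\<And>h. h \<in> ?C \<Longrightarrow> x \<otimes> h \<otimes> inv x \<in> ?C"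
    "x [^] (2::nat) \<in> ?C" using normalizer_grows_square[OF st fin _ C] by metis
  have xn: "x \<noteq> g [^] (i::nat)" for i using x(2) mem by metis
  obtain p :: nat where p: "x \<otimes> g \<otimes> inv x = g [^] p" "p < 4" using x(3)[OF mem[of 1]] gen g by auto
  obtain u :: nat where u: "x [^] (2::nat) = g [^] u" "u < 4" using x(4) gen by auto
  have xg: "x \<otimes> g = g [^] p \<otimes> x"
  proof -
    have "x \<otimes> g = x \<otimes> g \<otimes> inv x \<otimes> x" using x(1) g by (simp add: m_assoc)
    then show ?thesis using p by simp
  qed
  have "g [^] (u * 2) = (x [^] (2::nat)) [^] (2::nat)" using u g by (simp add: nat_pow_pow)
  also have "\<dots> = \<one>" using pow_4_two_group(1)[OF st fin ord' x(1)] x(1) by (simp add: nat_pow_pow)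
  finally have "4 dvd u * 2" using pow_eq_id[OF g(1)] g(2) by metis
  then have u': "u = 0 \<or> u = 2" using u(2) by presburger
  have "odd p"
  proof
    assume "even p"
    then have "g [^] (p * 2) = \<one>" using pow_eq_id[OF g(1), of "p * 2"] g(2) by auto
    moreover have "x \<otimes> g [^] (2::nat) = (g [^] p) [^] (2::nat) \<otimes> x" using conj_pow[OF x(1) g(1) _ xg, of 2] g by simp
    ultimately have "x \<otimes> g [^] (2::nat) = x" using g x by (simp add: nat_pow_pow)
    then have "g [^] (2::nat) = \<one>" using x(1) g by (metis l_cancel_one' nat_pow_closed)
    then show False using pow_eq_id[OF g(1), of 2] g(2) by simp
  qed
  then have "p = 1 \<or> p = 3" using p(2) by presburger
  then show ?thesis
  proof
    assume "p = 3"
    then have "pc_relations G g \<one> x 4 1 2 (3, 0) (0, 1) (u, 0)"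
      using pc_relations_metacyclicI[OF fin g(1) x(1) two_is_prime_nat xn xg u(1)] g(2) by simp
    then show ?thesis using u' ord unfolding has_pc_presentation_def by auto
  next
    assume "p = 1"
    then have comm: "x \<otimes> g = g \<otimes> x" using xg g by simp
    have "\<exists>b\<in>carrier G. b \<otimes> b = \<one> \<and> b \<otimes> g = g \<otimes> b \<and> (\<forall>i::nat. b \<noteq> g [^] i)"
      using u'
    proof
      assume "u = 0"
      then show ?thesis using u(1) x(1) comm xn by (intro bexI[of _ x]) (auto simp: numeral_2_eq_2)
    next
      \<comment> \<open>Here \<open>x\<close> has order 4 and the complementary involution is
        \<open>x g\<close>, because \<open>x^2 g^2 = g^4\<close>.\<close>
      assume "u = 2"
      have "x \<otimes> g \<otimes> (x \<otimes> g) = x \<otimes> (g \<otimes> x) \<otimes> g" using x g by (simp add: m_assoc)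
      also have "\<dots> = x [^] (2::nat) \<otimes> g [^] (2::nat)"
        unfolding comm[symmetric] using x g by (simp add: m_assoc numeral_2_eq_2)
      also have "\<dots> = g [^] (4::nat)" using u(1) \<open>u = 2\<close> g by (simp add: nat_pow_mult)
      also have "\<dots> = \<one>" using pow_ord_eq_1[OF g(1)] g(2) by simp
      finally have "x \<otimes> g \<otimes> (x \<otimes> g) = \<one>" .
      moreover have "x \<otimes> g \<noteq> g [^] (i::nat)" for i
      proof
        assume "x \<otimes> g = g [^] i"
        then have "x = g [^] i \<otimes> inv g" using x g by (metis inv_solve_right nat_pow_closed)
        moreover have "inv g \<in> ?C" using subgroup.m_inv_closed[OF C mem[of 1]] g by simp
        ultimately show False using x(2) subgroup.m_closed[OF C mem] by simp
      qed
      moreover have "x \<otimes> g \<otimes> g = g \<otimes> (x \<otimes> g)" using comm x(1) g(1) by (metis m_assoc)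
      ultimately show ?thesis using x g by (intro bexI[of _ "x \<otimes> g"]) auto
    qed
    then obtain b where b: "b \<in> carrier G" "b \<otimes> b = \<one>" "b \<otimes> g = g \<otimes> b" "\<And>i::nat. b \<noteq> g [^] i" by blast
    have "b \<noteq> \<one>" using b(4)[of 0] by simp
    then have "ord b = 2" using ord_2_iff b by blast
    then have "pc_relations G g b \<one> 4 2 1 (1, 0) (0, 1) (0, 0)"
      using pc_relations_abelianI[OF fin g(1) b(1) b(3)[symmetric]
          independent_powers[OF fin g(1) b(1) b(3)[symmetric] _ b(4)]] g(2) two_is_prime_nat by simp
    then show ?thesis using ord unfolding has_pc_presentation_def by auto
  qed
qed

end

section \<open>Products of cyclic groups and elementary abelian 2-groups\<close>

lemma cyclic_product_Nil [simp]: "carrier (cyclic_product []) = {[]}" "\<one>\<^bsub>cyclic_product []\<^esub> = []"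
  "x \<otimes>\<^bsub>cyclic_product []\<^esub> y = []"
  by (simp_all add: cyclic_product_def DirProd_list_def)

lemma cyclic_product_Cons_carrier [simp]:
  "xs \<in> carrier (cyclic_product (n # ns)) \<longleftrightarrow>
     (\<exists>y ys. xs = y # ys \<and> y \<in> carrier (integer_mod_group n) \<and> ys \<in> carrier (cyclic_product ns))"
  by (auto simp: cyclic_product_def DirProd_list_carrier)

lemma cyclic_product_Cons_iso:
  "(\<lambda>(x, xs). x # xs) \<in> iso (integer_mod_group n \<times>\<times> cyclic_product ns) (cyclic_product (n # ns))"
  using DirProd_list_iso[of "integer_mod_group n"] by (simp add: cyclic_product_def)

lemma cyclic_product_Cons_mult [simp]:
  assumes "x \<in> carrier (integer_mod_group n)" "y \<in> carrier (integer_mod_group n)"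
    "xs \<in> carrier (cyclic_product ns)" "ys \<in> carrier (cyclic_product ns)"
  shows "(x # xs) \<otimes>\<^bsub>cyclic_product (n # ns)\<^esub> (y # ys) =
    ((x + y) mod int n) # (xs \<otimes>\<^bsub>cyclic_product ns\<^esub> ys)"
proof -
  have "(\<lambda>(x, xs). x # xs) \<in> hom (integer_mod_group n \<times>\<times> cyclic_product ns) (cyclic_product (n # ns))"
    using cyclic_product_Cons_iso[of n ns] by (simp add: iso_def)
  from hom_mult[OF this, of "(x, xs)" "(y, ys)"] show ?thesis using assms by simp
qed

lemma cyclic_product_Cons_one [simp]: "\<one>\<^bsub>cyclic_product (n # ns)\<^esub> = 0 # \<one>\<^bsub>cyclic_product ns\<^esub>"
  by (simp add: cyclic_product_def DirProd_list_one)

definition elementary_2_group :: "('a, 'b) monoid_scheme \<Rightarrow> bool" where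
  "elementary_2_group G \<longleftrightarrow> (\<forall>x\<in>carrier G. x \<otimes>\<^bsub>G\<^esub> x = \<one>\<^bsub>G\<^esub>)"

lemma (in group) elementary_2_group_comm:
  assumes "elementary_2_group G"
  shows "comm_group G"
proof (rule group_comm_groupI)
  fix x y assume xy: "x \<in> carrier G" "y \<in> carrier G"
  have inv: "inv z = z" if "z \<in> carrier G" for z
    using assms that by (intro inv_equality) (auto simp: elementary_2_group_def)
  show "x \<otimes> y = y \<otimes> x" using inv_mult_group[OF xy] inv xy by simp
qed

text \<open>The Sylow existence theorem supplies subgroups of every prime power order dividing the
  group order, in particular one of index 2. Any element outside it generates a complement.\<close>

lemma (in group) elementary_2_group_split:
  assumes ord: "order G = 2 ^ Suc k" and el: "elementary_2_group G"
  obtains H where "subgroup H G" "card H = 2 ^ k" "G \<cong> integer_mod_group 2 \<times>\<times> G\<lparr>carrier := H\<rparr>"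
proof -
  interpret comm_group G by (rule elementary_2_group_comm[OF el])
  have fin: "finite (carrier G)" using ord by (metis card_ge_0_finite order_def zero_less_numeral zero_less_power)
  have "order G = 2 ^ k * 2" using ord by simp
  from sylow_thm[OF two_is_prime_nat is_group this fin]
  obtain H where H: "subgroup H G" "card H = 2 ^ k" by blast
  let ?H = "G\<lparr>carrier := H\<rparr>"
  have HG: "H \<subseteq> carrier G" using H(1) by (rule subgroup.subset)
  have "H \<noteq> carrier G" using H(2) ord by (auto simp: order_def)
  then obtain x where x: "x \<in> carrier G" "x \<notin> H" using HG by blast
  have sq: "y \<otimes> y = \<one>" if "y \<in> carrier G" for y using el that by (simp add: elementary_2_group_def)
  let ?Z = "integer_mod_group 2"
  have Z: "carrier ?Z = {0, 1}" by (auto simp: carrier_integer_mod_group)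
  define f where "f = (\<lambda>(i::int, h). if i = 0 then h else x \<otimes> h)"
  have f: "f \<in> iso (?Z \<times>\<times> ?H) G"
  proof -
    have "f \<in> hom (?Z \<times>\<times> ?H) G"
    proof (rule homI)
      fix u assume "u \<in> carrier (?Z \<times>\<times> ?H)"
      then show "f u \<in> carrier G" using x HG by (auto simp: f_def Z)
    next
      fix u v assume uv: "u \<in> carrier (?Z \<times>\<times> ?H)" "v \<in> carrier (?Z \<times>\<times> ?H)"
      obtain i h j h' where [simp]: "u = (i, h)" "v = (j, h')" by (cases u, cases v)
      have hh: "h \<in> carrier G" "h' \<in> carrier G" "i = 0 \<or> i = 1" "j = 0 \<or> j = 1" using uv HG by (auto simp: Z)
      have "x \<otimes> h \<otimes> (x \<otimes> h') = (x \<otimes> x) \<otimes> (h \<otimes> h')" using x hh by (simp add: m_ac)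
      then have "x \<otimes> h \<otimes> (x \<otimes> h') = h \<otimes> h'" using sq x hh by simp
      then show "f (u \<otimes>\<^bsub>?Z \<times>\<times> ?H\<^esub> v) = f u \<otimes> f v"
        using hh x by (auto simp: f_def m_ac)
    qed
    moreover have "inj_on f (carrier (?Z \<times>\<times> ?H))"
    proof (rule inj_onI)
      fix u v assume uv: "u \<in> carrier (?Z \<times>\<times> ?H)" "v \<in> carrier (?Z \<times>\<times> ?H)" and eq: "f u = f v"
      obtain i h j h' where [simp]: "u = (i, h)" "v = (j, h')" by (cases u, cases v)
      have hh: "h \<in> H" "h' \<in> H" "i = 0 \<or> i = 1" "j = 0 \<or> j = 1" using uv by (auto simp: Z)
      have ne: "x \<otimes> y \<noteq> y'" if "y \<in> H" "y' \<in> H" for y y'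
      proof
        assume "x \<otimes> y = y'"
        then have "x = y' \<otimes> inv y" using x that HG by (metis inv_solve_right subsetD)
        then show False using x that subgroup.m_closed[OF H(1)] subgroup.m_inv_closed[OF H(1)] by metis
      qed
      have "h = h'" if "x \<otimes> h = x \<otimes> h'" using that hh x HG by (metis l_cancel subsetD)
      then show "u = v" using hh eq ne[of h h'] ne[of h' h] by (auto simp: f_def split: if_splits)
    qed
    moreover have "card (carrier (?Z \<times>\<times> ?H)) = card (carrier G)"
      using H(2) ord by (simp add: Z card_cartesian_product order_def)
    ultimately have "f ` carrier (?Z \<times>\<times> ?H) = carrier G"
      using fin by (metis card_image card_subset_eq hom_carrier)
    then show ?thesis using \<open>f \<in> hom _ _\<close> \<open>inj_on f _\<close> by (simp add: iso_def bij_betw_def)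
  qed
  have gH: "group ?H" using H(1) by (simp add: subgroup_imp_group)
  have "?Z \<times>\<times> ?H \<cong> G" using f by (auto simp: is_iso_def)
  then have "G \<cong> ?Z \<times>\<times> ?H"
    by (rule group.iso_sym[OF DirProd_group[OF group_integer_mod_group gH]])
  then show ?thesis using that H by blast
qed

lemma elementary_2_group_iso:
  assumes "group G" "order G = 2 ^ k" "elementary_2_group G"
  shows "G \<cong> cyclic_product (replicate k 2)"
  using assms
proof (induction k arbitrary: G)
  case 0
  have "card (carrier G) = 1" using 0 by (simp add: order_def)
  then obtain a where "carrier G = {a}" by (rule card_1_singletonE)
  then have "(\<lambda>_. []) \<in> iso G (cyclic_product [])"
    by (auto simp: iso_def hom_def bij_betw_def)
  then show ?case by (auto simp: is_iso_def)
next
  case (Suc k)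
  let ?Z = "integer_mod_group 2"
  obtain H where H: "subgroup H G" "card H = 2 ^ k" "G \<cong> ?Z \<times>\<times> G\<lparr>carrier := H\<rparr>"
    using group.elementary_2_group_split[OF Suc.prems] by metis
  let ?H = "G\<lparr>carrier := H\<rparr>"
  have "elementary_2_group ?H"
    using Suc.prems(3) subgroup.mem_carrier[OF H(1)] by (simp add: elementary_2_group_def)
  then have "?H \<cong> cyclic_product (replicate k 2)"
    using Suc.IH[of ?H] H(1,2) group.subgroup_imp_group[OF Suc.prems(1)] by (simp add: order_def)
  then obtain \<phi> where \<phi>: "\<phi> \<in> iso ?H (cyclic_product (replicate k 2))" by (auto simp: is_iso_def)
  have "(\<lambda>(i, h). (i, \<phi> h)) \<in> iso (?Z \<times>\<times> ?H) (?Z \<times>\<times> cyclic_product (replicate k 2))"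
    using iso_set_refl[of ?Z] iso_paired2[of "?Z" ?H "\<lambda>x. x" \<phi> ?Z "cyclic_product (replicate k 2)"] \<phi>
    by (simp add: group.subgroup_imp_group[OF Suc.prems(1) H(1)])
  then have "?Z \<times>\<times> ?H \<cong> ?Z \<times>\<times> cyclic_product (replicate k 2)" by (auto simp: is_iso_def)
  moreover have "?Z \<times>\<times> cyclic_product (replicate k 2) \<cong> cyclic_product (replicate (Suc k) 2)"
    using cyclic_product_Cons_iso[of 2 "replicate k 2"] by (auto simp: is_iso_def)
  ultimately show ?case using H(3) by (meson iso_trans)
qed

lemma elementary_2_group_hom_image:
  assumes "group G" "group H" "G \<cong> H" "elementary_2_group G"
  shows "elementary_2_group H"
proof -
  obtain f where f: "f \<in> iso G H" using assms(3) by (auto simp: is_iso_def)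
  have "group_hom G H f" using f assms by (simp add: group_hom_def group_hom_axioms_def iso_def)
  then interpret group_hom G H f .
  have "f ` carrier G = carrier H" using f by (auto simp: iso_def bij_betw_def)
  then show ?thesis using assms(4) unfolding elementary_2_group_def by (metis hom_mult hom_one imageE)
qed

text \<open>The products of at most four of the independent elements of \<open>A - {\<one>}\<close> lie in \<open>A A\<close> or in \<open>s A\<close>,
  where \<open>s\<close> is the product of all of them; two elements of \<open>s A\<close> are never separated.\<close>

lemma (in group) elementary_right_stable_subset:
  assumes fin: "finite (carrier G)" and el: "elementary_2_group G"
    and K: "subgroup K G" and A: "A \<subseteq> K" "\<one> \<in> A" and s: "s \<in> carrier G"
    and cover: "\<And>t. t \<in> K \<Longrightarrow> \<exists>g\<in>A. (\<exists>h\<in>A. t = g \<otimes> h) \<or> t = s \<otimes> g"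
  shows "right_stable_subset G A"
proof -
  interpret comm_group G by (rule elementary_2_group_comm[OF el])
  have AG: "A \<subseteq> carrier G" using A(1) subgroup.subset[OF K] by blast
  have sq: "y \<otimes> y = \<one>" if "y \<in> carrier G" for y using el that by (simp add: elementary_2_group_def)
  have A0: "A \<noteq> {}" using A by blast
  have sA: "\<exists>g\<in>A. t = s \<otimes> g" if t: "t \<in> K" "separated G A \<one> t" for t
  proof -
    have "t \<noteq> g \<otimes> h" if "g \<in> A" "h \<in> A" for g h
    proof
      assume "t = g \<otimes> h"
      then have "g \<otimes> t = (g \<otimes> g) \<otimes> h" using that AG by (simp add: m_assoc subset_iff)
      then have "g \<otimes> t = h \<otimes> \<one>" using that AG sq by (auto simp: subset_iff)
      then show False using t(2) that unfolding separated_def by metis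
    qed
    then show ?thesis using cover[OF t(1)] by blast
  qed
  have no: "\<not> separated G A t u"
    if tu: "t \<in> K" "u \<in> K" "separated G A \<one> t" "separated G A \<one> u" for t u
  proof -
    obtain g h where gh: "g \<in> A" "h \<in> A" "t = s \<otimes> g" "u = s \<otimes> h" using sA tu by metis
    then have "h \<otimes> t = g \<otimes> u" using s AG by (simp add: m_ac subset_iff)
    then show ?thesis using gh unfolding separated_def by blast
  qed
  show ?thesis
    using right_stable_subset_if_stable_in_subgroup[OF fin K A(1) A0
        maximal_packing_card_le_2[OF K A(1) A0 no]] by blast
qed

lemma (in group) elementary_extend_subgroup:
  assumes fin: "finite (carrier G)" and el: "elementary_2_group G"
    and V: "subgroup V G" and a: "a \<in> carrier G" "a \<notin> V"
  shows "subgroup (V \<union> (\<otimes>) a ` V) G" "card (V \<union> (\<otimes>) a ` V) = 2 * card V"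
proof -
  interpret comm_group G by (rule elementary_2_group_comm[OF el])
  have VG: "V \<subseteq> carrier G" using subgroup.subset[OF V] .
  have sq: "y \<otimes> y = \<one>" if "y \<in> carrier G" for y using el that by (simp add: elementary_2_group_def)
  have inv: "inv z = z" if "z \<in> carrier G" for z
    using sq that by (intro inv_equality) auto
  have aa: "a \<otimes> v \<otimes> (a \<otimes> w) = v \<otimes> w" if "v \<in> V" "w \<in> V" for v w
  proof -
    have "a \<otimes> v \<otimes> (a \<otimes> w) = (a \<otimes> a) \<otimes> (v \<otimes> w)" using that a VG by (simp add: m_ac subset_iff)
    then show ?thesis using that a VG sq by (simp add: subset_iff)
  qed
  have va: "v \<otimes> (a \<otimes> w) = a \<otimes> (v \<otimes> w)" if "v \<in> V" "w \<in> V" for v w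
    using that a VG by (simp add: m_ac subset_iff)
  have av: "a \<otimes> v \<otimes> w = a \<otimes> (v \<otimes> w)" if "v \<in> V" "w \<in> V" for v w
    using that a VG by (simp add: m_ac subset_iff)
  show "subgroup (V \<union> (\<otimes>) a ` V) G"
  proof (rule subgroupI)
    fix x assume x: "x \<in> V \<union> (\<otimes>) a ` V"
    then have "x \<in> carrier G" using VG a by auto
    then show "inv x \<in> V \<union> (\<otimes>) a ` V" using x inv by simp
  next
    fix x y assume "x \<in> V \<union> (\<otimes>) a ` V" "y \<in> V \<union> (\<otimes>) a ` V"
    then show "x \<otimes> y \<in> V \<union> (\<otimes>) a ` V"
      using subgroup.m_closed[OF V] by (auto simp: aa va av)
  qed (use VG a subgroup.one_closed[OF V] in auto)
  have "V \<inter> (\<otimes>) a ` V = {}"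
  proof (rule ccontr)
    assume "V \<inter> (\<otimes>) a ` V \<noteq> {}"
    then obtain v where v: "v \<in> V" "a \<otimes> v \<in> V" by blast
    then have "a \<otimes> v \<otimes> v \<in> V" using subgroup.m_closed[OF V] by blast
    moreover have "a \<otimes> v \<otimes> v = a" using v(1) a VG sq by (simp add: m_assoc subset_iff)
    ultimately show False using a by simp
  qed
  moreover have "card ((\<otimes>) a ` V) = card V" using a VG by (intro card_image inj_onI) (auto simp: subset_iff)
  moreover have "finite V" using VG fin finite_subset by blast
  ultimately show "card (V \<union> (\<otimes>) a ` V) = 2 * card V" by (simp add: card_Un_disjoint)
qed

text \<open>Independent elements are picked from \<open>A\<close> until \<open>A\<close> lies in
  their span \<open>K\<close>; order 16 stops this after four. Up to rank 2 every element of
  \<open>K\<close> is a product of two elements of \<open>A\<close>, with \<open>s = \<one>\<close>.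
  At rank 3 and 4 the shift by the product of all picked elements reaches the products of three and
  more.\<close>

lemma (in group) elementary_stable:
  assumes fin: "finite (carrier G)" and el: "elementary_2_group G" and ord: "order G \<le> 16"
  shows "stable_group G"
proof (rule stable_groupI[OF fin])
  fix A assume A: "A \<subseteq> carrier G" "\<one> \<in> A"
  interpret comm_group G by (rule elementary_2_group_comm[OF el])
  have sq: "y \<otimes> y = \<one>" if "y \<in> carrier G" for y using el that by (simp add: elementary_2_group_def)
  have sq2: "y \<otimes> (y \<otimes> w) = w" if "y \<in> carrier G" "w \<in> carrier G" for y w
    using sq[OF that(1)] that by (simp add: m_assoc[symmetric])
  note ext = elementary_extend_subgroup[OF fin el] and stable = elementary_right_stable_subset[OF fin el _ _ A(2)]
  define V where "V a W = W \<union> (\<otimes>) a ` W" for a W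
  have V: "subgroup (V a W) G" "card (V a W) = 2 * card W" if "subgroup W G" "a \<in> carrier G" "a \<notin> W" for a W
    using ext that unfolding V_def by blast+
  have one: "subgroup {\<one>} G" by (rule triv_subgroup)
  show "right_stable_subset G A"
  proof (cases "A \<subseteq> {\<one>}")
    case True
    show ?thesis by (rule stable[OF one True, of \<one>]) (use A(2) in \<open>auto intro!: bexI[of _ \<one>]\<close>)
  next
    case False
    then obtain a where a: "a \<in> A" "a \<notin> {\<one>}" by blast
    then have aG: "a \<in> carrier G" using A by blast
    note V1 = V[OF one aG a(2)]
    have V1e: "V a {\<one>} = {\<one>, a}" using aG by (auto simp: V_def)
    show ?thesis
    proof (cases "A \<subseteq> V a {\<one>}")
      case True
      show ?thesis by (rule stable[OF V1(1) True, of \<one>]) (use a A(2) aG in \<open>auto simp: V1e intro: bexI[of _ \<one>] bexI[of _ a]\<close>)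
    next
      case False
      then obtain b where b: "b \<in> A" "b \<notin> V a {\<one>}" by blast
      then have bG: "b \<in> carrier G" using A by blast
      note V2 = V[OF V1(1) bG b(2)]
      have V2e: "V b (V a {\<one>}) = {\<one>, a, b, b \<otimes> a}" using bG by (auto simp: V_def[of b] V1e)
      show ?thesis
      proof (cases "A \<subseteq> V b (V a {\<one>})")
        case True
        have "\<exists>g\<in>A. (\<exists>h\<in>A. t = g \<otimes> h) \<or> t = \<one> \<otimes> g" if "t \<in> V b (V a {\<one>})" for t
        proof -
          have "\<one> = \<one> \<otimes> \<one>" "a = a \<otimes> \<one>" "b = b \<otimes> \<one>" using aG bG by simp_all
          then show ?thesis using that a(1) b(1) A(2) unfolding V2e by (elim insertE emptyE) metis+
        qed
        from stable[OF V2(1) True one_closed this] show ?thesis .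
      next
        case False
        then obtain c where c: "c \<in> A" "c \<notin> V b (V a {\<one>})" by blast
        then have cG: "c \<in> carrier G" using A by blast
        note V3 = V[OF V2(1) cG c(2)]
        have V3e: "V c (V b (V a {\<one>})) = {\<one>, a, b, b \<otimes> a, c, c \<otimes> a, c \<otimes> b, c \<otimes> (b \<otimes> a)}"
          using cG by (auto simp: V_def[of c] V2e)
        show ?thesis
        proof (cases "A \<subseteq> V c (V b (V a {\<one>}))")
          case True
          have "\<exists>g\<in>A. (\<exists>h\<in>A. t = g \<otimes> h) \<or> t = c \<otimes> (b \<otimes> a) \<otimes> g" if t: "t \<in> V c (V b (V a {\<one>}))" for t
          proof -
            define Q where "Q t \<longleftrightarrow> (\<exists>g\<in>A. (\<exists>h\<in>A. t = g \<otimes> h) \<or> t = c \<otimes> (b \<otimes> a) \<otimes> g)" for t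
            have AA: "Q (g \<otimes> h)" if "g \<in> A" "h \<in> A" for g h using that unfolding Q_def by blast
            have sA: "Q (c \<otimes> (b \<otimes> a) \<otimes> g)" if "g \<in> A" for g using that unfolding Q_def by blast
            have "Q \<one>" "Q a" "Q b" "Q c" "Q (c \<otimes> (b \<otimes> a))"
              using AA[OF A(2) A(2)] AA[OF a(1) A(2)] AA[OF b(1) A(2)] AA[OF c(1) A(2)] sA[OF A(2)] aG bG cG by simp_all
            then have "Q t" using t AA[OF b(1) a(1)] AA[OF c(1) a(1)] AA[OF c(1) b(1)]
              unfolding V3e by (elim insertE emptyE) simp_all
            then show ?thesis by (simp add: Q_def)
          qed
          from stable[OF V3(1) True _ this] show ?thesis using aG bG cG by simp
        next
          case False
          then obtain d where d: "d \<in> A" "d \<notin> V c (V b (V a {\<one>}))" by blast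
          then have dG: "d \<in> carrier G" using A by blast
          note V4 = V[OF V3(1) dG d(2)]
          have V4e: "V d (V c (V b (V a {\<one>}))) = {\<one>, a, b, b \<otimes> a, c, c \<otimes> a, c \<otimes> b, c \<otimes> (b \<otimes> a),
              d, d \<otimes> a, d \<otimes> b, d \<otimes> (b \<otimes> a), d \<otimes> c, d \<otimes> (c \<otimes> a), d \<otimes> (c \<otimes> b), d \<otimes> (c \<otimes> (b \<otimes> a))}"
            using dG by (auto simp: V_def[of d] V3e)
          have "card (V d (V c (V b (V a {\<one>})))) = 16" using V1 V2 V3 V4 by simp
          then have all: "V d (V c (V b (V a {\<one>}))) = carrier G"
            using ord subgroup.subset[OF V4(1)] fin by (intro card_seteq) (auto simp: order_def)
          let ?s = "d \<otimes> (c \<otimes> (b \<otimes> a))"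
          have "\<exists>g\<in>A. (\<exists>h\<in>A. t = g \<otimes> h) \<or> t = ?s \<otimes> g" if t: "t \<in> V d (V c (V b (V a {\<one>})))" for t
          proof -
            define Q where "Q t \<longleftrightarrow> (\<exists>g\<in>A. (\<exists>h\<in>A. t = g \<otimes> h) \<or> t = ?s \<otimes> g)" for t
            have AA: "Q (g \<otimes> h)" if "g \<in> A" "h \<in> A" for g h using that unfolding Q_def by blast
            have sA: "Q (?s \<otimes> g)" if "g \<in> A" for g using that unfolding Q_def by blast
            \<comment> \<open>A product of three basis elements is the product of all four times the
              missing one.\<close>
            have triple: "c \<otimes> (b \<otimes> a) = ?s \<otimes> d" "d \<otimes> (b \<otimes> a) = ?s \<otimes> c" "d \<otimes> (c \<otimes> a) = ?s \<otimes> b"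
              "d \<otimes> (c \<otimes> b) = ?s \<otimes> a"
              using aG bG cG dG by (simp_all add: m_ac sq sq2)
            have "Q (c \<otimes> (b \<otimes> a))" by (subst triple(1)) (rule sA[OF d(1)])
            moreover have "Q (d \<otimes> (b \<otimes> a))" by (subst triple(2)) (rule sA[OF c(1)])
            moreover have "Q (d \<otimes> (c \<otimes> a))" by (subst triple(3)) (rule sA[OF b(1)])
            moreover have "Q (d \<otimes> (c \<otimes> b))" by (subst triple(4)) (rule sA[OF a(1)])
            moreover have "Q \<one>" "Q a" "Q b" "Q c" "Q d" "Q ?s"
              using AA[OF A(2) A(2)] AA[OF a(1) A(2)] AA[OF b(1) A(2)] AA[OF c(1) A(2)] AA[OF d(1) A(2)]
                sA[OF A(2)] aG bG cG dG by simp_all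
            ultimately have "Q t" using t AA[OF b(1) a(1)] AA[OF c(1) a(1)] AA[OF c(1) b(1)]
                AA[OF d(1) a(1)] AA[OF d(1) b(1)] AA[OF d(1) c(1)]
              unfolding V4e by (elim insertE emptyE) simp_all
            then show ?thesis by (simp add: Q_def)
          qed
          from stable[OF V4(1) _ _ this] show ?thesis using A(1) all aG bG cG dG by simp
        qed
      qed
    qed
  qed
qed

text \<open>A copy of the elementary abelian group of order 32 whose carrier is an explicit
  enumeration, so that the witness can be evaluated.\<close>

definition bit_monoid :: "int list monoid" where
  "bit_monoid = \<lparr>carrier = set (List.n_lists 5 [0, 1]), monoid.mult = map2 (\<lambda>x y. (x + y) mod 2), one = replicate 5 0\<rparr>"

text \<open>\<open>A\<close> is the Hamming ball of radius 1, so packings are binary codes of length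
  5 and minimum distance 3. The repetition code is maximal, since every word has weight at most 2 or
  at least 3; yet there is a code with three words.\<close>

lemma unstable_bit_monoid: "unstable_witness bit_monoid
   {[0,0,0,0,0], [1,0,0,0,0], [0,1,0,0,0], [0,0,1,0,0], [0,0,0,1,0], [0,0,0,0,1]}
   {[0,0,0,0,0], [1,1,1,1,1]} {[0,0,0,0,0], [1,1,1,0,0], [0,0,1,1,1]}"
  by code_simp

lemma (in group) not_stable_elementary:
  assumes fin: "finite (carrier G)" and el: "elementary_2_group G" and ord: "order G = 2 ^ k" "k \<ge> 5"
  shows "\<not> stable_group G"
proof
  assume st: "stable_group G"
  have "order G = 2 ^ 5 * 2 ^ (k - 5)" using ord by (metis le_add_diff_inverse power_add)
  from sylow_thm[OF two_is_prime_nat is_group this fin]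
  obtain S where S: "subgroup S G" "card S = 2 ^ 5" by blast
  let ?S = "G\<lparr>carrier := S\<rparr>" and ?C = "cyclic_product (replicate 5 2)"
  have SG: "S \<subseteq> carrier G" using S(1) by (rule subgroup.subset)
  have gS: "group ?S" using S(1) by (simp add: subgroup_imp_group)
  have finS: "finite S" using SG fin finite_subset by blast
  have gC: "group ?C" by (rule group_cyclic_product)
  have "?S \<cong> ?C"
    using S SG el gS by (intro elementary_2_group_iso) (auto simp: order_def elementary_2_group_def)
  moreover have "stable_group ?S" by (rule stable_group_subgroup[OF is_group fin st S(1)])
  ultimately have stC: "stable_group ?C" using stable_group_iso[OF gS gC] finS by simp
  have Z: "carrier (integer_mod_group 2) = {0, 1}" by (auto simp: carrier_integer_mod_group)
  have rep: "replicate 5 (2::nat) = [2, 2, 2, 2, 2]" by (simp add: numeral_eq_Suc)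
  have len5: "length xs = 5 \<longleftrightarrow> (\<exists>a b c d e. xs = [a, b, c, d, e])" for xs :: "int list"
    by (auto simp: numeral_eq_Suc length_Suc_conv)
  have car: "carrier bit_monoid = carrier ?C"
    unfolding rep by (rule Set.set_eqI) (auto simp: bit_monoid_def set_n_lists len5 Z)
  have mult: "x \<otimes>\<^bsub>bit_monoid\<^esub> y = x \<otimes>\<^bsub>?C\<^esub> y" if "x \<in> carrier ?C" "y \<in> carrier ?C" for x y
    using that unfolding rep by (auto simp: bit_monoid_def)
  have "finite (carrier bit_monoid)" by (simp add: bit_monoid_def)
  then have finC: "finite (carrier ?C)" using car by simp
  have hom: "id \<in> hom bit_monoid ?C" using car mult by (auto simp: hom_def)
  have gB: "group bit_monoid"
  proof (rule group_if_mon[OF gC _ _ _ hom])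
    show one: "id \<one>\<^bsub>bit_monoid\<^esub> = \<one>\<^bsub>?C\<^esub>" unfolding rep by (simp add: bit_monoid_def numeral_eq_Suc)
    show "\<one>\<^bsub>bit_monoid\<^esub> \<in> carrier bit_monoid"
      using one monoid.one_closed[OF group.is_monoid[OF gC]] unfolding car by simp
    show "x \<otimes>\<^bsub>bit_monoid\<^esub> y \<in> carrier bit_monoid" if "x \<in> carrier bit_monoid" "y \<in> carrier bit_monoid" for x y
      using that mult group.is_monoid[OF gC] unfolding car by (simp add: monoid.m_closed)
  qed (use car finC in auto)
  then have "stable_group bit_monoid" using stable_group_mon[OF gC gB finC stC hom] by simp
  moreover have "\<not> stable_group bit_monoid"
    using unstable_bit_monoid group.not_stable_groupI[OF gB _ group.subgroup_self[OF gB]] finC car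
    unfolding unstable_witness_def by metis
  ultimately show False by simp
qed

section \<open>Elements of odd prime order acting on elementary abelian 2-groups\<close>

context group
begin

text \<open>Otherwise the product of the two elements would have order \<open>p q\<close> with
  distinct primes from 2, 3, 5, 7, that is 6, 10, 14, 15, 21 or 35, and none of these is an
  admissible element order.\<close>

lemma no_mixed_commuting:
  assumes st: "stable_group G" and fin: "finite (carrier G)" and xy: "x \<in> carrier G" "y \<in> carrier G" "x \<otimes> y = y \<otimes> x"
    and p: "Factorial_Ring.prime (ord x)" "Factorial_Ring.prime (ord y)"
  shows "ord x = ord y"
proof (rule ccontr)
  assume ne: "ord x \<noteq> ord y"
  let ?p = "ord x" and ?q = "ord y" and ?t = "x \<otimes> y"
  have tG: "?t \<in> carrier G" using xy by simp
  have pow: "?t [^] k = x [^] k \<otimes> y [^] k" for k :: nat using pow_mult_distrib[OF xy(3,1,2)] .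
  have P: "?p \<in> {2, 3, 5, 7}" and Q: "?q \<in> {2, 3, 5, 7}"
    using stable_prime_divisor[OF st fin p(1) ord_dvd_group_order[OF xy(1)]]
      stable_prime_divisor[OF st fin p(2) ord_dvd_group_order[OF xy(2)]] .
  have T: "ord ?t \<in> {1, 2, 3, 4, 5, 7}" by (rule stable_group_ord[OF st fin tG])
  have "?t [^] ?p = y [^] ?p" "?t [^] ?q = x [^] ?q" using pow xy by simp_all
  then have E: "ord ?t dvd ?p \<longleftrightarrow> ?q dvd ?p" "ord ?t dvd ?q \<longleftrightarrow> ?p dvd ?q"
    using pow_eq_id[OF tG] pow_eq_id[OF xy(1)] pow_eq_id[OF xy(2)] by metis+
  have "?t [^] (?p * ?q) = (x [^] ?p) [^] ?q \<otimes> (y [^] ?q) [^] ?p"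
    using pow[of "?p * ?q"] xy by (simp add: nat_pow_pow mult.commute[of ?q ?p] del: pow_ord_eq_1)
  then have "?t [^] (?p * ?q) = \<one>" using xy by simp
  then have D: "ord ?t dvd ?p * ?q" using pow_eq_id[OF tG] by blast
  show False using P Q T D E ne by (elim insertE emptyE) simp_all
qed

lemma normalizing_inverse:
  assumes fin: "finite (carrier G)" and N: "subgroup N G" and y: "y \<in> carrier G"
    and norm: "\<And>n. n \<in> N \<Longrightarrow> y \<otimes> n \<otimes> inv y \<in> N" and n: "n \<in> N"
  shows "inv y \<otimes> n \<otimes> y \<in> N"
proof -
  have NG: "N \<subseteq> carrier G" using N by (rule subgroup.subset)
  have "inj_on (\<lambda>n. y \<otimes> n \<otimes> inv y) N" using NG y by (intro inj_onI) (auto simp: subset_iff)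
  moreover have "(\<lambda>n. y \<otimes> n \<otimes> inv y) ` N \<subseteq> N" using norm by auto
  ultimately have "(\<lambda>n. y \<otimes> n \<otimes> inv y) ` N = N"
    using endo_inj_surj finite_subset[OF NG fin] by blast
  then obtain m where m: "m \<in> N" "n = y \<otimes> m \<otimes> inv y" using n by blast
  have mG: "m \<in> carrier G" using m NG by blast
  have "inv y \<otimes> n \<otimes> y = (inv y \<otimes> y) \<otimes> m \<otimes> (inv y \<otimes> y)" unfolding m(2) using mG y by (simp only: m_assoc m_closed inv_closed)
  then show ?thesis using m mG y by simp
qed

lemma normalizing_pow:
  assumes fin: "finite (carrier G)" and N: "subgroup N G" and y: "y \<in> carrier G"
    and norm: "\<And>n. n \<in> N \<Longrightarrow> y \<otimes> n \<otimes> inv y \<in> N" and n: "n \<in> N"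
  shows "inv (y [^] (i::nat)) \<otimes> n \<otimes> y [^] i \<in> N"
proof (induction i)
  case 0
  then show ?case using n subgroup.mem_carrier[OF N] by simp
next
  case (Suc i)
  have "inv (y [^] Suc i) \<otimes> n \<otimes> y [^] Suc i = inv y \<otimes> (inv (y [^] i) \<otimes> n \<otimes> y [^] i) \<otimes> y"
    using y subgroup.mem_carrier[OF N n] by (simp add: inv_mult_group m_assoc)
  then show ?case using normalizing_inverse[OF fin N y norm Suc.IH] by simp
qed

lemma subgroup_extend_cyclic:
  assumes fin: "finite (carrier G)" and N: "subgroup N G" and y: "y \<in> carrier G"
    and norm: "\<And>n. n \<in> N \<Longrightarrow> y \<otimes> n \<otimes> inv y \<in> N"
  shows "subgroup {y [^] (i::nat) \<otimes> n | i n. n \<in> N} G" (is "subgroup ?K G")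
proof (rule subgroupI)
  have NG: "N \<subseteq> carrier G" using N by (rule subgroup.subset)
  have swap: "n \<otimes> y [^] i = y [^] i \<otimes> (inv (y [^] i) \<otimes> n \<otimes> y [^] i)" if "n \<in> N" for n and i :: nat
  proof -
    have "n \<in> carrier G" using that NG by blast
    then have "y [^] i \<otimes> (inv (y [^] i) \<otimes> n \<otimes> y [^] i) = (y [^] i \<otimes> inv (y [^] i)) \<otimes> n \<otimes> y [^] i"
      using y by (simp only: m_assoc m_closed inv_closed nat_pow_closed)
    then show ?thesis using y \<open>n \<in> carrier G\<close> by simp
  qed
  show "?K \<subseteq> carrier G" using NG y by auto
  show "?K \<noteq> {}" using subgroup.one_closed[OF N] by blast
  fix a assume "a \<in> ?K"
  then obtain i :: nat and n where a: "a = y [^] i \<otimes> n" "n \<in> N" by blast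
  have nG: "n \<in> carrier G" using a NG by blast
  { fix b assume "b \<in> ?K"
    then obtain j :: nat and m where b: "b = y [^] j \<otimes> m" "m \<in> N" by blast
    have mG: "m \<in> carrier G" using b NG by blast
    let ?n = "inv (y [^] j) \<otimes> n \<otimes> y [^] j"
    have n': "?n \<in> N" by (rule normalizing_pow[OF fin N y norm a(2)])
    have "a \<otimes> b = y [^] i \<otimes> (n \<otimes> y [^] j) \<otimes> m" unfolding a b using nG mG y by (simp add: m_assoc)
    also have "\<dots> = y [^] (i + j) \<otimes> (?n \<otimes> m)"
      unfolding swap[OF a(2)] nat_pow_mult[OF y, symmetric] using y mG n' NG by (simp add: m_assoc subset_iff)
    finally show "a \<otimes> b \<in> ?K" using subgroup.m_closed[OF N n' b(2)] by blast }
  have "inv (y [^] i) = y [^] (i * (ord y - 1))"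
  proof (rule inv_equality)
    have "ord y > 0" using ord_ge_1[OF fin y] by simp
    then have "y [^] (i * (ord y - 1)) \<otimes> y [^] i = y [^] (ord y * i)"
      using y by (simp add: nat_pow_mult algebra_simps)
    also have "\<dots> = (y [^] ord y) [^] i" using y by (simp add: nat_pow_pow del: pow_ord_eq_1)
    finally show "y [^] (i * (ord y - 1)) \<otimes> y [^] i = \<one>" using y by simp
  qed (use y in auto)
  then have "inv a = inv n \<otimes> y [^] (i * (ord y - 1))" unfolding a using nG y by (simp add: inv_mult_group)
  then have "inv a = y [^] (i * (ord y - 1)) \<otimes> (inv (y [^] (i * (ord y - 1))) \<otimes> inv n \<otimes> y [^] (i * (ord y - 1)))"
    using swap[OF subgroup.m_inv_closed[OF N a(2)]] by simp
  then show "inv a \<in> ?K" using normalizing_pow[OF fin N y norm subgroup.m_inv_closed[OF N a(2)]] by blast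
qed

text \<open>Take \<open>W\<close> maximal among the subgroups containing \<open>m\<close> and
  avoiding \<open>n\<close>. Adjoining any further \<open>x\<close> must capture \<open>n\<close>,
  so \<open>n x \<in> W\<close>; thus \<open>W\<close> has index 2.\<close>

lemma elementary_maximal_subgroup:
  assumes fin: "finite (carrier G)" and el: "elementary_2_group G"
    and n: "n \<in> carrier G" "m \<in> carrier G" "n \<noteq> m" "n \<noteq> \<one>" "m \<noteq> \<one>"
  obtains W where "subgroup W G" "m \<in> W" "n \<notin> W" "\<And>x. x \<in> carrier G \<Longrightarrow> x \<notin> W \<Longrightarrow> n \<otimes> x \<in> W"
proof -
  interpret comm_group G by (rule elementary_2_group_comm[OF el])
  have sq: "y \<otimes> y = \<one>" if "y \<in> carrier G" for y using el that by (simp add: elementary_2_group_def)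
  let ?F = "{W. subgroup W G \<and> m \<in> W \<and> n \<notin> W}"
  have "finite ?F" by (rule finite_subset[of _ "Pow (carrier G)"]) (use fin subgroup.subset in auto)
  moreover have "{\<one>} \<union> (\<otimes>) m ` {\<one>} \<in> ?F"
    using elementary_extend_subgroup(1)[OF fin el triv_subgroup, of m] n by auto
  ultimately obtain W where W: "W \<in> ?F" and max: "\<And>V. V \<in> ?F \<Longrightarrow> W \<subseteq> V \<Longrightarrow> W = V"
    by (metis (no_types, lifting) finite_has_maximal2)
  have "n \<otimes> x \<in> W" if x: "x \<in> carrier G" "x \<notin> W" for x
  proof -
    have V: "subgroup (W \<union> (\<otimes>) x ` W) G" using elementary_extend_subgroup(1)[OF fin el _ x] W by blast
    have "x \<in> W \<union> (\<otimes>) x ` W" using W subgroup.one_closed[of W G] x(1) by (auto intro!: image_eqI[of _ _ \<one>])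
    then have "W \<union> (\<otimes>) x ` W \<notin> ?F" using max[of "W \<union> (\<otimes>) x ` W"] x(2) by blast
    then have "n \<in> (\<otimes>) x ` W" using V W by auto
    then obtain w where w: "w \<in> W" "n = x \<otimes> w" by blast
    have wG: "w \<in> carrier G" using w W subgroup.mem_carrier[of W G] by auto
    have "n \<otimes> x = (x \<otimes> x) \<otimes> w" unfolding w(2) using x wG by (simp add: m_ac)
    then show ?thesis using sq[OF x(1)] w wG by simp
  qed
  then show ?thesis using that W by blast
qed

text \<open>Let \<open>Q = \<langle>y\<rangle>\<close> and \<open>A = Q \<union> {n}\<close>. Packings of \<open>N Q\<close> choose at most one element \<open>y\<^sup>i m\<close> from each
  coset \<open>Q m\<close>, which then blocks \<open>n\<^sub>i m\<close>, where \<open>n\<^sub>i\<close> is the conjugate of \<open>n\<close> by \<open>y\<^sup>-\<^sup>i\<close>. Choosing \<open>i = 0\<close>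
  throughout an index \<open>2\<close> subgroup \<open>W\<close> of \<open>N\<close> with \<open>n \<notin> W\<close> blocks everything else. If some \<open>n\<^sub>i\<close> lies
  in \<open>W\<close> and some \<open>n\<^sub>j \<noteq> n\<close> does not, then moving \<open>\<one>\<close> to \<open>y\<^sup>j\<close> makes room for \<open>y\<^sup>i n\<close>.\<close>

lemma not_stable_if_fixed_point_free:
  assumes fin: "finite (carrier G)" and N: "subgroup N G" and el: "\<And>n. n \<in> N \<Longrightarrow> n \<otimes> n = \<one>"
    and y: "y \<in> carrier G" "Factorial_Ring.prime (ord y)" "ord y \<noteq> 2"
    and norm: "\<And>n. n \<in> N \<Longrightarrow> y \<otimes> n \<otimes> inv y \<in> N"
    and fpf: "\<And>n. n \<in> N \<Longrightarrow> y \<otimes> n = n \<otimes> y \<Longrightarrow> n = \<one>"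
    and n: "n \<in> N" "n \<noteq> \<one>"
  shows "\<not> stable_group G"
proof -
  have NG: "N \<subseteq> carrier G" using N by (rule subgroup.subset)
  let ?N = "G\<lparr>carrier := N\<rparr>"
  interpret NN: group ?N using N by (rule subgroup_imp_group)
  have elN: "elementary_2_group ?N" using el by (simp add: elementary_2_group_def)
  interpret NC: comm_group ?N by (rule NN.elementary_2_group_comm[OF elN])
  have finN: "finite N" using NG fin finite_subset by blast
  have comm: "u \<otimes> v = v \<otimes> u" if "u \<in> N" "v \<in> N" for u v using NC.m_comm[of u v] that by simp
  have nG: "n \<in> carrier G" using n NG by blast
  define s where "s i = inv (y [^] (i::nat)) \<otimes> n \<otimes> y [^] i" for i
  have sN: "s i \<in> N" for i unfolding s_def by (rule normalizing_pow[OF fin N y(1) norm n(1)])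
  have sG: "s i \<in> carrier G" for i using sN NG by blast
  have s0: "s 0 = n" using nG by (simp add: s_def)
  have sSuc: "s (Suc i) = inv y \<otimes> s i \<otimes> y" for i
    using y nG by (simp add: s_def inv_mult_group m_assoc)
  have ns: "n \<otimes> y [^] i = y [^] i \<otimes> s i" for i
  proof -
    have "y [^] i \<otimes> s i = (y [^] i \<otimes> inv (y [^] i)) \<otimes> n \<otimes> y [^] i"
      unfolding s_def using y nG by (simp only: m_assoc m_closed inv_closed nat_pow_closed)
    then show ?thesis using y nG by simp
  qed
  have s_ne: "s i \<noteq> n" if i: "0 < i" "i < ord y" for i
  proof
    assume "s i = n"
    then have c: "y [^] i \<otimes> n = n \<otimes> y [^] i" using ns[of i] by simp
    have "coprime (ord y) i" using y(2) i by (metis dvd_imp_le leD prime_imp_coprime)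
    then obtain c' d where "i * c' = ord y * d + 1"
      using bezout_nat[of i "ord y"] i by (auto simp: coprime_iff_gcd_eq_1 gcd.commute)
    then have "(y [^] i) [^] c' = (y [^] ord y) [^] d \<otimes> y" using y(1) by (simp add: nat_pow_pow del: pow_ord_eq_1)
    then have "(y [^] i) [^] c' = y" using y(1) by simp
    then have "y \<otimes> n = n \<otimes> y" using pow_commutes[of "y [^] i" n c' 1] c y(1) nG by simp
    then show False using fpf n by blast
  qed
  have ord1: "1 < ord y" using y(2) by (rule prime_gt_1_nat)
  have "s 1 \<noteq> \<one>"
  proof
    assume "s 1 = \<one>"
    then have "n \<otimes> y = \<one> \<otimes> y" using ns[of 1] y(1) by simp
    then have "n = \<one>" using nG y(1) by (metis r_cancel one_closed)
    then show False using n(2) by blast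
  qed
  \<comment> \<open>Prescribing \<open>s 1 \<in> W\<close> fixes which conjugate of \<open>n\<close>
    lies in \<open>W\<close>; the later exchange can then always use the exponent 1.\<close>
  then obtain W where W: "subgroup W ?N" "s 1 \<in> W" "n \<notin> W" "\<And>x. x \<in> N \<Longrightarrow> x \<notin> W \<Longrightarrow> n \<otimes> x \<in> W"
    using NN.elementary_maximal_subgroup[of n "s 1"] elN finN n sN s_ne[of 1] ord1 by auto
  have WN: "W \<subseteq> N" using subgroup.subset[OF W(1)] by simp
  have W1: "\<one> \<in> W" using subgroup.one_closed[OF W(1)] by simp
  have Wm: "u \<otimes> v \<in> W" if "u \<in> W" "v \<in> W" for u v using subgroup.m_closed[OF W(1) that] by simp
  have nW: "n \<otimes> w \<notin> W" if "w \<in> W" for w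
  proof
    assume "n \<otimes> w \<in> W"
    then have "n \<otimes> w \<otimes> w \<in> W" using Wm that by blast
    moreover have "n \<otimes> w \<otimes> w = n" using that WN NG nG el by (simp add: m_assoc subset_iff)
    ultimately show False using W(3) by simp
  qed
  \<comment> \<open>A conjugate other than \<open>n\<close> must lie outside \<open>W\<close>. The
    product of all conjugates \<open>s 0, ..., s (ord y - 1)\<close> commutes with \<open>y\<close>,
    hence is \<open>\<one>\<close>. If all factors except \<open>s 0 = n\<close> were in
    \<open>W\<close>, then \<open>n\<close> would be too.\<close>
  obtain j where j: "0 < j" "j < ord y" "s j \<notin> W"
  proof (rule ccontr)
    assume "\<not> thesis"
    then have sW: "s i \<in> W" if "0 < i" "i < ord y" for i using that \<open>\<And>j. 0 < j \<Longrightarrow> j < ord y \<Longrightarrow> s j \<notin> W \<Longrightarrow> thesis\<close> by blast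
    define P where "P k = rec_nat \<one> (\<lambda>i u. u \<otimes> s i) k" for k
    have P0: "P 0 = \<one>" and PS: "P (Suc k) = P k \<otimes> s k" for k by (simp_all add: P_def)
    have PN: "P k \<in> N" for k
      by (induction k) (simp_all add: P0 PS subgroup.one_closed[OF N] subgroup.m_closed[OF N] sN)
    have PG: "P k \<in> carrier G" for k using PN NG by blast
    \<comment> \<open>Conjugation by \<open>y\<close> shifts the conjugates by one place. Over a
      full period the product is only rotated, because \<open>s (ord y) = n\<close> and
      \<open>N\<close> is abelian, so it is fixed.\<close>
    have rot: "P (Suc k) = n \<otimes> (inv y \<otimes> P k \<otimes> y)" for k
    proof (induction k)
      case 0
      show ?case using nG y(1) by (simp add: P0 PS s0)
    next
      case (Suc k)
      have "P (Suc (Suc k)) = n \<otimes> (inv y \<otimes> P k \<otimes> y) \<otimes> s (Suc k)" using Suc.IH by (simp add: PS[of "Suc k"])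
      also have "\<dots> = n \<otimes> (inv y \<otimes> P k \<otimes> (y \<otimes> inv y) \<otimes> s k \<otimes> y)"
        unfolding sSuc using nG y(1) PG[of k] sG[of k] by (simp only: m_assoc m_closed inv_closed)
      also have "\<dots> = n \<otimes> (inv y \<otimes> (P k \<otimes> s k) \<otimes> y)" using nG y(1) PG[of k] sG[of k] by (simp add: m_assoc)
      finally show ?case by (simp add: PS)
    qed
    let ?q = "ord y"
    have sq: "s ?q = n" using y(1) nG by (simp add: s_def)
    have "n \<otimes> P ?q = n \<otimes> (inv y \<otimes> P ?q \<otimes> y)" using rot[of ?q] PS[of ?q] sq comm[OF n(1) PN[of ?q]] by simp
    then have "P ?q = inv y \<otimes> P ?q \<otimes> y" using nG PG[of ?q] y(1) by (metis l_cancel m_closed inv_closed)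
    then have "y \<otimes> P ?q = y \<otimes> (inv y \<otimes> P ?q \<otimes> y)" by simp
    also have "\<dots> = (y \<otimes> inv y) \<otimes> P ?q \<otimes> y" using PG[of ?q] y(1) by (simp only: m_assoc m_closed inv_closed)
    finally have "y \<otimes> P ?q = P ?q \<otimes> y" using PG[of ?q] y(1) by simp
    then have P1: "P ?q = \<one>" using fpf PN by blast
    have "n \<otimes> P (Suc k) \<in> W" if "Suc k \<le> ?q" for k
      using that
    proof (induction k)
      case 0
      show ?case using nG el[OF n(1)] W1 by (simp add: P0 PS s0)
    next
      case (Suc k)
      then have "n \<otimes> P (Suc k) \<otimes> s (Suc k) \<in> W" using Wm sW[of "Suc k"] by simp
      then show ?case using nG PG[of "Suc k"] sG[of "Suc k"] by (simp add: PS[of "Suc k"] m_assoc)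
    qed
    from this[of "?q - 1"] have "n \<otimes> \<one> \<in> W" using ord1 P1 by simp
    then show False using W(3) nG by simp
  qed
  let ?Q = "{y [^] (i::nat) | i. True}"
  let ?A = "?Q \<union> {n}" and ?K = "{y [^] (i::nat) \<otimes> m | i m. m \<in> N}"
  have pow_N: "y [^] i = \<one>" if "y [^] (i::nat) \<in> N" for i
  proof -
    have "y \<otimes> y [^] i = y [^] i \<otimes> y" using pow_commutes[OF y(1) y(1) refl, of 1 i] y(1) by simp
    then show ?thesis using fpf that by blast
  qed
  have coset: "y [^] i = y [^] j \<and> u = v" if "y [^] (i::nat) \<otimes> u = y [^] (j::nat) \<otimes> v" "u \<in> N" "v \<in> N" for i j u v
  proof -
    have uvG: "u \<in> carrier G" "v \<in> carrier G" using that NG by auto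
    have "inv (y [^] j) \<otimes> y [^] i = v \<otimes> inv u"
    proof -
      have "inv (y [^] j) \<otimes> (y [^] i \<otimes> u) \<otimes> inv u = inv (y [^] j) \<otimes> (y [^] j \<otimes> v) \<otimes> inv u" using that(1) by simp
      moreover have "inv (y [^] j) \<otimes> (y [^] i \<otimes> u) \<otimes> inv u = inv (y [^] j) \<otimes> y [^] i" using uvG y(1) by (simp add: m_assoc)
      moreover have "inv (y [^] j) \<otimes> (y [^] j \<otimes> v) \<otimes> inv u = v \<otimes> inv u" using uvG y(1) by (simp add: m_assoc[symmetric])
      ultimately show ?thesis by simp
    qed
    then have "inv (y [^] j) \<otimes> y [^] i \<in> N"
      using that(2,3) subgroup.m_closed[OF N] subgroup.m_inv_closed[OF N] by simp
    moreover have "inv (y [^] j) \<otimes> y [^] i = y [^] (j * (ord y - 1) + i)"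
    proof -
      have "y [^] (j * (ord y - 1)) \<otimes> y [^] j = y [^] (ord y * j)"
        using y(1) ord1 by (simp add: nat_pow_mult algebra_simps)
      also have "\<dots> = (y [^] ord y) [^] j" using y(1) by (simp add: nat_pow_pow del: pow_ord_eq_1)
      finally have "inv (y [^] j) = y [^] (j * (ord y - 1))" using y(1) by (intro inv_equality) auto
      then show ?thesis using y(1) by (simp add: nat_pow_mult)
    qed
    ultimately have "inv (y [^] j) \<otimes> y [^] i = \<one>" using pow_N by simp
    then have yij: "y [^] i = y [^] j" using y(1) by (metis inv_closed inv_equality inv_inv nat_pow_closed inv_comm)
    then show ?thesis using that(1) uvG y(1) by simp
  qed
  \<comment> \<open>The powers of \<open>y\<close> in \<open>?A\<close> absorb the left factors, so
    those translates meet exactly when the components in \<open>N\<close> agree. The element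
    \<open>n\<close> turns \<open>y^i u\<close> into \<open>y^i (s i u)\<close>, which accounts for
    the other two exceptions.\<close>
  have sep: "separated G ?A (y [^] i \<otimes> u) (y [^] j \<otimes> v) \<longleftrightarrow> u \<noteq> v \<and> v \<noteq> s i \<otimes> u \<and> u \<noteq> s j \<otimes> v"
    if uv: "u \<in> N" "v \<in> N" for i j :: nat and u v
  proof -
    have uvG: "u \<in> carrier G" "v \<in> carrier G" using uv NG by auto
    have nu: "n \<otimes> (y [^] k \<otimes> w) = y [^] k \<otimes> (s k \<otimes> w)" if "w \<in> carrier G" for k :: nat and w
      using ns[of k] that nG y(1) sG[of k] by (simp add: m_assoc[symmetric])
    have qu: "y [^] (l::nat) \<otimes> (y [^] (k::nat) \<otimes> w) = y [^] (l + k) \<otimes> w" if "w \<in> carrier G" for k l w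
      using that y(1) by (simp add: m_assoc[symmetric] nat_pow_mult)
    have suN: "s i \<otimes> u \<in> N" "s j \<otimes> v \<in> N" using subgroup.m_closed[OF N sN] uv by blast+
    have transl: "\<exists>k. y [^] (k::nat) \<otimes> y [^] (i::nat) = y [^] (j::nat)" for i j
    proof -
      have "j + i * (ord y - 1) + i = j + ord y * i" using ord1 by (cases "ord y") simp_all
      then have "y [^] (j + i * (ord y - 1)) \<otimes> y [^] i = y [^] (j + ord y * i)"
        by (simp only: nat_pow_mult[OF y(1)])
      also have "\<dots> = y [^] j \<otimes> (y [^] ord y) [^] i" using y(1) by (simp add: nat_pow_pow nat_pow_mult del: pow_ord_eq_1)
      finally show ?thesis using y(1) by auto
    qed
    show ?thesis
    proof
      assume sp: "separated G ?A (y [^] i \<otimes> u) (y [^] j \<otimes> v)"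
      obtain k :: nat where k: "y [^] k \<otimes> y [^] i = y [^] j" using transl by blast
      obtain k' :: nat where k': "y [^] k' \<otimes> y [^] j = y [^] i" using transl by blast
      have a: "y [^] k \<in> ?A" "\<one> \<in> ?A" "n \<in> ?A" "y [^] k' \<in> ?A" using nat_pow_0[of y] by (auto intro: exI[of _ "0::nat"])
      have kw: "y [^] k \<otimes> (y [^] i \<otimes> w) = y [^] j \<otimes> w" "y [^] k' \<otimes> (y [^] j \<otimes> w) = y [^] i \<otimes> w"
        if "w \<in> carrier G" for w
        using k k' that y(1) by (simp_all add: m_assoc[symmetric])
      have "u \<noteq> v" using sp a(1,2) kw(1)[OF uvG(1)] uvG y(1) unfolding separated_def by (metis l_one m_closed nat_pow_closed)
      moreover have "v \<noteq> s i \<otimes> u"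
        using sp a(3,4) kw(2)[OF uvG(2)] nu[OF uvG(1), of i] unfolding separated_def by metis
      moreover have "u \<noteq> s j \<otimes> v"
        using sp a(3,1) kw(1)[OF uvG(1)] nu[OF uvG(2), of j] unfolding separated_def by metis
      ultimately show "u \<noteq> v \<and> v \<noteq> s i \<otimes> u \<and> u \<noteq> s j \<otimes> v" by blast
    next
      assume h: "u \<noteq> v \<and> v \<noteq> s i \<otimes> u \<and> u \<noteq> s j \<otimes> v"
      show "separated G ?A (y [^] i \<otimes> u) (y [^] j \<otimes> v)"
        unfolding separated_def
      proof (intro ballI notI)
        fix a b assume ab: "a \<in> ?A" "b \<in> ?A" "a \<otimes> (y [^] i \<otimes> u) = b \<otimes> (y [^] j \<otimes> v)"
        show False
        proof (cases "a = n")
          case an: True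
          show False
          proof (cases "b = n")
            case True
            then have "y [^] i \<otimes> u = y [^] j \<otimes> v" using an ab(3) nG uvG y(1) by simp
            then show False using coset uv h by blast
          next
            case False
            then obtain l where "b = y [^] (l::nat)" using ab by blast
            then have "y [^] i \<otimes> (s i \<otimes> u) = y [^] (l + j) \<otimes> v"
              using ab(3) an nu[OF uvG(1)] qu[OF uvG(2)] by simp
            then show False using coset[OF _ suN(1) uv(2)] h by blast
          qed
        next
          case False
          then obtain l where l: "a = y [^] (l::nat)" using ab by blast
          show False
          proof (cases "b = n")
            case True
            then have "y [^] (l + i) \<otimes> u = y [^] j \<otimes> (s j \<otimes> v)"
              using ab(3) l nu[OF uvG(2)] qu[OF uvG(1)] by simp
            then show False using coset[OF _ uv(1) suN(2)] h by blast
          next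
            case False
            then obtain l' where "b = y [^] (l'::nat)" using ab by blast
            then have "y [^] (l + i) \<otimes> u = y [^] (l' + j) \<otimes> v"
              using ab(3) l qu[OF uvG(1)] qu[OF uvG(2)] by simp
            then show False using coset uv h by blast
          qed
        qed
      qed
    qed
  qed
  have sep0: "separated G ?A u (y [^] j \<otimes> v) \<longleftrightarrow> u \<noteq> v \<and> v \<noteq> n \<otimes> u \<and> u \<noteq> s j \<otimes> v"
    if "u \<in> N" "v \<in> N" for j :: nat and u v
    using sep[OF that, of 0 j] that NG s0 by (simp add: subset_iff)
  have sep00: "separated G ?A u v \<longleftrightarrow> u \<noteq> v \<and> v \<noteq> n \<otimes> u \<and> u \<noteq> n \<otimes> v"
    if "u \<in> N" "v \<in> N" for u v
    using sep0[OF that, of 0] that NG s0 by (simp add: subset_iff)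
  \<comment> \<open>The exchange: \<open>\<one>\<close> is moved to \<open>y^j\<close> and
    \<open>y n\<close> is added. Both fit because \<open>s j \<notin> W\<close>, while
    \<open>s 1 \<in> W\<close> and \<open>n \<notin> W\<close> give
    \<open>s 1 n \<notin> W\<close>.\<close>
  let ?B = "insert (y [^] j) (insert (y \<otimes> n) (W - {\<one>}))"
  have N1: "\<one> \<in> N" using subgroup.one_closed[OF N] .
  have finW: "finite W" using WN finN finite_subset by blast
  show ?thesis
  proof (rule not_stable_groupI[OF fin subgroup_extend_cyclic[OF fin N y(1) norm], where A = ?A and B = W and C = ?B])
    have "n = y [^] (0::nat) \<otimes> n" using nG by simp
    moreover have "y [^] i = y [^] i \<otimes> \<one>" for i :: nat using y(1) by simp
    ultimately show "?A \<subseteq> ?K" using n(1) N1 by blast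
    show "?A \<noteq> {}" by blast
    show "maximal_packing G ?K ?A W"
      unfolding maximal_packing_def
    proof (intro conjI ballI)
      have "w = y [^] (0::nat) \<otimes> w" if "w \<in> W" for w using that WN NG by (simp add: subset_iff)
      then show "W \<subseteq> ?K" using WN by blast
      show "packing G ?A W"
        unfolding packing_def using sep00 WN nW by (metis subsetD)
      fix x assume "x \<in> ?K - W"
      then obtain i m where x: "x = y [^] (i::nat) \<otimes> m" "m \<in> N" by blast
      show "\<exists>b\<in>W. \<not> separated G ?A x b"
      proof (cases "m \<in> W")
        case True
        then have "\<not> separated G ?A m x" using sep0[OF x(2,2)] x(1) by simp
        then show ?thesis using True separated_sym by metis
      next
        case False
        then have w: "n \<otimes> m \<in> W" using W(4) x(2) by blast
        have "n \<otimes> (n \<otimes> m) = m" using el[OF n(1)] nG x(2) NG by (simp add: m_assoc[symmetric] subset_iff)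
        then have "\<not> separated G ?A (n \<otimes> m) x" using sep0[of "n \<otimes> m" m i] w WN x by auto
        then show ?thesis using w separated_sym by metis
      qed
    qed
    have yj: "y [^] j = y [^] j \<otimes> \<one>" and yn: "y \<otimes> n = y [^] (1::nat) \<otimes> n" using y(1) by simp_all
    have "w = y [^] (0::nat) \<otimes> w" if "w \<in> W" for w using that WN NG by (simp add: subset_iff)
    then show "?B \<subseteq> ?K" using WN yj yn n(1) N1 by blast
    have s1: "n \<noteq> s j" using s_ne[OF j(1,2)] by simp
    have sn: "s 1 \<otimes> n \<notin> W" using nW[OF W(2)] comm[OF sN[of 1] n(1)] by simp
    have sep_jn: "separated G ?A (y [^] j) (y \<otimes> n)"
      using sep[OF N1 n(1), of j 1] yj yn n(2) s1 sG[of j] sn W1 by auto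
    have sep_wj: "separated G ?A w (y [^] j)" if "w \<in> W - {\<one>}" for w
    proof -
      have "\<one> \<noteq> n \<otimes> w" using nW[of w] W1 that by auto
      then show ?thesis using sep0[of w \<one> j] yj that WN N1 j(3) sG[of j] by auto
    qed
    have sep_wn: "separated G ?A w (y \<otimes> n)" if "w \<in> W - {\<one>}" for w
    proof -
      have "n \<noteq> n \<otimes> w" using that WN NG nG by (metis Diff_iff insertI1 r_cancel_one' l_cancel_one' subsetD)
      then show ?thesis using sep0[of w n 1] yn that WN n(1) W(3) sn by auto
    qed
    have sep_ww: "separated G ?A w w'" if "w \<in> W - {\<one>}" "w' \<in> W - {\<one>}" "w \<noteq> w'" for w w'
      using sep00 that WN nW by (metis DiffD1 subsetD)
    have pW: "packing G ?A (W - {\<one>})" unfolding packing_def using sep_ww by blast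
    show "packing G ?A ?B"
      unfolding packing_insert[of _ _ "y [^] j"] packing_insert[of _ _ "y \<otimes> n"]
      using pW sep_jn sep_wj sep_wn separated_sym by (metis insertE)
    have notW: "y [^] (i::nat) \<otimes> m \<notin> W - {\<one>}" if "m \<in> N" "m \<notin> W - {\<one>}" for i m
    proof
      assume w: "y [^] i \<otimes> m \<in> W - {\<one>}"
      then have "y [^] i \<otimes> m = y [^] (0::nat) \<otimes> (y [^] i \<otimes> m)" using WN NG by (auto simp: subset_iff)
      then have "m = y [^] i \<otimes> m" using coset[of i m 0 "y [^] i \<otimes> m"] that(1) w WN by blast
      then show False using that(2) w by simp
    qed
    have "y \<otimes> n \<notin> W - {\<one>}" using notW[of n 1] yn n(1) W(3) by simp
    moreover have "y [^] j \<notin> insert (y \<otimes> n) (W - {\<one>})"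
      using notW[of \<one> j] yj N1 coset[of j \<one> 1 n] yn n by auto
    ultimately have "card ?B = Suc (Suc (card (W - {\<one>})))" using finW by simp
    also have "\<dots> = Suc (card W)" using finW W1 by (metis card_Suc_Diff1)
    finally show "card W < card ?B" by simp
  qed
qed

end

section \<open>Normalizers and normal 2-subgroups\<close>

definition normalizes :: "('a, 'b) monoid_scheme \<Rightarrow> 'a \<Rightarrow> 'a set \<Rightarrow> bool" where
  "normalizes G g N \<longleftrightarrow> (\<forall>n\<in>N. g \<otimes>\<^bsub>G\<^esub> n \<otimes>\<^bsub>G\<^esub> inv\<^bsub>G\<^esub> g \<in> N)"

context group
begin

lemma stable_group_restrict:
  assumes "stable_group G" "finite (carrier G)" "subgroup K G"
  shows "stable_group (G\<lparr>carrier := K\<rparr>)" "finite (carrier (G\<lparr>carrier := K\<rparr>))"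
    "group (G\<lparr>carrier := K\<rparr>)" "order (G\<lparr>carrier := K\<rparr>) = card K"
  using stable_group_subgroup[OF is_group assms(2,1,3)] finite_subset[OF subgroup.subset[OF assms(3)] assms(2)]
    subgroup_imp_group[OF assms(3)] by (simp_all add: order_def)

lemma ord_restrict: "subgroup K G \<Longrightarrow> x \<in> K \<Longrightarrow> group.ord (G\<lparr>carrier := K\<rparr>) x = ord x"
proof -
  assume K: "subgroup K G" "x \<in> K"
  interpret K: group "G\<lparr>carrier := K\<rparr>" using K(1) by (rule subgroup_imp_group)
  have "K.ord x dvd n \<longleftrightarrow> ord x dvd n" for n
    using K.pow_eq_id[of x n] pow_eq_id[of x n] K subgroup.mem_carrier[OF K] by (simp add: nat_pow_consistent[symmetric])
  then show ?thesis by (metis dvd_antisym dvd_refl)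
qed

lemma element_of_prime_order_in_subgroup:
  assumes fin: "finite (carrier G)" and K: "subgroup K G" and q: "Factorial_Ring.prime (q::nat)" "q dvd card K"
  obtains y where "y \<in> K" "ord y = q"
proof -
  interpret K: group "G\<lparr>carrier := K\<rparr>" using K by (rule subgroup_imp_group)
  have "finite K" using finite_subset[OF subgroup.subset[OF K] fin] .
  then obtain y where "y \<in> K" "K.ord y = q" using K.element_of_prime_order[OF _ q(1)] q(2) by (auto simp: order_def)
  then show ?thesis using that ord_restrict[OF K] by simp
qed

lemma ord_subgroup_power:
  assumes "stable_group G" "finite (carrier G)" "subgroup R G" "card R = r ^ e" "Factorial_Ring.prime r" "r \<noteq> 2"
    "x \<in> R" "x \<noteq> \<one>"
  shows "ord x = r"
  using group.ord_odd_p_group[OF stable_group_restrict(3,1,2)[OF assms(1-3)], of r e x] assms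
    stable_group_restrict(4)[OF assms(1-3)] ord_restrict[OF assms(3,7)] by simp

text \<open>The involutions in the centre of a normal \<open>2\<close>-subgroup form a normal elementary abelian subgroup
  on which elements of odd prime order act without fixed points.\<close>

lemma not_stable_normal_2_subgroup:
  assumes fin: "finite (carrier G)" and D: "subgroup D G" "card D = 2 ^ j" "j > 0"
    and norm: "\<And>g. g \<in> carrier G \<Longrightarrow> normalizes G g D"
    and q: "Factorial_Ring.prime q" "q \<noteq> 2" "q dvd order G"
  shows "\<not> stable_group G"
proof
  assume st: "stable_group G"
  interpret D: group "G\<lparr>carrier := D\<rparr>" using D(1) by (rule subgroup_imp_group)
  have DG: "D \<subseteq> carrier G" using D(1) by (rule subgroup.subset)
  have finD: "finite (carrier (G\<lparr>carrier := D\<rparr>))" using finite_subset[OF DG fin] by simp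
  have "order (G\<lparr>carrier := D\<rparr>) = 2 ^ j" using D(2) by (simp add: order_def)
  then obtain z where z: "z \<in> D" "D.ord z = 2" "\<And>g. g \<in> D \<Longrightarrow> g \<otimes> z = z \<otimes> g"
    using D.central_element_of_prime_order[OF finD _ D(3) two_is_prime_nat] by auto
  have oz: "ord z = 2" using z(2) ord_restrict[OF D(1) z(1)] by simp
  have zz: "z \<noteq> \<one>" "z \<otimes> z = \<one>" using oz ord_2_iff z(1) DG by blast+
  let ?N = "{d \<in> D. d \<otimes> d = \<one> \<and> (\<forall>g\<in>D. g \<otimes> d = d \<otimes> g)}"
  obtain y where y: "y \<in> carrier G" "ord y = q" using element_of_prime_order[OF fin q(1,3)] by blast
  have N: "subgroup ?N G"
  proof (rule subgroupI)
    show "?N \<noteq> {}" using z(1,3) zz by blast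
    fix a assume a: "a \<in> ?N"
    then have aG: "a \<in> carrier G" using DG by blast
    then have "inv a = a" using a by (intro inv_equality) auto
    then show "inv a \<in> ?N" using a by simp
    fix b assume b: "b \<in> ?N"
    then have bG: "b \<in> carrier G" using DG by blast
    have ab: "a \<otimes> b \<in> D" using a b subgroup.m_closed[OF D(1)] by blast
    have "a \<otimes> b \<otimes> (a \<otimes> b) = a \<otimes> (b \<otimes> a) \<otimes> b" using aG bG by (simp add: m_assoc)
    also have "b \<otimes> a = a \<otimes> b" using a b by blast
    also have "a \<otimes> (a \<otimes> b) \<otimes> b = (a \<otimes> a) \<otimes> (b \<otimes> b)" using aG bG by (simp only: m_assoc m_closed)
    also have "\<dots> = \<one>" using a b by simp
    finally have sq: "a \<otimes> b \<otimes> (a \<otimes> b) = \<one>" .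
    have "g \<otimes> (a \<otimes> b) = a \<otimes> b \<otimes> g" if "g \<in> D" for g
    proof -
      have gG: "g \<in> carrier G" using that DG by blast
      have "g \<otimes> (a \<otimes> b) = (g \<otimes> a) \<otimes> b" using aG bG gG by (simp only: m_assoc)
      also have "g \<otimes> a = a \<otimes> g" using a that by blast
      also have "a \<otimes> g \<otimes> b = a \<otimes> (g \<otimes> b)" using aG bG gG by (simp only: m_assoc)
      also have "g \<otimes> b = b \<otimes> g" using b that by blast
      finally show ?thesis using aG bG gG by (simp only: m_assoc)
    qed
    then show "a \<otimes> b \<in> ?N" using ab sq by blast
  qed (use DG in blast)
  have conj: "y \<otimes> n \<otimes> inv y \<in> ?N" if n: "n \<in> ?N" for n
  proof -
    have nG: "n \<in> carrier G" using n DG by blast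
    have mem: "y \<otimes> n \<otimes> inv y \<in> D" using norm[OF y(1)] n by (simp add: normalizes_def)
    have hom: "y \<otimes> u \<otimes> inv y \<otimes> (y \<otimes> v \<otimes> inv y) = y \<otimes> (u \<otimes> v) \<otimes> inv y" if "u \<in> carrier G" "v \<in> carrier G" for u v
    proof -
      have "y \<otimes> u \<otimes> inv y \<otimes> (y \<otimes> v \<otimes> inv y) = y \<otimes> u \<otimes> (inv y \<otimes> y) \<otimes> v \<otimes> inv y"
        using that y(1) by (simp only: m_assoc m_closed inv_closed)
      then show ?thesis using that y(1) by (simp add: m_assoc)
    qed
    have "g \<otimes> (y \<otimes> n \<otimes> inv y) = y \<otimes> n \<otimes> inv y \<otimes> g" if g: "g \<in> D" for g
    proof -
      have gG: "g \<in> carrier G" using g DG by blast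
      let ?h = "inv y \<otimes> g \<otimes> y"
      have h: "?h \<in> D" using normalizing_inverse[OF fin D(1) y(1)] norm[OF y(1)] g by (simp add: normalizes_def)
      then have hG: "?h \<in> carrier G" using DG by blast
      have "y \<otimes> ?h \<otimes> inv y = (y \<otimes> inv y) \<otimes> g \<otimes> (y \<otimes> inv y)" using gG y(1) by (simp only: m_assoc m_closed inv_closed)
      then have gh: "g = y \<otimes> ?h \<otimes> inv y" using gG y(1) by simp
      have "?h \<otimes> n = n \<otimes> ?h" using n h by blast
      then show ?thesis using hom[OF hG nG] hom[OF nG hG] gh by metis
    qed
    moreover have "y \<otimes> n \<otimes> inv y \<otimes> (y \<otimes> n \<otimes> inv y) = \<one>" using hom[OF nG nG] n y(1) by simp
    ultimately show ?thesis using mem by blast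
  qed
  have fpf: "n = \<one>" if n: "n \<in> ?N" "y \<otimes> n = n \<otimes> y" for n
  proof (rule ccontr)
    assume "n \<noteq> \<one>"
    then have on: "ord n = 2" using ord_2_iff n(1) DG by blast
    have nG: "n \<in> carrier G" using n(1) DG by blast
    have "Factorial_Ring.prime (ord y)" "Factorial_Ring.prime (ord n)"
      unfolding on y(2) by (rule q(1), rule two_is_prime_nat)
    then have "ord y = ord n" by (rule no_mixed_commuting[OF st fin y(1) nG n(2)])
    then show False using on y(2) q(2) by simp
  qed
  have zN: "z \<in> ?N" using z(1,3) zz(2) by blast
  have elN: "n \<otimes> n = \<one>" if "n \<in> ?N" for n using that by simp
  have yp: "Factorial_Ring.prime (ord y)" "ord y \<noteq> 2" using y(2) q(1,2) by simp_all
  have "\<not> stable_group G"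
    by (rule not_stable_if_fixed_point_free[OF fin N elN y(1) yp conj fpf zN zz(1)])
  then show False using st by simp
qed

text \<open>For \<open>x\<close> outside \<open>D\<close> the two halves of \<open>P\<close> are
  \<open>D\<close> and \<open>D x\<close>. Since \<open>x d\<close> is not in \<open>D\<close>, it
  lies in \<open>D x\<close>. The inequality also admits \<open>D = P\<close>.\<close>

lemma index_2_normalizes:
  assumes fin: "finite (carrier G)" and D: "subgroup D G" and P: "subgroup P G" "D \<subseteq> P" "card P \<le> 2 * card D"
    and x: "x \<in> P"
  shows "normalizes G x D"
  unfolding normalizes_def
proof
  fix d assume d: "d \<in> D"
  have PG: "P \<subseteq> carrier G" using P(1) by (rule subgroup.subset)
  have xG: "x \<in> carrier G" "d \<in> carrier G" using x d P PG by auto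
  show "x \<otimes> d \<otimes> inv x \<in> D"
  proof (cases "x \<in> D")
    case True
    then show ?thesis using d subgroup.m_closed[OF D] subgroup.m_inv_closed[OF D] by simp
  next
    case False
    have finP: "finite P" using PG fin finite_subset by blast
    have disj: "D \<inter> (\<lambda>d. d \<otimes> x) ` D = {}"
    proof (rule ccontr)
      assume "D \<inter> (\<lambda>d. d \<otimes> x) ` D \<noteq> {}"
      then obtain c where c: "c \<in> D" "c \<otimes> x \<in> D" by blast
      then have "inv c \<otimes> (c \<otimes> x) \<in> D" using subgroup.m_closed[OF D] subgroup.m_inv_closed[OF D] by blast
      moreover have "inv c \<otimes> (c \<otimes> x) = x" using c(1) xG P PG by (simp add: m_assoc[symmetric] subset_iff)
      ultimately show False using False by simp
    qed
    have "card ((\<lambda>d. d \<otimes> x) ` D) = card D" using xG P PG by (intro card_image inj_onI) (auto simp: subset_iff)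
    then have "card (D \<union> (\<lambda>d. d \<otimes> x) ` D) = 2 * card D"
      using disj finite_subset[OF P(2) finP] by (simp add: card_Un_disjoint)
    moreover have sub: "D \<union> (\<lambda>d. d \<otimes> x) ` D \<subseteq> P" using P(2) x subgroup.m_closed[OF P(1)] by blast
    ultimately have all: "D \<union> (\<lambda>d. d \<otimes> x) ` D = P" using P(3) finP by (intro card_seteq) auto
    have "x \<otimes> d \<in> P" using x d P subgroup.m_closed[OF P(1)] by blast
    moreover have "x \<otimes> d \<notin> D"
    proof
      assume "x \<otimes> d \<in> D"
      then have "x \<otimes> d \<otimes> inv d \<in> D" using d subgroup.m_closed[OF D] subgroup.m_inv_closed[OF D] by blast
      then show False using False xG by (simp add: m_assoc)
    qed
    ultimately obtain c where c: "c \<in> D" "x \<otimes> d = c \<otimes> x" using all by blast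
    then have "x \<otimes> d \<otimes> inv x = c" using xG P PG by (simp add: m_assoc subset_iff)
    then show ?thesis using c by simp
  qed
qed

lemma normalizer_subgroup:
  assumes fin: "finite (carrier G)" and D: "subgroup D G"
  shows "subgroup {g \<in> carrier G. normalizes G g D} G"
proof (rule subgroupI)
  have DG: "D \<subseteq> carrier G" using D by (rule subgroup.subset)
  show "{g \<in> carrier G. normalizes G g D} \<noteq> {}" using DG by (auto simp: normalizes_def intro!: exI[of _ \<one>])
  fix g assume g: "g \<in> {g \<in> carrier G. normalizes G g D}"
  then show "inv g \<in> {g \<in> carrier G. normalizes G g D}"
    using normalizing_inverse[OF fin D, of g] by (simp add: normalizes_def)
  fix h assume h: "h \<in> {g \<in> carrier G. normalizes G g D}"
  have "g \<otimes> h \<otimes> d \<otimes> inv (g \<otimes> h) \<in> D" if d: "d \<in> D" for d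
  proof -
    have "g \<otimes> h \<otimes> d \<otimes> inv (g \<otimes> h) = g \<otimes> (h \<otimes> d \<otimes> inv h) \<otimes> inv g"
      using g h d DG by (simp add: inv_mult_group m_assoc subset_iff)
    then show ?thesis using g h d by (simp add: normalizes_def)
  qed
  then show "g \<otimes> h \<in> {g \<in> carrier G. normalizes G g D}" using g h by (simp add: normalizes_def)
qed auto

lemma card_subgroup_dvd: "finite (carrier G) \<Longrightarrow> subgroup K G \<Longrightarrow> card K dvd order G"
  using lagrange by (metis dvd_triv_right)

text \<open>A Sylow \<open>2\<close>-subgroup \<open>P\<close> has index \<open>3\<close>. Letting it act on its three cosets shows that \<open>P\<close> meets a
  conjugate in a subgroup \<open>D\<close> of index at most \<open>2\<close> in both, so that \<open>D\<close> is normal in \<open>G\<close>.\<close>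

lemma stable_order_3_times_2_power:
  assumes st: "stable_group G" and fin: "finite (carrier G)" and ord: "order G = 3 * 2 ^ b"
  shows "b \<le> 1"
proof (rule ccontr)
  assume b: "\<not> b \<le> 1"
  have p3: "Factorial_Ring.prime (3::nat)" by (simp add: prime_nat_numeral_eq)
  have no2: False if "subgroup D G" "card D = 2 ^ j" "j > 0" "\<And>g. g \<in> carrier G \<Longrightarrow> normalizes G g D" for D j
    using not_stable_normal_2_subgroup[OF fin that p3] ord st by simp
  have "order G = 2 ^ b * 3" using ord by simp
  from sylow_thm[OF two_is_prime_nat is_group this fin] obtain P where P: "subgroup P G" "card P = 2 ^ b" by blast
  have PG: "P \<subseteq> carrier G" using P(1) by (rule subgroup.subset)
  have finP: "finite P" using PG fin finite_subset by blast
  obtain g where g: "g \<in> carrier G" "\<not> normalizes G g P" using no2[OF P] b by auto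
  let ?E = "rcosets P" and ?act = "\<lambda>h C. C #> inv h" and ?P = "G\<lparr>carrier := P\<rparr>"
  have EG: "C \<subseteq> carrier G" if "C \<in> ?E" for C using that rcosets_part_G[OF P(1)] by blast
  have "card ?E * 2 ^ b = 3 * 2 ^ b" using lagrange[OF P(1)] ord P(2) by simp
  then have cardE: "card ?E = 3" by simp
  have gP: "group ?P" using P(1) by (rule subgroup_imp_group)
  interpret A: group_action ?P ?E "\<lambda>h. \<lambda>C\<in>?E. ?act h C"
  proof (rule group_actionI[OF gP])
    fix h C assume "h \<in> carrier ?P" "C \<in> ?E"
    then obtain x where x: "x \<in> carrier G" "C = P #> x" by (auto simp: RCOSETS_def)
    have hG: "h \<in> carrier G" using \<open>h \<in> carrier ?P\<close> PG by auto
    then have "C #> inv h = P #> (x \<otimes> inv h)" using x PG by (simp add: coset_mult_assoc)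
    then show "C #> inv h \<in> ?E" using x hG by (auto simp: RCOSETS_def)
  next
    fix C assume "C \<in> ?E"
    then show "C #> inv \<one>\<^bsub>?P\<^esub> = C" using EG by (simp add: coset_mult_one)
  next
    fix h k C assume "h \<in> carrier ?P" "k \<in> carrier ?P" "C \<in> ?E"
    then show "C #> inv (h \<otimes>\<^bsub>?P\<^esub> k) = C #> inv k #> inv h"
      using EG PG by (simp add: coset_mult_assoc inv_mult_group subset_iff)
  qed
  let ?C = "P #> g"
  have CE: "?C \<in> ?E" using g by (auto simp: RCOSETS_def)
  have PE: "P \<in> ?E" using subgroup.subgroup_in_rcosets[OF P(1) is_group] .
  let ?D = "{h \<in> P. g \<otimes> h \<otimes> inv g \<in> P}"
  have gn: "g \<notin> P"
  proof
    assume "g \<in> P"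
    then have "normalizes G g P"
      using subgroup.m_closed[OF P(1)] subgroup.m_inv_closed[OF P(1)] by (simp add: normalizes_def)
    then show False using g by simp
  qed
  have stab: "stabilizer ?P (\<lambda>h. \<lambda>C\<in>?E. ?act h C) ?C = ?D"
  proof -
    have "?C #> inv h = ?C \<longleftrightarrow> g \<otimes> h \<otimes> inv g \<in> P" if h: "h \<in> P" for h
    proof -
      have hG: "h \<in> carrier G" using h PG by blast
      have eq: "?C #> inv h = P #> (g \<otimes> inv h)" using g hG PG by (simp add: coset_mult_assoc)
      have "P #> (g \<otimes> inv h) = ?C \<longleftrightarrow> g \<in> P #> (g \<otimes> inv h)"
        using rcos_self[OF g(1) P(1)] repr_independence[OF _ _ P(1)] g(1) hG by (metis inv_closed m_closed)
      also have "\<dots> \<longleftrightarrow> g \<otimes> inv (g \<otimes> inv h) \<in> P"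
      proof -
        have xG: "g \<otimes> inv h \<in> carrier G" using g hG by simp
        show ?thesis
        proof
          assume "g \<in> P #> (g \<otimes> inv h)"
          then obtain p where "p \<in> P" "g = p \<otimes> (g \<otimes> inv h)" by (auto simp: r_coset_def)
          then show "g \<otimes> inv (g \<otimes> inv h) \<in> P" using xG g PG by (metis inv_solve_right subsetD)
        next
          assume "g \<otimes> inv (g \<otimes> inv h) \<in> P"
          moreover have "g = g \<otimes> inv (g \<otimes> inv h) \<otimes> (g \<otimes> inv h)" using xG g(1) by (simp add: m_assoc)
          ultimately show "g \<in> P #> (g \<otimes> inv h)" unfolding r_coset_def by blast
        qed
      qed
      also have "g \<otimes> inv (g \<otimes> inv h) = g \<otimes> h \<otimes> inv g" using g hG by (simp add: inv_mult_group m_assoc)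
      finally show ?thesis unfolding eq .
    qed
    then show ?thesis using CE by (auto simp: stabilizer_def)
  qed
  have D: "subgroup ?D G"
    using A.stabilizer_subgroup[OF CE] incl_subgroup[OF P(1)] stab by simp
  let ?O = "orbit ?P (\<lambda>h. \<lambda>C\<in>?E. ?act h C) ?C"
  \<comment> \<open>The coset \<open>P\<close> is not in the orbit of \<open>P g\<close> under
    \<open>P\<close>, so that orbit lies in the other two cosets. Hence the stabilizer of
    \<open>P g\<close>, the intersection of \<open>P\<close> with its conjugate, has index at most 2
    in \<open>P\<close>.\<close>
  have "P \<notin> ?O"
  proof
    assume "P \<in> ?O"
    then obtain h where h: "h \<in> P" "P = P #> g #> inv h" using CE by (auto simp: orbit_def)
    then have "P = P #> (g \<otimes> inv h)" using g PG by (simp add: coset_mult_assoc subset_iff)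
    then have "g \<otimes> inv h \<in> P" using rcos_self[OF _ P(1), of "g \<otimes> inv h"] g h PG by (metis inv_closed m_closed subsetD)
    then have "g \<otimes> inv h \<otimes> h \<in> P" using h subgroup.m_closed[OF P(1)] by blast
    then show False using gn g h PG by (simp add: m_assoc subset_iff)
  qed
  moreover have "?O \<subseteq> ?E" using A.orbits_coverture CE unfolding orbits_def by blast
  moreover have finE: "finite ?E" by (rule card_ge_0_finite) (simp add: cardE)
  ultimately have "card ?O \<le> card (?E - {P})" by (intro card_mono) auto
  then have "card ?O \<le> 2" using cardE PE finE by simp
  then have "card ?O * card ?D \<le> 2 * card ?D" by (rule mult_le_mono1)
  moreover have "card ?O * card ?D = 2 ^ b"
    using A.orbit_stabilizer_theorem[OF CE] stab P(2) by (simp add: order_def)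
  ultimately have half: "card P \<le> 2 * card ?D" using P(2) by simp
  let ?P' = "(\<lambda>h. inv g \<otimes> h \<otimes> g) ` P"
  have P'_eq: "?P' = {h \<in> carrier G. g \<otimes> h \<otimes> inv g \<in> P}"
  proof (intro equalityI subsetI)
    fix h assume "h \<in> ?P'"
    then obtain p where p: "p \<in> P" "h = inv g \<otimes> p \<otimes> g" by blast
    have pG: "p \<in> carrier G" using p PG by blast
    have "g \<otimes> h \<otimes> inv g = (g \<otimes> inv g) \<otimes> p \<otimes> (g \<otimes> inv g)"
      unfolding p(2) using pG g(1) by (simp only: m_assoc m_closed inv_closed)
    then have "g \<otimes> h \<otimes> inv g = p" using pG g(1) by simp
    then show "h \<in> {h \<in> carrier G. g \<otimes> h \<otimes> inv g \<in> P}" using p pG g(1) by simp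
  next
    fix h assume h: "h \<in> {h \<in> carrier G. g \<otimes> h \<otimes> inv g \<in> P}"
    have "inv g \<otimes> (g \<otimes> h \<otimes> inv g) \<otimes> g = (inv g \<otimes> g) \<otimes> h \<otimes> (inv g \<otimes> g)"
      using h g by (simp only: m_assoc m_closed inv_closed mem_Collect_eq)
    then have "h = inv g \<otimes> (g \<otimes> h \<otimes> inv g) \<otimes> g" using h g by simp
    then show "h \<in> ?P'" using h by blast
  qed
  have P': "subgroup ?P' G"
  proof (rule subgroupI)
    show "?P' \<subseteq> carrier G" "?P' \<noteq> {}" using PG g subgroup.one_closed[OF P(1)] by auto
    fix h assume h: "h \<in> ?P'"
    then have hG: "h \<in> carrier G" "g \<otimes> h \<otimes> inv g \<in> P" unfolding P'_eq by auto
    then have "inv (g \<otimes> h \<otimes> inv g) \<in> P" using subgroup.m_inv_closed[OF P(1)] by blast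
    then show "inv h \<in> ?P'" unfolding P'_eq using hG g by (simp add: inv_mult_group m_assoc)
    fix k assume "k \<in> ?P'"
    then have kG: "k \<in> carrier G" "g \<otimes> k \<otimes> inv g \<in> P" unfolding P'_eq by auto
    have "g \<otimes> h \<otimes> inv g \<otimes> (g \<otimes> k \<otimes> inv g) = g \<otimes> h \<otimes> (inv g \<otimes> g) \<otimes> k \<otimes> inv g"
      using hG(1) kG(1) g by (simp only: m_assoc m_closed inv_closed)
    also have "\<dots> = g \<otimes> (h \<otimes> k) \<otimes> inv g" using hG(1) kG(1) g by (simp add: m_assoc)
    finally show "h \<otimes> k \<in> ?P'"
      unfolding P'_eq using hG kG subgroup.m_closed[OF P(1) hG(2) kG(2)] by simp
  qed
  have cardP': "card ?P' = card P"
    using g PG by (intro card_image inj_onI) (auto simp: subset_iff)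
  have DP': "?D \<subseteq> ?P'" unfolding P'_eq using PG by auto
  let ?N = "{x \<in> carrier G. normalizes G x ?D}"
  have N: "subgroup ?N G" by (rule normalizer_subgroup[OF fin D])
  have PN: "P \<subseteq> ?N" using index_2_normalizes[OF fin D P(1) _ half] PG by blast
  have half': "card ?P' \<le> 2 * card ?D" using half cardP' by simp
  have P'N: "?P' \<subseteq> ?N"
  proof
    fix x assume x: "x \<in> ?P'"
    then have "normalizes G x ?D" by (rule index_2_normalizes[OF fin D P' DP' half'])
    moreover have "x \<in> carrier G" using x subgroup.subset[OF P'] by blast
    ultimately show "x \<in> ?N" by simp
  qed
  have finN: "finite ?N" using fin by simp
  \<comment> \<open>The normalizer of \<open>?D\<close> contains \<open>P\<close> and its conjugate
    \<open>?P'\<close>. These differ, since \<open>g\<close> does not normalize \<open>P\<close>, so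
    the normalizer is larger than \<open>P\<close>. As \<open>P\<close> has prime index 3, it is all
    of \<open>G\<close>.\<close>
  have "P \<noteq> ?N"
  proof
    assume "P = ?N"
    then have "?P' \<subseteq> P" using P'N by simp
    then have eq: "?P' = P" using cardP' finP by (intro card_subset_eq) auto
    have "h \<in> {h \<in> carrier G. g \<otimes> h \<otimes> inv g \<in> P}" if "h \<in> P" for h
      unfolding P'_eq[symmetric] eq by (rule that)
    then have "normalizes G g P" by (simp add: normalizes_def)
    then show False using g by simp
  qed
  then have "card P < card ?N" using PN finN by (intro psubset_card_mono) auto
  moreover have "card P dvd card ?N"
    using group.card_subgroup_dvd[OF subgroup_imp_group[OF N], of P] subgroup_incl[OF P(1) N PN] finN by (simp add: order_def)
  moreover have "card ?N dvd order G" by (rule card_subgroup_dvd[OF fin N])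
  ultimately have "card ?N = order G"
  proof -
    obtain c where c: "card ?N = 2 ^ b * c" using \<open>card P dvd card ?N\<close> P(2) by auto
    then have "c dvd 3" using \<open>card ?N dvd order G\<close> ord by (simp add: mult.commute[of 3])
    then have "c = 1 \<or> c = 3" using p3 by (simp add: prime_nat_iff)
    then show ?thesis using c \<open>card P < card ?N\<close> P(2) ord by auto
  qed
  then have "?N = carrier G" using fin by (intro card_subset_eq) (auto simp: order_def)
  then have normD: "normalizes G x ?D" if "x \<in> carrier G" for x using that by blast
  have "card ?D dvd 2 ^ b" using dvd_triv_right[of "card ?D" "card ?O"]
    unfolding \<open>card ?O * card ?D = 2 ^ b\<close> .
  then obtain j where j: "card ?D = 2 ^ j" using divides_primepow_nat[OF two_is_prime_nat] by blast
  \<comment> \<open>This is where \<open>b \<ge> 2\<close> enters: for \<open>b = 1\<close>, as in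
    \<open>S3\<close>, the intersection may be trivial.\<close>
  have "j \<noteq> 0"
  proof
    assume "j = 0"
    then have "2 ^ b \<le> (2::nat)" using half P(2) j by simp
    moreover have "(2::nat) ^ 2 \<le> 2 ^ b" using b by (intro power_increasing) auto
    ultimately show False by simp
  qed
  then show False using no2[OF D j _ normD] by simp
qed

end

section \<open>Sylow subgroups for odd primes\<close>

context group
begin

lemma prime_divisor_orders:
  assumes "stable_group G" "finite (carrier G)" "subgroup R G" "card R = r ^ e" "Factorial_Ring.prime r" "r \<noteq> 2" "e > 0"
  shows "r = 3 \<and> (e = 1 \<or> e = 2) \<or> (r = 5 \<or> r = 7) \<and> e = 1"
proof -
  have "r dvd order G"
    using card_subgroup_dvd[OF assms(2,3)] assms(4,7) by (metis dvd_power dvd_trans)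
  then have r: "r \<in> {2, 3, 5, 7}" by (rule stable_prime_divisor[OF assms(1,2,5)])
  have "e \<le> 2" if "r = 3"
    using group.stable_3_group[OF stable_group_restrict(3,1,2)[OF assms(1-3)], of e] that assms(4)
      stable_group_restrict(4)[OF assms(1-3)] by simp
  moreover have "e \<le> 1" if "r = 5 \<or> r = 7"
    using group.stable_5_or_7_group[OF stable_group_restrict(3,1,2)[OF assms(1-3)], of r e] that assms(4)
      stable_group_restrict(4)[OF assms(1-3)] by simp
  ultimately show ?thesis using r assms(6,7) by (auto simp: le_Suc_eq numeral_2_eq_2)
qed

text \<open>The order is at most \<open>r^2\<close>. The centralizer of \<open>a\<close> contains a
  central subgroup of order \<open>r\<close>; if \<open>a\<close> lies outside it, the centralizer
  has order above \<open>r\<close> and is everything, and otherwise \<open>a\<close> is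
  central.\<close>

lemma odd_subgroup_abelian:
  assumes st: "stable_group G" and fin: "finite (carrier G)" and R: "subgroup R G" "card R = r ^ e"
    and r: "Factorial_Ring.prime r" "r \<noteq> 2" and ab: "a \<in> R" "b \<in> R"
  shows "a \<otimes> b = b \<otimes> a"
proof (cases "e = 0")
  case True
  then have "card R = 1" using R(2) by simp
  then obtain c where "R = {c}" by (rule card_1_singletonE)
  then show ?thesis using ab by simp
next
  case False
  have RG: "R \<subseteq> carrier G" using R(1) by (rule subgroup.subset)
  have finR: "finite R" using RG fin finite_subset by blast
  interpret R: group "G\<lparr>carrier := R\<rparr>" using R(1) by (rule subgroup_imp_group)
  have "e \<le> 2" using prime_divisor_orders[OF st fin R r] False by auto
  obtain z where z: "z \<in> R" "R.ord z = r" "\<And>g. g \<in> R \<Longrightarrow> g \<otimes> z = z \<otimes> g"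
    using R.central_element_of_prime_order[of r e] r False finR R(2) by (auto simp: order_def)
  have zG: "z \<in> carrier G" "a \<in> carrier G" using z ab RG by auto
  let ?C = "{g \<in> R. g \<otimes> a = a \<otimes> g}" and ?Z = "generate G {z}"
  have C: "subgroup ?C (G\<lparr>carrier := R\<rparr>)" using R.centralizer_subgroup[of a] ab by simp
  have C': "subgroup ?C G" using incl_subgroup[OF R(1) C] .
  have Z: "subgroup ?Z G" using zG by (simp add: generate_is_subgroup)
  have "z \<in> ?C" using z ab by simp
  then have ZC: "?Z \<subseteq> ?C" using generate_subgroup_incl[OF _ C'] by simp
  have cZ: "card ?Z = r" using generate_pow_card[OF zG(1)] ord_restrict[OF R(1) z(1)] z(2) by simp
  have "R = ?C"
  proof (cases "a \<in> ?Z")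
    case True
    then obtain i where "a = z [^] (i::nat)" using generate_pow_on_finite_carrier[OF fin zG(1)] by blast
    then have "g \<otimes> a = a \<otimes> g" if "g \<in> R" for g
      using pow_commutes[of g z 1 i] z(3)[OF that] that RG zG by auto
    then show ?thesis by blast
  next
    case False
    then have "?Z \<subset> ?C" using ZC ab by blast
    then have "r < card ?C" using cZ finR psubset_card_mono[of ?C ?Z] by simp
    moreover have "card ?C dvd r ^ e" using R.card_subgroup_dvd[OF _ C] finR R(2) by (simp add: order_def)
    then obtain i where i: "i \<le> e" "card ?C = r ^ i" using r by (auto simp: divides_primepow_nat)
    ultimately have "r ^ 1 < r ^ i" by simp
    then have "1 < i" using r(1) power_less_imp_less_exp prime_gt_1_nat by blast
    then have "i = e" using i(1) \<open>e \<le> 2\<close> by simp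
    then show ?thesis using i(2) R(2) finR by (metis (no_types, lifting) card_subset_eq mem_Collect_eq subsetI)
  qed
  from this ab(2) have "b \<in> ?C" by (rule subst[where P = "\<lambda>S. b \<in> S"])
  then show ?thesis by simp
qed

text \<open>The centralizer of a common element \<open>x \<noteq> \<one>\<close> is an
  \<open>r\<close>-group by \<open>no_mixed_commuting\<close>, so its order is at most
  \<open>r^e\<close>. It contains \<open>R\<close> and \<open>R'\<close>, as both are abelian, hence
  equals both.\<close>

lemma sylow_trivial_intersection:
  assumes st: "stable_group G" and fin: "finite (carrier G)"
    and ord: "order G = r ^ e * m" "\<not> r dvd m" and r: "Factorial_Ring.prime r" "r \<noteq> 2"
    and R: "subgroup R G" "card R = r ^ e" "subgroup R' G" "card R' = r ^ e"
    and x: "x \<in> R" "x \<in> R'" "x \<noteq> \<one>"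
  shows "R = R'"
proof -
  have xG: "x \<in> carrier G" using x R(1) by (simp add: subgroup.mem_carrier)
  let ?C = "{g \<in> carrier G. g \<otimes> x = x \<otimes> g}"
  have C: "subgroup ?C G" by (rule centralizer_subgroup[OF xG])
  have finC: "finite ?C" using fin by simp
  have "card ?C > 0" using finC subgroup.one_closed[OF C] by (auto simp: card_gt_0_iff)
  moreover have "q = r" if q: "Factorial_Ring.prime q" "q dvd card ?C" for q
  proof -
    obtain y where y: "y \<in> ?C" "ord y = q" using element_of_prime_order_in_subgroup[OF fin C q] by blast
    have "ord x = r" using ord_subgroup_power[OF st fin R(1,2) r x(1,3)] .
    then show ?thesis using no_mixed_commuting[OF st fin _ xG, of y] y q(1) r(1) by simp
  qed
  ultimately obtain k where k: "card ?C = r ^ k" using power_of_prime_if_unique_prime_divisor[of "card ?C" r] by blast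
  then have "r ^ k dvd r ^ e * m" using card_subgroup_dvd[OF fin C] ord by simp
  moreover have "coprime (r ^ k) m" using r(1) ord(2) by (simp add: prime_imp_coprime)
  ultimately have "r ^ k dvd r ^ e" by (simp add: coprime_dvd_mult_left_iff)
  moreover have "r ^ e > 0" using r(1) prime_gt_0_nat by simp
  ultimately have le: "card ?C \<le> r ^ e" using k by (simp add: dvd_imp_le)
  have sub: "S \<subseteq> ?C" if "subgroup S G" "card S = r ^ e" "x \<in> S" for S
    using odd_subgroup_abelian[OF st fin that(1,2) r _ that(3)] subgroup.subset[OF that(1)] by blast
  have "S = ?C" if "subgroup S G" "card S = r ^ e" "x \<in> S" for S
    using sub[OF that] le that(2) finC by (intro card_seteq) auto
  from this[OF R(1,2) x(1)] this[OF R(3,4) x(2)] show ?thesis by simp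
qed

lemma card_conjugates:
  assumes fin: "finite (carrier G)" and R: "subgroup R G"
  defines "E \<equiv> {(\<lambda>x. g \<otimes> x \<otimes> inv g) ` R | g. g \<in> carrier G}"
  shows "card E * card {g \<in> carrier G. normalizes G g R} = order G"
proof -
  let ?act = "\<lambda>g S. (\<lambda>x. g \<otimes> x \<otimes> inv g) ` S" and ?P = "Pow (carrier G)"
  have RG: "R \<subseteq> carrier G" using R by (rule subgroup.subset)
  interpret A: group_action G ?P "\<lambda>g. \<lambda>S\<in>?P. ?act g S"
  proof (rule group_actionI[OF is_group])
    fix S assume "S \<in> ?P"
    then show "?act \<one> S = S" by (force simp: subset_iff)
  next
    fix g h S assume gh: "g \<in> carrier G" "h \<in> carrier G" "S \<in> ?P"
    have "g \<otimes> h \<otimes> x \<otimes> inv (g \<otimes> h) = g \<otimes> (h \<otimes> x \<otimes> inv h) \<otimes> inv g" if "x \<in> S" for x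
      using gh that by (simp add: inv_mult_group m_assoc subset_iff)
    then show "?act (g \<otimes> h) S = ?act g (?act h S)" unfolding image_image by (intro image_cong) auto
  qed auto
  have "orbit G (\<lambda>g. \<lambda>S\<in>?P. ?act g S) R = E" using RG by (auto simp: orbit_def E_def)
  moreover have "stabilizer G (\<lambda>g. \<lambda>S\<in>?P. ?act g S) R = {g \<in> carrier G. normalizes G g R}"
  proof -
    have "?act g R = R \<longleftrightarrow> normalizes G g R" if g: "g \<in> carrier G" for g
    proof
      assume "normalizes G g R"
      then have "?act g R \<subseteq> R" by (auto simp: normalizes_def)
      moreover have "inj_on (\<lambda>x. g \<otimes> x \<otimes> inv g) R" using g RG by (intro inj_onI) (auto simp: subset_iff)
      ultimately show "?act g R = R" using endo_inj_surj finite_subset[OF RG fin] by blast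
    qed (auto simp: normalizes_def)
    then show ?thesis using RG by (auto simp: stabilizer_def)
  qed
  ultimately show ?thesis using A.orbit_stabilizer_theorem[of R] RG by simp
qed

lemma conjugate_subgroup:
  assumes R: "subgroup R G" and g: "g \<in> carrier G"
  shows "subgroup ((\<lambda>x. g \<otimes> x \<otimes> inv g) ` R) G" "card ((\<lambda>x. g \<otimes> x \<otimes> inv g) ` R) = card R"
proof -
  have RG: "R \<subseteq> carrier G" using R by (rule subgroup.subset)
  show "subgroup ((\<lambda>x. g \<otimes> x \<otimes> inv g) ` R) G"
  proof (rule subgroupI)
    fix u assume "u \<in> (\<lambda>x. g \<otimes> x \<otimes> inv g) ` R"
    then obtain x where x: "x \<in> R" "u = g \<otimes> x \<otimes> inv g" by blast
    have xG: "x \<in> carrier G" using x RG by blast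
    have "inv u = g \<otimes> inv x \<otimes> inv g" unfolding x(2) using xG g by (simp add: inv_mult_group m_assoc)
    then show "inv u \<in> (\<lambda>x. g \<otimes> x \<otimes> inv g) ` R" using subgroup.m_inv_closed[OF R x(1)] by blast
    fix v assume "v \<in> (\<lambda>x. g \<otimes> x \<otimes> inv g) ` R"
    then obtain w where w: "w \<in> R" "v = g \<otimes> w \<otimes> inv g" by blast
    have wG: "w \<in> carrier G" using w RG by blast
    have "u \<otimes> v = g \<otimes> x \<otimes> (inv g \<otimes> g) \<otimes> w \<otimes> inv g"
      unfolding x(2) w(2) using xG wG g by (simp only: m_assoc m_closed inv_closed)
    also have "\<dots> = g \<otimes> (x \<otimes> w) \<otimes> inv g" using xG wG g by (simp add: m_assoc)
    finally show "u \<otimes> v \<in> (\<lambda>x. g \<otimes> x \<otimes> inv g) ` R" using subgroup.m_closed[OF R x(1) w(1)] by blast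
  qed (use RG g subgroup.one_closed[OF R] in auto)
  show "card ((\<lambda>x. g \<otimes> x \<otimes> inv g) ` R) = card R"
    using RG g by (intro card_image inj_onI) (auto simp: subset_iff)
qed

text \<open>Distinct conjugates of \<open>R\<close> share only \<open>\<one>\<close>, so their
  nontrivial elements are counted without overlap: index of the normalizer times
  \<open>card R - 1\<close>. The multiplicative form avoids division.\<close>

lemma card_sylow_elements:
  assumes st: "stable_group G" and fin: "finite (carrier G)"
    and ord: "order G = r ^ e * m" "\<not> r dvd m" and r: "Factorial_Ring.prime r" "r \<noteq> 2"
    and R: "subgroup R G" "card R = r ^ e"
  defines "U \<equiv> {g \<otimes> x \<otimes> inv g | g x. g \<in> carrier G \<and> x \<in> R - {\<one>}}"
  shows "card U * card {g \<in> carrier G. normalizes G g R} = order G * (card R - 1)"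
    "U \<subseteq> {u \<in> carrier G. ord u = r}"
proof -
  let ?E = "{(\<lambda>x. g \<otimes> x \<otimes> inv g) ` R | g. g \<in> carrier G}"
  have RG: "R \<subseteq> carrier G" using R(1) by (rule subgroup.subset)
  have E: "subgroup S G" "card S = r ^ e" if "S \<in> ?E" for S
    using that conjugate_subgroup[OF R(1)] R(2) by auto
  have finE: "finite ?E" using fin by simp
  have fixed_one: "g \<otimes> x \<otimes> inv g = \<one> \<longleftrightarrow> x = \<one>" if "g \<in> carrier G" "x \<in> carrier G" for g x
    using that by (metis inv_solve_right' l_cancel_one' m_closed inv_closed r_inv r_one l_one one_closed r_cancel)
  have U: "U = (\<Union>S\<in>?E. S - {\<one>})"
  proof (intro equalityI subsetI)
    fix u assume "u \<in> U"
    then obtain g x where gx: "g \<in> carrier G" "x \<in> R" "x \<noteq> \<one>" "u = g \<otimes> x \<otimes> inv g" unfolding U_def by blast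
    then show "u \<in> (\<Union>S\<in>?E. S - {\<one>})" using fixed_one[of g x] RG by blast
  next
    fix u assume "u \<in> (\<Union>S\<in>?E. S - {\<one>})"
    then obtain g x where gx: "g \<in> carrier G" "x \<in> R" "u = g \<otimes> x \<otimes> inv g" "u \<noteq> \<one>" by blast
    then show "u \<in> U" unfolding U_def using fixed_one[of g x] RG by blast
  qed
  have "card U = (\<Sum>S\<in>?E. card (S - {\<one>}))"
    unfolding U
  proof (rule card_UN_disjoint[OF finE])
    show "\<forall>S\<in>?E. finite (S - {\<one>})"
    proof
      fix S assume "S \<in> ?E"
      then have "S \<subseteq> carrier G" by (rule subgroup.subset[OF E(1)])
      then show "finite (S - {\<one>})" using fin by (simp add: finite_subset)
    qed
    show "\<forall>S\<in>?E. \<forall>T\<in>?E. S \<noteq> T \<longrightarrow> (S - {\<one>}) \<inter> (T - {\<one>}) = {}"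
    proof (intro ballI impI, rule ccontr)
      fix S T assume ST: "S \<in> ?E" "T \<in> ?E" "S \<noteq> T" "(S - {\<one>}) \<inter> (T - {\<one>}) \<noteq> {}"
      then obtain x where "x \<in> S" "x \<in> T" "x \<noteq> \<one>" by blast
      then show False
        using sylow_trivial_intersection[OF st fin ord r E(1)[OF ST(1)] E(2)[OF ST(1)] E(1)[OF ST(2)] E(2)[OF ST(2)]] ST(3)
        by blast
    qed
  qed
  also have "\<dots> = (\<Sum>S\<in>?E. card R - 1)"
  proof (rule sum.cong[OF refl])
    fix S assume S: "S \<in> ?E"
    show "card (S - {\<one>}) = card R - 1"
      using subgroup.one_closed[OF E(1)[OF S]] E(2)[OF S] R(2) by (simp add: card_Diff_singleton)
  qed
  finally have "card U = card ?E * (card R - 1)" by simp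
  then have "card U * card {g \<in> carrier G. normalizes G g R} =
      (card ?E * card {g \<in> carrier G. normalizes G g R}) * (card R - 1)" by (simp add: mult_ac)
  then show "card U * card {g \<in> carrier G. normalizes G g R} = order G * (card R - 1)"
    using card_conjugates[OF fin R(1)] by simp
  show "U \<subseteq> {u \<in> carrier G. ord u = r}"
  proof
    fix u assume "u \<in> U"
    then obtain S where S: "S \<in> ?E" "u \<in> S" "u \<noteq> \<one>" unfolding U by blast
    have "u \<in> carrier G" by (rule subgroup.mem_carrier[OF E(1)[OF S(1)] S(2)])
    moreover have "ord u = r" using ord_subgroup_power[OF st fin E(1)[OF S(1)] E(2)[OF S(1)] r] S(2,3) by simp
    ultimately show "u \<in> {u \<in> carrier G. ord u = r}" by simp
  qed
qed

lemma pc_relations_inverting: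
  assumes fin: "finite (carrier G)" and a: "a \<in> carrier G" and y: "y \<in> carrier G" "ord y = 2"
    and yn: "\<And>i::nat. y \<noteq> a [^] i" and inv: "y \<otimes> a = inv a \<otimes> y"
  shows "pc_relations G a \<one> y (ord a) 1 2 (ord a - 1, 0) (0, 1) (0, 0)"
proof (rule pc_relations_metacyclicI[OF fin a y(1) two_is_prime_nat yn])
  have "a [^] (ord a - 1) \<otimes> a = a [^] ord a" using a ord_ge_1[OF fin a] by (metis Suc_pred' less_le_trans nat_pow_Suc zero_less_one)
  then have "inv a = a [^] (ord a - 1)" using a by (intro inv_equality) simp_all
  then show "y \<otimes> a = a [^] (ord a - 1) \<otimes> y" using inv by simp
  show "y [^] (2::nat) = a [^] (0::nat)" using pow_ord_eq_1[OF y(1)] y(2) by simp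
qed

end

context group
begin

text \<open>A prime \<open>q\<close> dividing \<open>m\<close> provides an element acting on
  \<open>R\<close> with \<open>\<one>\<close> as only fixed point, so \<open>card R\<close> is 1
  modulo \<open>q\<close>. With \<open>card R\<close> among 3, 9, 5, 7 this means
  \<open>q = 2\<close>, or \<open>q = 3\<close> and \<open>card R = 7\<close>. Witnesses of orders
  10, 14, 18 and 21 leave only \<open>card R = 3\<close> and \<open>q = 2\<close>.\<close>

lemma normal_odd_sylow:
  assumes st: "stable_group G" and fin: "finite (carrier G)"
    and ord: "order G = r ^ e * m" "\<not> r dvd m" "e > 0" and r: "Factorial_Ring.prime r" "r \<noteq> 2"
    and R: "subgroup R G" "card R = r ^ e" and norm: "\<And>g. g \<in> carrier G \<Longrightarrow> normalizes G g R"
  shows "m = 1 \<or> card R = 3 \<and> m = 2"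
proof -
  have RG: "R \<subseteq> carrier G" using R(1) by (rule subgroup.subset)
  have finR: "finite R" using RG fin finite_subset by blast
  have ordR: "ord x = r" if "x \<in> R" "x \<noteq> \<one>" for x using ord_subgroup_power[OF st fin R r that] .
  have m0: "m > 0" using ord(1) fin by (metis gr0I mult_0_right order_gt_0_iff_finite less_irrefl)
  have q2: "q = 2 \<and> card R = 3" if q: "Factorial_Ring.prime q" "q dvd m" for q
  proof -
    have "q dvd order G" using q ord(1) by simp
    then obtain y where y: "y \<in> carrier G" "ord y = q" using element_of_prime_order[OF fin q(1)] by blast
    have q4: "q \<in> {2, 3, 5, 7}" by (rule stable_prime_divisor[OF st fin q(1) \<open>q dvd order G\<close>])
    have qr: "q \<noteq> r" using q(2) ord(2) by blast
    have conj: "y \<otimes> x \<otimes> inv y \<in> R" if "x \<in> R" for x using norm[OF y(1)] that by (simp add: normalizes_def)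
    have fpf: "x = \<one>" if "x \<in> R" "y \<otimes> x = x \<otimes> y" for x
      using no_mixed_commuting[OF st fin y(1) _ that(2)] ordR[OF that(1)] that(1) RG y(2) q(1) r(1) qr by auto
    have yR: "y \<notin> R" using fpf[of y] y(2) q(1) by auto
    have "card R mod q = card {x \<in> R. \<forall>g\<in>carrier (G\<lparr>carrier := generate G {y}\<rparr>). g \<otimes> x \<otimes> inv g = x} mod q"
    proof (rule card_fixed_points_mod[OF _ _ q(1) finR])
      have Y: "subgroup (generate G {y}) G" using y by (simp add: generate_is_subgroup)
      show "group (G\<lparr>carrier := generate G {y}\<rparr>)" by (rule subgroup_imp_group[OF Y])
      show "order (G\<lparr>carrier := generate G {y}\<rparr>) = q ^ 1" using generate_pow_card[OF y(1)] y(2) by (simp add: order_def)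
      show "g \<otimes> x \<otimes> inv g \<in> R" if "g \<in> carrier (G\<lparr>carrier := generate G {y}\<rparr>)" "x \<in> R" for g x
        using norm[of g] that subgroup.subset[OF Y] by (auto simp: normalizes_def)
      show "\<one>\<^bsub>G\<lparr>carrier := generate G {y}\<rparr>\<^esub> \<otimes> x \<otimes> inv \<one>\<^bsub>G\<lparr>carrier := generate G {y}\<rparr>\<^esub> = x" if "x \<in> R" for x
        using that RG by auto
      show "g \<otimes>\<^bsub>G\<lparr>carrier := generate G {y}\<rparr>\<^esub> h \<otimes> x \<otimes> inv (g \<otimes>\<^bsub>G\<lparr>carrier := generate G {y}\<rparr>\<^esub> h) = g \<otimes> (h \<otimes> x \<otimes> inv h) \<otimes> inv g"
        if "g \<in> carrier (G\<lparr>carrier := generate G {y}\<rparr>)" "h \<in> carrier (G\<lparr>carrier := generate G {y}\<rparr>)" "x \<in> R" for g h x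
        using that RG subgroup.subset[OF Y] by (auto simp: inv_mult_group m_assoc subset_iff)
    qed
    also have "{x \<in> R. \<forall>g\<in>carrier (G\<lparr>carrier := generate G {y}\<rparr>). g \<otimes> x \<otimes> inv g = x} = {\<one>}"
    proof (intro equalityI subsetI)
      fix x assume x: "x \<in> {x \<in> R. \<forall>g\<in>carrier (G\<lparr>carrier := generate G {y}\<rparr>). g \<otimes> x \<otimes> inv g = x}"
      have "y \<in> generate G {y}" by (auto intro: generate.incl)
      then have "y \<otimes> x \<otimes> inv y = x" using x by simp
      then have "y \<otimes> x = x \<otimes> y" using x y(1) RG by (metis (no_types, lifting) inv_solve_right m_closed mem_Collect_eq subsetD inv_closed)
      then show "x \<in> {\<one>}" using fpf x by blast
    next
      fix x assume "x \<in> {\<one>}"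
      moreover have "generate G {y} \<subseteq> carrier G" using y(1) generate_incl by blast
      ultimately show "x \<in> {x \<in> R. \<forall>g\<in>carrier (G\<lparr>carrier := generate G {y}\<rparr>). g \<otimes> x \<otimes> inv g = x}"
        using subgroup.one_closed[OF R(1)] by auto
    qed
    finally have modq: "card R mod q = 1 mod q" by simp
    have cases: "r = 3 \<and> (e = 1 \<or> e = 2) \<or> (r = 5 \<or> r = 7) \<and> e = 1" by (rule prime_divisor_orders[OF st fin R r ord(3)])
    obtain a where a: "a \<in> R" "a \<noteq> \<one>" 
    proof -
      have "card R \<noteq> 1" using R(2) ord(3) r(1) prime_gt_1_nat[of r] by (metis nat_power_eq_Suc_0_iff One_nat_def less_irrefl)
      then have "R \<noteq> {\<one>}" by auto
      then show ?thesis using that subgroup.one_closed[OF R(1)] by blast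
    qed
    have aG: "a \<in> carrier G" and oa: "ord a = r" using a RG ordR by auto
    have aR: "a [^] (i::nat) \<in> R" for i by (rule nat_pow_mem_subgroup[OF R(1) a(1)])
    have yna: "y \<noteq> a [^] (i::nat)" for i using aR yR by metis
    show ?thesis
    proof (cases "q = 2")
      case True
      have yy: "y \<otimes> y = \<one>" using ord_2_iff[OF y(1)] y(2) True by simp
      then have iy: "inv y = y" using y(1) by (simp add: inv_equality)
      \<comment> \<open>Equal values at \<open>u\<close> and \<open>v\<close> would make
        \<open>v \<otimes> inv u\<close> commute with \<open>y\<close>, so the map is injective and
        hence onto \<open>R\<close>. The involution \<open>y\<close> inverts every element of this
        form, so it inverts all of \<open>R\<close>.\<close>
      have "inj_on (\<lambda>x. inv x \<otimes> (y \<otimes> x \<otimes> inv y)) R"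
      proof (rule inj_onI)
        fix u v assume uv: "u \<in> R" "v \<in> R" "inv u \<otimes> (y \<otimes> u \<otimes> inv y) = inv v \<otimes> (y \<otimes> v \<otimes> inv y)"
        have G: "u \<in> carrier G" "v \<in> carrier G" using uv RG by auto
        have "v \<otimes> inv u \<otimes> (y \<otimes> u) \<otimes> inv y = v \<otimes> (inv u \<otimes> (y \<otimes> u \<otimes> inv y))" using G y(1) by (simp add: m_assoc)
        also have "\<dots> = (v \<otimes> inv v) \<otimes> (y \<otimes> v) \<otimes> inv y" unfolding uv(3) using G y(1) by (simp only: m_assoc m_closed inv_closed)
        finally have "v \<otimes> inv u \<otimes> (y \<otimes> u) \<otimes> inv y = y \<otimes> v \<otimes> inv y" using G y(1) by simp
        then have "v \<otimes> inv u \<otimes> (y \<otimes> u) = y \<otimes> v" using G y(1) by (metis m_closed inv_closed r_cancel)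
        then have "v \<otimes> inv u \<otimes> (y \<otimes> u) \<otimes> inv u = y \<otimes> v \<otimes> inv u" by simp
        then have "v \<otimes> inv u \<otimes> y = y \<otimes> (v \<otimes> inv u)" using G y(1) by (simp add: m_assoc)
        then have "v \<otimes> inv u = \<one>"
          using fpf[of "v \<otimes> inv u"] uv(1,2) subgroup.m_closed[OF R(1)] subgroup.m_inv_closed[OF R(1)] by simp
        then show "u = v" using G by (metis inv_closed inv_equality inv_inv)
      qed
      moreover have "(\<lambda>x. inv x \<otimes> (y \<otimes> x \<otimes> inv y)) ` R \<subseteq> R"
        using conj subgroup.m_closed[OF R(1)] subgroup.m_inv_closed[OF R(1)] by auto
      ultimately have surj: "(\<lambda>x. inv x \<otimes> (y \<otimes> x \<otimes> inv y)) ` R = R" using endo_inj_surj[OF finR] by blast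
      have inverts: "y \<otimes> u = inv u \<otimes> y" if u: "u \<in> R" for u
      proof -
        obtain x where x: "x \<in> R" "u = inv x \<otimes> (y \<otimes> x \<otimes> inv y)" using surj u by blast
        have xG: "x \<in> carrier G" using x RG by blast
        have uG: "u \<in> carrier G" using u RG by blast
        have "inv u = y \<otimes> (inv x \<otimes> (y \<otimes> x))"
          unfolding x(2) using xG y(1) by (simp add: iy inv_mult_group m_assoc)
        also have "inv x \<otimes> (y \<otimes> x) = u \<otimes> y" unfolding x(2) iy using xG y(1) yy by (simp add: m_assoc)
        finally have "inv u \<otimes> y = y \<otimes> u \<otimes> (y \<otimes> y)" using uG y(1) by (simp add: m_assoc)
        then show ?thesis using yy uG y(1) by simp
      qed
      have pc: "pc_relations G a \<one> y r 1 2 (r - 1, 0) (0, 1) (0, 0)"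
        using pc_relations_inverting[OF fin aG y(1) _ yna inverts[OF a(1)]] y(2) True oa by simp
      have "r \<noteq> 5"
      proof
        assume "r = 5"
        then show False using pc_not_stable_witness[OF fin _ unstable_pc_D5] pc st by simp
      qed
      moreover have "r \<noteq> 7"
      proof
        assume "r = 7"
        then show False using pc_not_stable_witness[OF fin _ unstable_pc_D7] pc st by simp
      qed
      moreover have "e \<noteq> 2"
      proof
        assume e: "e = 2"
        then have r3: "r = 3" using cases by auto
        interpret R: group "G\<lparr>carrier := R\<rparr>" using R(1) by (rule subgroup_imp_group)
        obtain b where b: "b \<in> R" "\<And>i::nat. b \<noteq> a [^] i"
        proof -
          have "card (generate G {a}) < card R" using generate_pow_card[OF aG] oa R(2) e r3 by simp
          moreover have "finite (generate G {a})" using generate_incl[of "{a}"] aG fin finite_subset by blast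
          ultimately have "\<not> R \<subseteq> generate G {a}" using card_mono leD by blast
          then show ?thesis using that generate_pow_on_finite_carrier[OF fin aG] by blast
        qed
        have bG: "b \<in> carrier G" using b RG by blast
        have ob: "ord b = 3" using ordR[OF b(1)] b(2)[of 0] r3 by simp
        have comm: "a \<otimes> b = b \<otimes> a" by (rule odd_subgroup_abelian[OF st fin R r a(1) b(1)])
        have p3: "Factorial_Ring.prime (3::nat)" by (simp add: prime_nat_numeral_eq)
        have sq: "inv u = u [^] (2::nat)" if "u \<in> R" "u \<noteq> \<one>" for u
        proof -
          have uG: "u \<in> carrier G" using that RG by blast
          have "u [^] (3::nat) = \<one>" using pow_ord_eq_1[OF uG] ordR[OF that] r3 by simp
          then show ?thesis using uG by (intro inv_equality) (simp_all add: numeral_3_eq_3 numeral_2_eq_2)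
        qed
        have "y \<notin> powers_product a b"
          using yR subgroup.m_closed[OF R(1)] nat_pow_mem_subgroup[OF R(1)] a(1) b(1) by (metis powers_productE)
        moreover have "y \<otimes> a = a [^] (2::nat) \<otimes> b [^] (0::nat) \<otimes> y" using inverts[OF a(1)] sq[OF a] aG by simp
        moreover have "y \<otimes> b = a [^] (0::nat) \<otimes> b [^] (2::nat) \<otimes> y"
          using inverts[OF b(1)] sq[OF b(1)] b(2)[of 0] bG by simp
        moreover have "y [^] (2::nat) = a [^] (0::nat) \<otimes> b [^] (0::nat)" using yy y(1) by (simp add: numeral_2_eq_2)
        ultimately have "pc_relations G a b y (ord a) (ord b) 2 (2, 0) (0, 2) (0, 0)"
          using pc_relationsI[OF fin aG bG y(1) comm independent_powers[OF fin aG bG comm _ b(2)] two_is_prime_nat] ob p3 by simp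
        then show False using pc_not_stable_witness[OF fin _ unstable_pc_Dih33] oa ob r3 st by simp
      qed
      ultimately show ?thesis using cases True R(2) by auto
    next
      case False
      then have r7: "r = 7" and q3: "q = 3" and e1: "e = 1" using cases modq q4 R(2) by auto
      have all: "R = generate G {a}"
      proof -
        have sub: "generate G {a} \<subseteq> R" using generate_subgroup_incl[of "{a}" R] a(1) R(1) by simp
        have "card (generate G {a}) = card R" using generate_pow_card[OF aG] oa R(2) e1 by simp
        then show ?thesis using card_subset_eq[OF finR sub] by simp
      qed
      obtain k :: nat where k: "y \<otimes> a \<otimes> inv y = a [^] k" "k < 7"
        using conj[OF a(1)] all generate_singleton_eq[OF fin aG] oa r7 by auto
      have "y \<otimes> a = y \<otimes> a \<otimes> inv y \<otimes> y" using y(1) aG by (simp add: m_assoc)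
      then have ya: "y \<otimes> a = a [^] k \<otimes> y" using k by simp
      have ypow: "y [^] i \<otimes> a = a [^] (k ^ i) \<otimes> y [^] i" for i :: nat
      proof (induction i)
        case (Suc i)
        have "y [^] Suc i \<otimes> a = y \<otimes> (y [^] i \<otimes> a)" using y(1) aG nat_pow_Suc2[of y i] by (simp add: m_assoc)
        also have "\<dots> = y \<otimes> a [^] (k ^ i) \<otimes> y [^] i" using y(1) aG by (simp add: Suc.IH m_assoc)
        also have "y \<otimes> a [^] (k ^ i) = (a [^] k) [^] (k ^ i) \<otimes> y" using conj_pow[OF y(1) aG _ ya] aG by simp
        also have "(a [^] k) [^] (k ^ i) \<otimes> y \<otimes> y [^] i = a [^] (k ^ Suc i) \<otimes> y [^] Suc i"
          using y(1) aG nat_pow_Suc2[of y i] by (simp add: nat_pow_pow m_assoc)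
        finally show ?case .
      qed (use aG in simp)
      have y3: "y [^] (3::nat) = \<one>" using pow_ord_eq_1[OF y(1)] y(2) q3 by simp
      have "a [^] (k ^ 3) = a [^] (1::nat)" using ypow[of 3] y3 aG by simp
      then have k3: "k ^ 3 mod 7 = 1" unfolding pow_eq_pow_iff[OF fin aG] oa r7 by simp
      have "k \<noteq> 1"
      proof
        assume "k = 1"
        then have "y \<otimes> a = a \<otimes> y" using ya aG by simp
        then show False using fpf[OF a(1)] a(2) by blast
      qed
      moreover have "k = 0 \<or> k = 1 \<or> k = 2 \<or> k = 3 \<or> k = 4 \<or> k = 5 \<or> k = 6" using k(2) by linarith
      ultimately have k24: "k = 2 \<or> k = 4" using k3 by (elim disjE) simp_all
      have rel: "pc_relations G a \<one> x 7 1 3 (2, 0) (0, 1) (0, 0)"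
        if "x \<in> carrier G" "\<And>i::nat. x \<noteq> a [^] i" "x \<otimes> a = a [^] (2::nat) \<otimes> x" "x [^] (3::nat) = \<one>" for x
        using pc_relations_metacyclicI[OF fin aG that(1) _ that(2,3), of 3 0] that(4) oa r7
        by (simp add: prime_nat_numeral_eq)
      have "\<exists>x. pc_relations G a \<one> x 7 1 3 (2, 0) (0, 1) (0, 0)"
        using k24
      proof
        assume "k = 2"
        then show ?thesis using rel[OF y(1) yna] ya y3 by blast
      next
        \<comment> \<open>The witness has the exponent 2. The element \<open>y^2\<close> acts by the
          exponent 16, which is 2 modulo 7.\<close>
        assume k4: "k = 4"
        have "y [^] (2::nat) \<noteq> a [^] (i::nat)" for i
        proof
          assume "y [^] (2::nat) = a [^] i"
          then have "(y [^] (2::nat)) [^] (2::nat) \<in> R" using aR nat_pow_mem_subgroup[OF R(1)] by metis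
          moreover have "(y [^] (2::nat)) [^] (2::nat) = y [^] (3::nat) \<otimes> y" using y(1) by (simp add: nat_pow_pow numeral_eq_Suc m_assoc)
          ultimately show False using yR y3 y(1) by simp
        qed
        moreover have "y [^] (2::nat) \<otimes> a = a [^] (2::nat) \<otimes> y [^] (2::nat)"
          using ypow[of 2] k4 pow_eq_pow_iff[OF fin aG, of 16 2] oa r7 by simp
        moreover have "(y [^] (2::nat)) [^] (3::nat) = \<one>"
        proof -
          have "(y [^] (2::nat)) [^] (3::nat) = (y [^] (3::nat)) [^] (2::nat)" using y(1) by (simp add: nat_pow_pow)
          then show ?thesis using y3 by simp
        qed
        ultimately show ?thesis using rel[of "y [^] (2::nat)"] y(1) by blast
      qed
      then show ?thesis using pc_not_stable_witness[OF fin _ unstable_pc_F21] st by blast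
    qed
  qed
  show ?thesis
  proof (cases "m = 1")
    case False
    then obtain q where "Factorial_Ring.prime q" "q dvd m" using prime_factor_nat by blast
    then have R3: "card R = 3" using q2 by blast
    obtain b where b: "m = 2 ^ b" using power_of_prime_if_unique_prime_divisor[OF m0, of 2] q2 by blast
    then have "b \<le> 1" using stable_order_3_times_2_power[OF st fin, of b] ord(1) R(2) R3 by simp
    then have "b = 1" using b False by (cases b) auto
    then show ?thesis using b R3 by simp
  qed simp
qed

end

section \<open>The order of a stable group\<close>

context group
begin

text \<open>Applying \<open>normal_odd_sylow\<close> inside the normalizer of an odd Sylow subgroup
  \<open>R\<close> shows that \<open>R\<close> is self-normalizing or has order 3 with normalizer of
  order 6. In the first case the conjugates of \<open>R\<close> cover all but \<open>m\<close>
  elements outside \<open>\<one>\<close>-free unions, which excludes another odd prime and otherwise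
  makes the Sylow 2-subgroup normal. If only the second case occurs, the order is
  \<open>3 * 2^b\<close>.\<close>

lemma stable_order_cases:
  assumes st: "stable_group G" and fin: "finite (carrier G)"
  shows "(\<exists>p k. Factorial_Ring.prime p \<and> order G = p ^ k) \<or> order G = 6"
proof (rule ccontr)
  assume contra: "\<not> ?thesis"
  have o0: "order G > 0" using fin by (simp add: order_gt_0_iff_finite)
  have p3: "Factorial_Ring.prime (3::nat)" by (simp add: prime_nat_numeral_eq)
  let ?odd = "\<lambda>r. Factorial_Ring.prime r \<and> r \<noteq> 2 \<and> r dvd order G"
  have sylow: "\<exists>e m R. order G = r ^ e * m \<and> \<not> r dvd m \<and> e > 0 \<and> subgroup R G \<and> card R = r ^ e \<and>
      ({g \<in> carrier G. normalizes G g R} = R \<or> r = 3 \<and> e = 1 \<and> card {g \<in> carrier G. normalizes G g R} = 6)"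
    if r: "?odd r" for r
  proof -
    have "order G \<noteq> 0" "\<not> is_unit r" using o0 r by (auto dest: not_prime_unit)
    then obtain m where m: "order G = r ^ multiplicity r (order G) * m" "\<not> r dvd m"
      by (rule multiplicity_decompose')
    define e where "e = multiplicity r (order G)"
    have ord: "order G = r ^ e * m" using m(1) by (simp add: e_def)
    have e0: "e > 0"
    proof (rule ccontr)
      assume "\<not> e > 0"
      then have "order G = m" using ord by simp
      then show False using r m(2) by simp
    qed
    obtain R where R: "subgroup R G" "card R = r ^ e" using sylow_thm[OF _ is_group ord fin] r by blast
    have RG: "R \<subseteq> carrier G" using R(1) by (rule subgroup.subset)
    let ?N = "{g \<in> carrier G. normalizes G g R}"
    have N: "subgroup ?N G" by (rule normalizer_subgroup[OF fin R(1)])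
    have RN: "R \<subseteq> ?N"
      using RG subgroup.m_closed[OF R(1)] subgroup.m_inv_closed[OF R(1)] by (auto simp: normalizes_def)
    note stN = stable_group_restrict[OF st fin N]
    have RsN: "subgroup R (G\<lparr>carrier := ?N\<rparr>)" by (rule subgroup_incl[OF R(1) N RN])
    obtain m' where m': "card ?N = r ^ e * m'"
      using group.card_subgroup_dvd[OF stN(3,2) RsN] stN(4) R(2) by auto
    have "r ^ e * m' dvd r ^ e * m" using card_subgroup_dvd[OF fin N] m' ord by simp
    moreover have "r > 0" using r prime_gt_0_nat by simp
    ultimately have "m' dvd m" by simp
    then have "\<not> r dvd m'" using m(2) dvd_trans by blast
    moreover have "normalizes (G\<lparr>carrier := ?N\<rparr>) g R" if "g \<in> carrier (G\<lparr>carrier := ?N\<rparr>)" for g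
      using that m_inv_consistent[OF N, of g] by (simp add: normalizes_def)
    ultimately have alt: "m' = 1 \<or> card R = 3 \<and> m' = 2"
      using group.normal_odd_sylow[OF stN(3,1,2) _ _ e0 _ _ RsN R(2), of m'] stN(4) m' r by simp
    have "?N = R \<or> r = 3 \<and> e = 1 \<and> card ?N = 6"
      using alt
    proof
      assume "m' = 1"
      then have "card ?N = card R" using m' R(2) by simp
      moreover have "finite ?N" using fin by simp
      ultimately show ?thesis using RN by (metis (no_types, lifting) card_subset_eq)
    next
      assume h: "card R = 3 \<and> m' = 2"
      then have "r dvd 3" using R(2) e0 by (metis dvd_power)
      then have r3: "r = 3" using r p3 by (metis primes_dvd_imp_eq)
      then have "(3::nat) ^ e = 3 ^ 1" using h R(2) by simp
      then have "e = 1" by (subst (asm) power_inject_exp) auto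
      then show ?thesis using r3 m' h R(2) by simp
    qed
    then show ?thesis using ord m(2) e0 R by blast
  qed
  show False
  proof (cases "\<exists>r. ?odd r")
    case False
    then obtain k where "order G = 2 ^ k" using power_of_prime_if_unique_prime_divisor[OF o0, of 2] by blast
    then show False using contra two_is_prime_nat by blast
  next
    case some: True
    let ?U = "\<lambda>R. {g \<otimes> x \<otimes> inv g | g x. g \<in> carrier G \<and> x \<in> R - {\<one>}}"
    show False
    proof (cases "\<exists>r e m R. ?odd r \<and> order G = r ^ e * m \<and> \<not> r dvd m \<and> e > 0 \<and> subgroup R G \<and> card R = r ^ e \<and>
        {g \<in> carrier G. normalizes G g R} = R")
      case True
      then obtain r e m R where r: "Factorial_Ring.prime r" "r \<noteq> 2" "r dvd order G" and ord: "order G = r ^ e * m" "\<not> r dvd m"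
        and e: "e > 0" and R: "subgroup R G" "card R = r ^ e" and N: "{g \<in> carrier G. normalizes G g R} = R" by blast
      have U: "card (?U R) * card R = order G * (card R - 1)" "?U R \<subseteq> {u \<in> carrier G. ord u = r}"
        using card_sylow_elements[OF st fin ord r(1,2) R] unfolding N by auto
      have re: "r ^ e \<ge> 3"
      proof -
        have "r \<ge> 3" using r(1,2) prime_ge_2_nat[of r] by linarith
        moreover have "r ^ 1 \<le> r ^ e" using e \<open>r \<ge> 3\<close> by (intro power_increasing) auto
        ultimately show ?thesis by simp
      qed
      have "card (?U R) * r ^ e = (m * (r ^ e - 1)) * r ^ e" using U(1) R(2) ord(1) by (simp add: mult_ac)
      then have cU: "card (?U R) = m * (r ^ e - 1)" using re prime_gt_0_nat[OF r(1)] by simp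
      have m0: "m > 0" using ord(1) o0 by (metis gr0I mult_0_right less_irrefl)
      have cU': "card (?U R) + m = order G"
      proof -
        have "m * (r ^ e - 1) + m = m * (r ^ e - 1 + 1)" by (simp only: distrib_left mult_1_right)
        also have "r ^ e - 1 + 1 = r ^ e" using re by linarith
        finally show ?thesis unfolding cU ord(1) by (simp only: mult.commute)
      qed
      have finord: "finite {u \<in> carrier G. ord u = s}" for s using fin by simp
      have finU: "finite (?U R)" by (rule finite_subset[OF U(2) finord])
      show False
      proof (cases "\<exists>s. Factorial_Ring.prime s \<and> s \<noteq> 2 \<and> s dvd m")
        case True
        then obtain s where s: "Factorial_Ring.prime s" "s \<noteq> 2" "s dvd m" by blast
        have sr: "s \<noteq> r" using s(3) ord(2) by blast
        have so: "s dvd order G" using s(3) ord(1) by simp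
        have "?odd s" using s(1,2) so by blast
        from sylow[OF this] obtain f k S where S: "order G = s ^ f * k" "\<not> s dvd k" "f > 0" "subgroup S G" "card S = s ^ f"
          and NS: "{g \<in> carrier G. normalizes G g S} = S \<or> s = 3 \<and> f = 1 \<and> card {g \<in> carrier G. normalizes G g S} = 6"
          by (elim exE conjE) (rule that)
        have US: "card (?U S) * card {g \<in> carrier G. normalizes G g S} = order G * (card S - 1)"
          "?U S \<subseteq> {u \<in> carrier G. ord u = s}"
          using card_sylow_elements[OF st fin S(1,2) s(1,2) S(4,5)] by auto
        have finS: "finite (?U S)" by (rule finite_subset[OF US(2) finord])
        \<comment> \<open>A self-normalizing \<open>S\<close> contributes the fraction
          \<open>1 - 1 / card S\<close> of the group, the exceptional case the fraction 2/6. Outside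
          the nontrivial elements of the conjugates of \<open>R\<close> only \<open>m\<close>
          elements remain, at most a third of the group, and one of them is
          \<open>\<one>\<close>.\<close>
        have third: "order G \<le> 3 * card (?U S)"
          using NS
        proof
          assume "{g \<in> carrier G. normalizes G g S} = S"
          then have eq: "card (?U S) * card S = order G * (card S - 1)" using US(1) by simp
          have "s \<ge> 3" using s(1,2) prime_ge_2_nat[of s] by linarith
          then have "s ^ 1 \<le> s ^ f" using S(3) by (intro power_increasing) auto
          then have c3: "card S \<ge> 3" using S(5) \<open>s \<ge> 3\<close> by simp
          have "order G * card S \<le> order G * (3 * (card S - 1))" using c3 by (intro mult_le_mono) auto
          also have "\<dots> = 3 * card (?U S) * card S" using eq by (simp add: mult_ac)
          finally show ?thesis using c3 by simp
        next
          assume h: "s = 3 \<and> f = 1 \<and> card {g \<in> carrier G. normalizes G g S} = 6"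
          then have "card (?U S) * 6 = order G * 2" using US(1) S(5) by simp
          then show ?thesis by simp
        qed
        have "?U R \<inter> ?U S = {}" using U(2) US(2) sr by blast
        then have "card (?U R) + card (?U S) = card (?U R \<union> ?U S)" using finU finS by (simp add: card_Un_disjoint)
        also have "\<dots> < card (carrier G)"
        proof (rule psubset_card_mono[OF fin])
          have "ord \<one> \<noteq> r" "ord \<one> \<noteq> s" using r(1) s(1) by auto
          then have "\<one> \<notin> ?U R \<union> ?U S" using U(2) US(2) by blast
          then show "?U R \<union> ?U S \<subset> carrier G" using U(2) US(2) one_closed by blast
        qed
        finally have "card (?U S) < m" using cU' by (simp add: order_def)
        moreover have "3 * m \<le> order G" using ord(1) re by simp
        ultimately show False using third by linarith
      next
        case False
        then obtain b where b: "m = 2 ^ b" using power_of_prime_if_unique_prime_divisor[OF m0, of 2] by blast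
        have "b \<noteq> 0"
        proof
          assume "b = 0"
          then show False using contra ord(1) b r(1) by auto
        qed
        have "order G = 2 ^ b * r ^ e" using ord(1) b by simp
        from sylow_thm[OF two_is_prime_nat is_group this fin]
        obtain P where P: "subgroup P G" "card P = 2 ^ b" by blast
        have PG: "P \<subseteq> carrier G" using P(1) by (rule subgroup.subset)
        have "p \<notin> ?U R" if p: "p \<in> P" for p
        proof
          assume "p \<in> ?U R"
          then have "ord p = r" using U(2) by blast
          moreover have "ord p dvd 2 ^ b"
            using group.ord_dvd_group_order[OF stable_group_restrict(3)[OF st fin P(1)], of p]
              ord_restrict[OF P(1) p] stable_group_restrict(4)[OF st fin P(1)] P(2) p by simp
          ultimately have "r dvd 2" using r(1) prime_dvd_power by blast
          then show False using r(1,2) two_is_prime_nat primes_dvd_imp_eq by blast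
        qed
        then have sub: "P \<subseteq> carrier G - ?U R" using PG by blast
        \<comment> \<open>The complement of \<open>?U R\<close> has exactly as many elements as the
          Sylow 2-subgroup inside it, so the two agree. The complement is closed under conjugation,
          which makes \<open>P\<close> normal.\<close>
        have "card (carrier G - ?U R) = m"
          using cU' U(2) finU by (subst card_Diff_subset) (auto simp: order_def)
        then have Peq: "P = carrier G - ?U R" using sub P(2) b fin by (intro card_subset_eq) auto
        have "normalizes G g P" if g: "g \<in> carrier G" for g
          unfolding normalizes_def
        proof
          fix p assume p: "p \<in> P"
          then have pG: "p \<in> carrier G" using PG by blast
          have "g \<otimes> p \<otimes> inv g \<notin> ?U R"
          proof
            assume "g \<otimes> p \<otimes> inv g \<in> ?U R"
            then obtain h x where hx: "h \<in> carrier G" "x \<in> R - {\<one>}" "g \<otimes> p \<otimes> inv g = h \<otimes> x \<otimes> inv h" by blast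
            have xG: "x \<in> carrier G" using hx(2) subgroup.subset[OF R(1)] by blast
            have "p = inv g \<otimes> (g \<otimes> p \<otimes> inv g) \<otimes> g"
            proof -
              have "inv g \<otimes> (g \<otimes> p \<otimes> inv g) \<otimes> g = (inv g \<otimes> g) \<otimes> p \<otimes> (inv g \<otimes> g)"
                using g pG by (simp only: m_assoc m_closed inv_closed)
              then show ?thesis using g pG by simp
            qed
            also have "\<dots> = (inv g \<otimes> h) \<otimes> x \<otimes> inv (inv g \<otimes> h)"
              unfolding hx(3) using g hx(1) xG by (simp add: inv_mult_group m_assoc)
            finally have "p \<in> ?U R" using g hx(1,2) by blast
            then show False using p Peq by blast
          qed
          then show "g \<otimes> p \<otimes> inv g \<in> P" using Peq g pG by simp
        qed
        then show False
          using not_stable_normal_2_subgroup[OF fin P _ _ r] st \<open>b \<noteq> 0\<close> by blast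
      qed
    next
      case False
      have r3: "r = 3" if "?odd r" for r using sylow[OF that] False that by blast
      then obtain e m R where ord: "order G = 3 ^ e * m" "\<not> 3 dvd m" "e = 1"
        using some sylow False by metis
      have m0: "m > 0" using ord(1) o0 by (metis gr0I mult_0_right less_irrefl)
      have "q = 2" if "Factorial_Ring.prime q" "q dvd m" for q
        using r3[of q] that ord(1,2) by (metis dvd_mult)
      then obtain b where b: "m = 2 ^ b" using power_of_prime_if_unique_prime_divisor[OF m0, of 2] by blast
      then have "b \<le> 1" using stable_order_3_times_2_power[OF st fin, of b] ord by simp
      then have "order G = 3 ^ 1 \<or> order G = 6" using ord b by (cases b) auto
      moreover have "Factorial_Ring.prime (3::nat)" by (simp add: prime_nat_numeral_eq)
      ultimately show False using contra by blast
    qed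
  qed
qed

end

section \<open>Presentations of the listed groups\<close>

lemma has_pc_presentationI:
  "pc_relations G a b x l m n P Q C \<Longrightarrow> order G = l * m * n \<Longrightarrow> has_pc_presentation G l m n P Q C"
  by (auto simp: has_pc_presentation_def)

lemma cyclic_product_Cons_pow:
  assumes "n > 0" "x \<in> carrier (integer_mod_group n)" "xs \<in> carrier (cyclic_product ns)"
  shows "(x # xs) [^]\<^bsub>cyclic_product (n # ns)\<^esub> (k::nat) =
    (int k * x mod int n) # (xs [^]\<^bsub>cyclic_product ns\<^esub> k)"
proof (induction k)
  case (Suc k)
  interpret C: group "cyclic_product ns" by (rule group_cyclic_product)
  have "int k * x mod int n \<in> carrier (integer_mod_group n)"
    using assms(1) by (simp add: carrier_integer_mod_group)
  then have "(x # xs) [^]\<^bsub>cyclic_product (n # ns)\<^esub> Suc k =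
      ((int k * x mod int n + x) mod int n) # (xs [^]\<^bsub>cyclic_product ns\<^esub> Suc k)"
    using assms Suc.IH by (simp add: monoid.nat_pow_Suc[OF group.is_monoid[OF group_cyclic_product]])
  also have "(int k * x mod int n + x) mod int n = int (Suc k) * x mod int n"
    by (simp add: mod_simps algebra_simps)
  finally show ?case .
qed (simp add: monoid.nat_pow_0[OF group.is_monoid[OF group_cyclic_product]])

lemma (in group) ord_eq_if_pow_eq_one_iff:
  assumes "a \<in> carrier G" "\<And>k::nat. a [^] k = \<one> \<longleftrightarrow> n dvd k"
  shows "ord a = n"
  using assms(2) pow_eq_id[OF assms(1)] by (meson dvd_antisym dvd_refl)

lemma finite_cyclic_product: "0 \<notin> set ns \<Longrightarrow> finite (carrier (cyclic_product ns))"
  using order_cyclic_product[of ns] prod_list_zero_iff[of ns] by (metis card_ge_0_finite gr0I order_def)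

lemma pc_presentation_cyclic_product_single:
  assumes n: "n > 1"
  shows "has_pc_presentation (cyclic_product [n]) n 1 1 (1, 0) (0, 1) (0, 0)"
proof -
  interpret C: group "cyclic_product [n]" by (rule group_cyclic_product)
  have a: "[1] \<in> carrier (cyclic_product [n])" using n by (simp add: carrier_integer_mod_group)
  have nil: "[] [^]\<^bsub>cyclic_product []\<^esub> (k::nat) = []" for k by (induction k) simp_all
  have "[1] [^]\<^bsub>cyclic_product [n]\<^esub> k = \<one>\<^bsub>cyclic_product [n]\<^esub> \<longleftrightarrow> n dvd k" for k :: nat
    using n by (simp add: cyclic_product_Cons_pow carrier_integer_mod_group nil mod_eq_0_iff_dvd)
  then have "C.ord [1] = n" by (rule C.ord_eq_if_pow_eq_one_iff[OF a])
  then show ?thesis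
    using C.pc_presentation_cyclic[OF finite_cyclic_product a] n order_cyclic_product[of "[n]"] by simp
qed

text \<open>The generator \<open>a\<close> comes from the second factor, so the product
  \<open>[2, 4]\<close> receives the parameters 4, 2, with the generator of order 4 first.\<close>

lemma pc_presentation_cyclic_product_pair:
  assumes n: "n > 1" "m > 1"
  shows "has_pc_presentation (cyclic_product [m, n]) n m 1 (1, 0) (0, 1) (0, 0)"
proof -
  let ?C = "cyclic_product [m, n]"
  interpret C: group ?C by (rule group_cyclic_product)
  have ab: "[0, 1] \<in> carrier ?C" "[1, 0] \<in> carrier ?C" using n by (simp_all add: carrier_integer_mod_group)
  have nil: "[] [^]\<^bsub>cyclic_product []\<^esub> (k::nat) = []" for k by (induction k) simp_all
  have a: "[0, 1] [^]\<^bsub>?C\<^esub> k = [0, int k mod int n]" for k :: nat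
    using n by (simp add: cyclic_product_Cons_pow carrier_integer_mod_group nil)
  have b: "[1, 0] [^]\<^bsub>?C\<^esub> k = [int k mod int m, 0]" for k :: nat
    using n by (simp add: cyclic_product_Cons_pow carrier_integer_mod_group nil)
  have ord: "C.ord [0, 1] = n" "C.ord [1, 0] = m"
    using n by (auto intro!: C.ord_eq_if_pow_eq_one_iff ab simp: a b mod_eq_0_iff_dvd)
  have "pc_relations ?C [0, 1] [1, 0] \<one>\<^bsub>?C\<^esub> (C.ord [0, 1]) (C.ord [1, 0]) 1 (1, 0) (0, 1) (0, 0)"
  proof (rule C.pc_relations_abelianI[OF _ ab])
    show "finite (carrier ?C)" using n by (intro finite_cyclic_product) auto
    show "[0, 1] \<otimes>\<^bsub>?C\<^esub> [1, 0] = [1, 0] \<otimes>\<^bsub>?C\<^esub> [0, 1]" using n by (simp add: carrier_integer_mod_group)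
    fix i j :: nat
    assume "[0, 1] [^]\<^bsub>?C\<^esub> i \<otimes>\<^bsub>?C\<^esub> [1, 0] [^]\<^bsub>?C\<^esub> j = \<one>\<^bsub>?C\<^esub>"
    then show "C.ord [0, 1] dvd i \<and> C.ord [1, 0] dvd j"
      using n by (simp add: a b ord carrier_integer_mod_group mod_eq_0_iff_dvd)
  qed
  then show ?thesis
    unfolding ord by (rule has_pc_presentationI) (use order_cyclic_product[of "[m, n]"] n in simp)
qed

lemma pc_presentation_dihedral_group_4:
  "has_pc_presentation (dihedral_group 4) 4 1 2 (3, 0) (0, 1) (0, 0)"
proof -
  let ?D = "dihedral_group 4"
  interpret D: group ?D by (rule group_dihedral_group) simp
  have a: "(1, False) \<in> carrier ?D" and x: "(0, True) \<in> carrier ?D" by (simp_all add: dihedral_group_def)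
  have pow: "(1, False) [^]\<^bsub>?D\<^esub> k = (int k mod 4, False)" for k :: nat
  proof (induction k)
    case 0
    show ?case by (simp add: D.nat_pow_0) (simp add: dihedral_group_def)
  next
    case (Suc k)
    then show ?case by (simp add: D.nat_pow_Suc) (simp add: dihedral_group_def mod_simps add.commute)
  qed
  have one: "\<one>\<^bsub>?D\<^esub> = (0, False)" by (simp add: dihedral_group_def)
  have "(1, False) [^]\<^bsub>?D\<^esub> k = \<one>\<^bsub>?D\<^esub> \<longleftrightarrow> 4 dvd k" for k :: nat
    unfolding pow one by auto presburger+
  then have ord: "D.ord (1, False) = 4" by (rule D.ord_eq_if_pow_eq_one_iff[OF a])
  have "pc_relations ?D (1, False) \<one>\<^bsub>?D\<^esub> (0, True) (D.ord (1, False)) 1 2 (3, 0) (0, 1) (0, 0)"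
  proof (rule D.pc_relations_metacyclicI[OF _ a x two_is_prime_nat])
    show "finite (carrier ?D)" by (simp add: dihedral_group_def)
    show "(0, True) \<noteq> (1, False) [^]\<^bsub>?D\<^esub> i" for i :: nat unfolding pow by simp
    show "(0, True) \<otimes>\<^bsub>?D\<^esub> (1, False) = (1, False) [^]\<^bsub>?D\<^esub> (3::nat) \<otimes>\<^bsub>?D\<^esub> (0, True)"
      unfolding pow by (simp add: dihedral_group_def)
    have "(0, True) \<otimes>\<^bsub>?D\<^esub> (0, True) = \<one>\<^bsub>?D\<^esub>" by (simp add: dihedral_group_def)
    then show "(0, True) [^]\<^bsub>?D\<^esub> (2::nat) = (1, False) [^]\<^bsub>?D\<^esub> (0::nat)"
      using x by (simp add: numeral_2_eq_2 D.nat_pow_Suc)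
  qed
  then show ?thesis unfolding ord by (rule has_pc_presentationI) (simp add: order_dihedral_group)
qed

lemma pc_presentation_quaternion_group:
  "has_pc_presentation quaternion_group 4 1 2 (3, 0) (0, 1) (2, 0)"
proof -
  let ?Q = quaternion_group
  interpret Q: group ?Q by (rule group_quaternion_group)
  have a: "(1, Qi) \<in> carrier ?Q" and x: "(1, Qj) \<in> carrier ?Q" by (simp_all add: quaternion_group_def)
  have one: "\<one>\<^bsub>?Q\<^esub> = (1, Q1)" by (simp add: quaternion_group_def)
  have mult: "(\<epsilon>, u) \<otimes>\<^bsub>?Q\<^esub> (\<delta>, v) = (\<epsilon> * \<delta> * fst (quat_unit_mult u v), snd (quat_unit_mult u v))" for \<epsilon> \<delta> u v
    by (simp add: quaternion_group_def)
  have p2: "(1, Qi) [^]\<^bsub>?Q\<^esub> (2::nat) = (-1, Q1)" and p3: "(1, Qi) [^]\<^bsub>?Q\<^esub> (3::nat) = (-1, Qi)"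
    and p4: "(1, Qi) [^]\<^bsub>?Q\<^esub> (4::nat) = \<one>\<^bsub>?Q\<^esub>"
    by (simp_all add: numeral_eq_Suc Q.nat_pow_Suc Q.nat_pow_0 one mult)
  have "Q.ord (1, Qi) dvd 2 ^ 2" using p4 Q.pow_eq_id[OF a] by simp
  then obtain i where i: "Q.ord (1, Qi) = 2 ^ i" "i \<le> 2"
    using divides_primepow_nat[OF two_is_prime_nat] by blast
  have "\<not> Q.ord (1, Qi) dvd 2" using p2 one Q.pow_eq_id[OF a, of 2] by simp
  moreover have "i = 0 \<or> i = 1 \<or> i = 2" using i(2) by linarith
  ultimately have ord: "Q.ord (1, Qi) = 4" using i(1) by auto
  have "pc_relations ?Q (1, Qi) \<one>\<^bsub>?Q\<^esub> (1, Qj) (Q.ord (1, Qi)) 1 2 (3, 0) (0, 1) (2, 0)"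
  proof (rule Q.pc_relations_metacyclicI[OF _ a x two_is_prime_nat])
    show "finite (carrier ?Q)" using order_quaternion_group by (metis card_ge_0_finite order_def zero_less_numeral)
    show "(1, Qj) \<noteq> (1, Qi) [^]\<^bsub>?Q\<^esub> i" for i :: nat
    proof -
      have "snd ((1, Qi) [^]\<^bsub>?Q\<^esub> i) \<in> {Q1, Qi}"
      proof (induction i)
        case (Suc i)
        obtain \<epsilon> u where "(1, Qi) [^]\<^bsub>?Q\<^esub> i = (\<epsilon>, u)" by (metis surj_pair)
        then show ?case using Suc by (auto simp: Q.nat_pow_Suc mult)
      qed (simp add: Q.nat_pow_0 one)
      then show ?thesis by (metis insertE quat_unit.distinct singletonD snd_conv)
    qed
    show "(1, Qj) \<otimes>\<^bsub>?Q\<^esub> (1, Qi) = (1, Qi) [^]\<^bsub>?Q\<^esub> (3::nat) \<otimes>\<^bsub>?Q\<^esub> (1, Qj)"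
      unfolding p3 mult by simp
    show "(1, Qj) [^]\<^bsub>?Q\<^esub> (2::nat) = (1, Qi) [^]\<^bsub>?Q\<^esub> (2::nat)"
      unfolding p2 by (simp add: numeral_2_eq_2 Q.nat_pow_Suc Q.nat_pow_0 one mult)
  qed
  then show ?thesis unfolding ord by (rule has_pc_presentationI) (simp add: order_quaternion_group)
qed

lemma pc_presentation_sym_group_3:
  "has_pc_presentation (sym_group 3) 3 1 2 (2, 0) (0, 1) (0, 0)"
proof -
  let ?S = "sym_group 3"
  interpret S: group ?S by (rule sym_group_is_group)
  \<comment> \<open>A transposition and a 3-cycle, the latter mapping 1 to 2, 2 to 3 and 3 to
    1.\<close>
  define x :: "nat \<Rightarrow> nat" where "x = transpose 1 2"
  define a :: "nat \<Rightarrow> nat" where "a = transpose 1 2 \<circ> transpose 2 3"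
  have mult: "p \<otimes>\<^bsub>?S\<^esub> q = p \<circ> q" for p q by (simp add: sym_group_def)
  have one: "\<one>\<^bsub>?S\<^esub> = id" by (simp add: sym_group_def)
  have t: "transpose 1 2 permutes {1..3::nat}" "transpose 2 3 permutes {1..3::nat}"
    by (auto intro!: permutes_swap_id)
  have aG: "a \<in> carrier ?S" and xG: "x \<in> carrier ?S"
    using t permutes_compose[OF t(2,1)] by (simp_all add: sym_group_def a_def x_def)
  have a2: "a [^]\<^bsub>?S\<^esub> (2::nat) = a \<circ> a" using aG by (simp add: numeral_2_eq_2 S.nat_pow_Suc mult one)
  have "a [^]\<^bsub>?S\<^esub> Suc 2 = a \<circ> a \<circ> a" unfolding S.nat_pow_Suc a2 mult ..
  also have "\<dots> = id" by (auto simp: a_def transpose_def fun_eq_iff)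
  finally have "a [^]\<^bsub>?S\<^esub> Suc 2 = \<one>\<^bsub>?S\<^esub>" unfolding one .
  moreover have "Suc 2 = 3" by simp
  ultimately have a3: "a [^]\<^bsub>?S\<^esub> (3::nat) = \<one>\<^bsub>?S\<^esub>" by metis
  have "a 1 = 2" by (simp add: a_def transpose_def)
  then have "a \<noteq> \<one>\<^bsub>?S\<^esub>" by (auto simp: one)
  moreover have "S.ord a dvd 3" using a3 S.pow_eq_id[OF aG] by simp
  moreover have "Factorial_Ring.prime (3::nat)" by (simp add: prime_nat_numeral_eq)
  ultimately have ord: "S.ord a = 3" using S.ord_eq_1[OF aG] by (metis prime_nat_iff)
  have "pc_relations ?S a \<one>\<^bsub>?S\<^esub> x (S.ord a) 1 2 (2, 0) (0, 1) (0, 0)"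
  proof (rule S.pc_relations_metacyclicI[OF _ aG xG two_is_prime_nat])
    show "finite (carrier ?S)" using order_sym_group_3 by (metis card_ge_0_finite order_def zero_less_numeral)
    show "x \<noteq> a [^]\<^bsub>?S\<^esub> i" for i :: nat
    proof -
      have "i mod 3 = 0 \<or> i mod 3 = 1 \<or> i mod 3 = 2" by linarith
      then have "a [^]\<^bsub>?S\<^esub> i = id \<or> a [^]\<^bsub>?S\<^esub> i = a \<or> a [^]\<^bsub>?S\<^esub> i = a \<circ> a"
        using S.pow_mod_eq[OF aG a3, of i] a2 aG one by (auto simp: mult)
      moreover have "x 3 = 3" "x 1 = 2" "a 3 = 1" "a 1 = 2" "(a \<circ> a) 3 = 2"
        by (simp_all add: a_def x_def transpose_def)
      ultimately show ?thesis by auto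
    qed
    show "x \<otimes>\<^bsub>?S\<^esub> a = a [^]\<^bsub>?S\<^esub> (2::nat) \<otimes>\<^bsub>?S\<^esub> x"
      unfolding a2 mult by (auto simp: a_def x_def transpose_def fun_eq_iff)
    have "x \<otimes>\<^bsub>?S\<^esub> x = \<one>\<^bsub>?S\<^esub>" unfolding mult one by (simp add: x_def)
    then show "x [^]\<^bsub>?S\<^esub> (2::nat) = a [^]\<^bsub>?S\<^esub> (0::nat)" using xG by (simp add: numeral_2_eq_2 S.nat_pow_Suc)
  qed
  then show ?thesis unfolding ord by (rule has_pc_presentationI) (simp add: order_sym_group_3)
qed

section \<open>Invariants that tell the listed groups apart\<close>

lemma elementary_cyclic_product_Nil: "elementary_2_group (cyclic_product [])"
  by (simp add: elementary_2_group_def)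

lemma elementary_cyclic_product_Cons:
  assumes n: "n > 0"
  shows "elementary_2_group (cyclic_product (n # ns)) \<longleftrightarrow> n \<le> 2 \<and> elementary_2_group (cyclic_product ns)"
proof
  interpret C: group "cyclic_product ns" by (rule group_cyclic_product)
  assume el: "elementary_2_group (cyclic_product (n # ns))"
  have sq: "(y + y) mod int n = 0 \<and> ys \<otimes>\<^bsub>cyclic_product ns\<^esub> ys = \<one>\<^bsub>cyclic_product ns\<^esub>"
    if "y \<in> carrier (integer_mod_group n)" "ys \<in> carrier (cyclic_product ns)" for y ys
  proof -
    have "(y # ys) \<otimes>\<^bsub>cyclic_product (n # ns)\<^esub> (y # ys) = \<one>\<^bsub>cyclic_product (n # ns)\<^esub>"
      using el that unfolding elementary_2_group_def by (meson cyclic_product_Cons_carrier)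
    then show ?thesis using that by simp
  qed
  have "n \<le> 2"
  proof (rule ccontr)
    assume "\<not> n \<le> 2"
    then show False using sq[of 1 "\<one>\<^bsub>cyclic_product ns\<^esub>"] by (simp add: carrier_integer_mod_group)
  qed
  moreover have "elementary_2_group (cyclic_product ns)"
    unfolding elementary_2_group_def using sq[of 0] n by (simp add: carrier_integer_mod_group)
  ultimately show "n \<le> 2 \<and> elementary_2_group (cyclic_product ns)" by blast
next
  assume h: "n \<le> 2 \<and> elementary_2_group (cyclic_product ns)"
  have sq: "(y + y) mod int n = 0" if "y \<in> carrier (integer_mod_group n)" for y
  proof -
    have "n = 1 \<or> n = 2" using h n by linarith
    then show ?thesis by auto
  qed
  have el: "ys \<otimes>\<^bsub>cyclic_product ns\<^esub> ys = \<one>\<^bsub>cyclic_product ns\<^esub>" if "ys \<in> carrier (cyclic_product ns)" for ys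
    using h that by (simp add: elementary_2_group_def)
  show "elementary_2_group (cyclic_product (n # ns))"
    unfolding elementary_2_group_def using sq el by auto
qed

lemma cyclic_product_commute:
  "x \<in> carrier (cyclic_product ns) \<Longrightarrow> y \<in> carrier (cyclic_product ns) \<Longrightarrow>
     x \<otimes>\<^bsub>cyclic_product ns\<^esub> y = y \<otimes>\<^bsub>cyclic_product ns\<^esub> x"
  by (induction ns arbitrary: x y) (auto simp: add.commute)

lemma iso_commute:
  assumes "G \<cong> H" and comm: "\<And>x y. x \<in> carrier G \<Longrightarrow> y \<in> carrier G \<Longrightarrow> x \<otimes>\<^bsub>G\<^esub> y = y \<otimes>\<^bsub>G\<^esub> x"
    and "u \<in> carrier H" "v \<in> carrier H"
  shows "u \<otimes>\<^bsub>H\<^esub> v = v \<otimes>\<^bsub>H\<^esub> u"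
proof -
  obtain f where f: "f \<in> hom G H" "f ` carrier G = carrier H"
    using assms(1) by (auto simp: is_iso_def iso_def bij_betw_def)
  then obtain x y where xy: "x \<in> carrier G" "y \<in> carrier G" "u = f x" "v = f y" using assms(3,4) by blast
  have "u \<otimes>\<^bsub>H\<^esub> v = f (x \<otimes>\<^bsub>G\<^esub> y)" unfolding xy(3,4) by (rule hom_mult[OF f(1) xy(1,2), symmetric])
  also have "x \<otimes>\<^bsub>G\<^esub> y = y \<otimes>\<^bsub>G\<^esub> x" by (rule comm[OF xy(1,2)])
  also have "f (y \<otimes>\<^bsub>G\<^esub> x) = v \<otimes>\<^bsub>H\<^esub> u" unfolding xy(3,4) by (rule hom_mult[OF f(1) xy(2,1)])
  finally show ?thesis .
qed

lemma cyclic_product_not_iso: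
  "\<not> cyclic_product ns \<cong> sym_group 3" "\<not> cyclic_product ns \<cong> dihedral_group 4"
  "\<not> cyclic_product ns \<cong> quaternion_group"
proof -
  show "\<not> cyclic_product ns \<cong> sym_group 3"
  proof
    assume iso: "cyclic_product ns \<cong> sym_group 3"
    have "transpose 1 2 \<in> carrier (sym_group 3)" "transpose 2 3 \<in> carrier (sym_group 3)"
      by (auto simp: sym_group_def intro!: permutes_swap_id)
    from iso_commute[OF iso cyclic_product_commute this]
    have "transpose 1 2 \<circ> transpose 2 3 = transpose 2 3 \<circ> transpose 1 (2::nat)"
      by (simp add: sym_group_def)
    then have "(transpose 1 2 \<circ> transpose 2 3) 1 = (transpose 2 3 \<circ> transpose 1 (2::nat)) 1" by (rule fun_cong)
    then show False by (simp add: transpose_def)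
  qed
  show "\<not> cyclic_product ns \<cong> dihedral_group 4"
  proof
    assume iso: "cyclic_product ns \<cong> dihedral_group 4"
    from iso_commute[OF iso cyclic_product_commute, of "(1, False)" "(0, True)"]
    show False by (simp add: dihedral_group_def)
  qed
  show "\<not> cyclic_product ns \<cong> quaternion_group"
  proof
    assume iso: "cyclic_product ns \<cong> quaternion_group"
    from iso_commute[OF iso cyclic_product_commute, of "(1, Qi)" "(1, Qj)"]
    show False by (simp add: quaternion_group_def)
  qed
qed

lemma iso_order: "G \<cong> H \<Longrightarrow> order G = order H"
  by (auto simp: is_iso_def iso_def order_def dest: bij_betw_same_card)

text \<open>The quaternion group has only one involution, \<open>-1\<close>, to which the central
  rotation of order 2 and a reflection would both have to be mapped.\<close>

lemma dihedral_group_4_not_iso_quaternion_group: "\<not> dihedral_group 4 \<cong> quaternion_group"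
proof
  let ?D = "dihedral_group 4" and ?Q = quaternion_group
  interpret D: group ?D by (rule group_dihedral_group) simp
  interpret Q: group ?Q by (rule group_quaternion_group)
  assume "?D \<cong> ?Q"
  then obtain f where f: "f \<in> hom ?D ?Q" "inj_on f (carrier ?D)"
    by (auto simp: is_iso_def iso_def bij_betw_def)
  have f1: "f \<one>\<^bsub>?D\<^esub> = \<one>\<^bsub>?Q\<^esub>" using f(1) D.is_group Q.is_group by (rule hom_one)
  have involution: "f d = (-1, Q1)" if d: "d \<in> carrier ?D" "d \<noteq> \<one>\<^bsub>?D\<^esub>" "d \<otimes>\<^bsub>?D\<^esub> d = \<one>\<^bsub>?D\<^esub>" for d
  proof -
    have "f d \<otimes>\<^bsub>?Q\<^esub> f d = \<one>\<^bsub>?Q\<^esub>" using hom_mult[OF f(1) d(1,1)] d(3) f1 by simp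
    moreover have "f d \<noteq> \<one>\<^bsub>?Q\<^esub>" using inj_onD[OF f(2), of d "\<one>\<^bsub>?D\<^esub>"] d(1,2) f1 by auto
    moreover have "f d \<in> carrier ?Q" using hom_carrier[OF f(1)] d(1) by blast
    moreover obtain \<epsilon> u where "f d = (\<epsilon>, u)" by (cases "f d")
    ultimately show ?thesis by (cases u) (auto simp: quaternion_group_def)
  qed
  have "f (2, False) = f (0, True)"
    using involution[of "(2, False)"] involution[of "(0, True)"] by (simp add: dihedral_group_def)
  then show False using inj_onD[OF f(2), of "(2, False)" "(0, True)"] by (simp add: dihedral_group_def)
qed

section \<open>Stability of C3 x C3\<close>

lemma pc_33_facts:
  "\<forall>g\<in>carrier (pc_monoid 3 3 1 (1, 0) (0, 1) (0, 0)). \<forall>h\<in>carrier (pc_monoid 3 3 1 (1, 0) (0, 1) (0, 0)).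
   let M = pc_monoid 3 3 1 (1, 0) (0, 1) (0, 0) in g \<otimes>\<^bsub>M\<^esub> (g \<otimes>\<^bsub>M\<^esub> g) = \<one>\<^bsub>M\<^esub> \<and> g \<otimes>\<^bsub>M\<^esub> h = h \<otimes>\<^bsub>M\<^esub> g"
  by code_simp

text \<open>If \<open>A\<close> contains \<open>\<one>\<close> and two independent elements \<open>g\<close>, \<open>h\<close>, then a packing containing \<open>\<one>\<close>
  is contained in \<open>\<langle>g h\<rangle>\<close>.\<close>

lemma stable_pc_33:
  assumes "group (pc_monoid 3 3 1 (1, 0) (0, 1) (0, 0))"
  shows "stable_group (pc_monoid 3 3 1 (1, 0) (0, 1) (0, 0))"
proof -
  define M where "M = pc_monoid 3 3 1 (1, 0) (0, 1) (0, 0)"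
  interpret group M using assms by (simp add: M_def)
  have fin: "finite (carrier M)" by (simp add: M_def pc_monoid_def)
  have cube: "g \<otimes>\<^bsub>M\<^esub> (g \<otimes>\<^bsub>M\<^esub> g) = \<one>\<^bsub>M\<^esub>" if "g \<in> carrier M" for g
    using pc_33_facts that unfolding M_def[symmetric] Let_def by blast
  have sep: "t = g \<otimes>\<^bsub>M\<^esub> h \<or> t = (g \<otimes>\<^bsub>M\<^esub> h) \<otimes>\<^bsub>M\<^esub> (g \<otimes>\<^bsub>M\<^esub> h)"
    if "g \<in> carrier M" "h \<in> carrier M" "g \<noteq> \<one>\<^bsub>M\<^esub>" "h \<noteq> \<one>\<^bsub>M\<^esub>" "h \<noteq> g" "h \<noteq> g \<otimes>\<^bsub>M\<^esub> g"
      "t \<in> carrier M" "separated M {\<one>\<^bsub>M\<^esub>, g, h} \<one>\<^bsub>M\<^esub> t" for g h t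
    using pc_33_separated[unfolded M_def[symmetric] Let_def, rule_format, OF that(1,2)] that by auto
  have pow3: "g [^]\<^bsub>M\<^esub> (3::nat) = \<one>\<^bsub>M\<^esub>" if "g \<in> carrier M" for g
    using cube[OF that] that by (simp add: numeral_3_eq_3 m_assoc)
  have ord: "ord g = 1 \<or> ord g = 3" if "g \<in> carrier M" for g
  proof -
    have "ord g dvd 3" using pow3[OF that] pow_eq_id[OF that] by blast
    moreover have "Factorial_Ring.prime (3::nat)" by (simp add: prime_nat_numeral_eq)
    ultimately show ?thesis using prime_nat_iff by blast
  qed
  have "stable_group M"
  proof (rule stable_groupI[OF fin])
    fix A assume A: "A \<subseteq> carrier M" "\<one>\<^bsub>M\<^esub> \<in> A"
    have A0: "A \<noteq> {}" using A(2) by blast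
    show "right_stable_subset M A"
    proof (cases "\<exists>g\<in>A. \<exists>h\<in>A. g \<noteq> \<one>\<^bsub>M\<^esub> \<and> h \<noteq> \<one>\<^bsub>M\<^esub> \<and> h \<noteq> g \<and> h \<noteq> g \<otimes>\<^bsub>M\<^esub> g")
      case True
      then obtain g h where gh: "g \<in> A" "h \<in> A" "g \<noteq> \<one>\<^bsub>M\<^esub>" "h \<noteq> \<one>\<^bsub>M\<^esub>" "h \<noteq> g" "h \<noteq> g \<otimes>\<^bsub>M\<^esub> g" by blast
      have ghM: "g \<in> carrier M" "h \<in> carrier M" using gh A by auto
      define s where "s = g \<otimes>\<^bsub>M\<^esub> h"
      have only: "t = s \<or> t = s \<otimes>\<^bsub>M\<^esub> s" if t: "t \<in> carrier M" "separated M A \<one>\<^bsub>M\<^esub> t" for t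
      proof -
        have "{\<one>\<^bsub>M\<^esub>, g, h} \<subseteq> A" using gh A(2) by blast
        then have "separated M {\<one>\<^bsub>M\<^esub>, g, h} \<one>\<^bsub>M\<^esub> t" using t(2) by (rule separated_antimono)
        then show ?thesis unfolding s_def by (rule sep[OF ghM gh(3-6) t(1)])
      qed
      show ?thesis
      proof (cases "\<exists>t\<in>carrier M. separated M A \<one>\<^bsub>M\<^esub> t")
        case no: False
        have "card B = (if \<exists>t\<in>carrier M. separated M A \<one>\<^bsub>M\<^esub> t then 2 else 1)" if "maximal_packing M (carrier M) A B" for B
          by (rule maximal_packing_card_le_2[OF subgroup_self A(1) A0 _ that]) (use no in blast)
        then show ?thesis by (rule right_stable_subset_if_stable_in_subgroup[OF fin subgroup_self A(1) A0])
      next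
        case ex: True
        have "card B = 3" if "maximal_packing M (carrier M) A B" for B
        proof (rule maximal_packing_card_eq_3[OF subgroup_self A(1) A0 ex _ _ that])
          \<comment> \<open>Translating the separated pair \<open>\<one>\<close>, \<open>t\<close>
            by \<open>t\<close> and by its square shows that \<open>\<one>\<close>, \<open>t\<close>
            and \<open>t \<otimes> t\<close> are pairwise separated, because \<open>t\<close> has
            cube \<open>\<one>\<close>.\<close>
          fix t assume t: "t \<in> carrier M" "separated M A \<one>\<^bsub>M\<^esub> t"
          have tt: "t \<otimes>\<^bsub>M\<^esub> t \<in> carrier M" using t by simp
          have "separated M A t (t \<otimes>\<^bsub>M\<^esub> t)"
            using separated_mult_right[OF A(1) one_closed t(1) t(1)] t by simp
          moreover have "separated M A \<one>\<^bsub>M\<^esub> (t \<otimes>\<^bsub>M\<^esub> t)"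
            using separated_mult_right[OF A(1) one_closed t(1) tt] t cube[OF t(1)] separated_sym[of M A] by simp
          ultimately show "\<exists>u\<in>carrier M. separated M A \<one>\<^bsub>M\<^esub> u \<and> separated M A t u" using tt by blast
        next
          fix t u v
          assume tuv: "t \<in> carrier M" "u \<in> carrier M" "v \<in> carrier M" "separated M A \<one>\<^bsub>M\<^esub> t"
            "separated M A \<one>\<^bsub>M\<^esub> u" "separated M A \<one>\<^bsub>M\<^esub> v" "separated M A t u" "separated M A t v"
          have "t \<noteq> u" "t \<noteq> v" using separated_irrefl[OF A0] tuv(7,8) by blast+
          then have "u = v" using only[OF tuv(1,4)] only[OF tuv(2,5)] only[OF tuv(3,6)] by blast
          then show "\<not> separated M A u v" using separated_irrefl[OF A0] by blast
        qed
        then show ?thesis by (rule right_stable_subset_if_stable_in_subgroup[OF fin subgroup_self A(1) A0])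
      qed
    next
      \<comment> \<open>Now \<open>A\<close> is contained in a cyclic subgroup of order at most 3,
        so it is \<open>{\<one>}\<close>, a pair, or that subgroup itself.\<close>
      case dep: False
      show ?thesis
      proof (cases "A = {\<one>\<^bsub>M\<^esub>}")
        case True
        then show ?thesis using right_stable_subset_pair[OF fin one_closed] by simp
      next
        case False
        then obtain g where g: "g \<in> A" "g \<noteq> \<one>\<^bsub>M\<^esub>" using A(2) by blast
        have gM: "g \<in> carrier M" using g A by blast
        have og: "ord g = 3" using ord[OF gM] ord_eq_1[OF gM] g(2) by blast
        have sub: "A \<subseteq> {\<one>\<^bsub>M\<^esub>, g, g \<otimes>\<^bsub>M\<^esub> g}" using dep g by blast
        show ?thesis
        proof (cases "g \<otimes>\<^bsub>M\<^esub> g \<in> A")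
          case False
          then have "A = {\<one>\<^bsub>M\<^esub>, g}" using sub g A(2) by blast
          then show ?thesis using right_stable_subset_pair[OF fin gM] og by simp
        next
          case True
          then have "A = {\<one>\<^bsub>M\<^esub>, g, g \<otimes>\<^bsub>M\<^esub> g}" using sub g A(2) by blast
          moreover have "{..<3} = {0, 1, 2::nat}" by auto
          ultimately have "A = generate M {g}"
            using generate_singleton_eq[OF fin gM] og gM by (simp add: numeral_2_eq_2)
          then have K: "subgroup A M" using gM by (simp add: generate_is_subgroup)
          have no: "\<not> separated M A \<one>\<^bsub>M\<^esub> t" if "t \<in> A" for t
          proof -
            have "t \<otimes>\<^bsub>M\<^esub> \<one>\<^bsub>M\<^esub> = \<one>\<^bsub>M\<^esub> \<otimes>\<^bsub>M\<^esub> t" using that A by auto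
            then show ?thesis using that A(2) unfolding separated_def by blast
          qed
          have "card B = (if \<exists>t\<in>A. separated M A \<one>\<^bsub>M\<^esub> t then 2 else 1)" if "maximal_packing M A A B" for B
            by (rule maximal_packing_card_le_2[OF K subset_refl A0 _ that]) (use no in blast)
          then show ?thesis by (rule right_stable_subset_if_stable_in_subgroup[OF fin K subset_refl A0])
        qed
      qed
    qed
  qed
  then show ?thesis by (simp add: M_def)
qed

section \<open>Matching stable groups with the list\<close>

text \<open>The nine listed groups that are not elementary abelian 2-groups: \<open>C3 x C3\<close>,
  \<open>C3\<close>, \<open>C4\<close>, \<open>C4 x C2\<close>, \<open>C5\<close>,
  \<open>C7\<close>, \<open>S3\<close>, \<open>D4\<close>, \<open>Q8\<close>. The parameter
  \<open>Q = (0, 1)\<close> is common to all and left out.\<close>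

definition stable_presentations :: "(nat \<times> nat \<times> nat \<times> (nat \<times> nat) \<times> (nat \<times> nat)) set" where
  "stable_presentations = {(3, 3, 1, (1, 0), (0, 0)), (3, 1, 1, (1, 0), (0, 0)), (4, 1, 1, (1, 0), (0, 0)), (4, 2, 1, (1, 0), (0, 0)),
     (5, 1, 1, (1, 0), (0, 0)), (7, 1, 1, (1, 0), (0, 0)), (3, 1, 2, (2, 0), (0, 0)),
     (4, 1, 2, (3, 0), (0, 0)), (4, 1, 2, (3, 0), (2, 0))}"

lemma stable_if_presentation:
  assumes "group G" "has_pc_presentation G l m n P (0, 1) C" "(l, m, n, P, C) \<in> stable_presentations"
  shows "stable_group G"
proof -
  let ?M = "pc_monoid l m n P (0, 1) C"
  obtain a b x where rel: "pc_relations G a b x l m n P (0, 1) C" and ord: "order G = l * m * n"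
    using assms(2) by (auto simp: has_pc_presentation_def)
  have M: "group ?M" by (rule group.pc_embedding(3)[OF assms(1) rel])
  have fin: "finite (carrier ?M)" by (simp add: pc_monoid_def)
  have "stable_group ?M"
  proof (cases "(l, m, n, P, C) = (3, 3, 1, (1, 0), (0, 0))")
    case True
    then show ?thesis using stable_pc_33 M by simp
  next
    case False
    have mem: "(l, m, n, P, C) \<in> {(3, 1, 1, (1, 0), (0, 0)), (4, 1, 1, (1, 0), (0, 0)), (4, 2, 1, (1, 0), (0, 0)),
     (5, 1, 1, (1, 0), (0, 0)), (7, 1, 1, (1, 0), (0, 0)), (3, 1, 2, (2, 0), (0, 0)),
     (4, 1, 2, (3, 0), (0, 0)), (4, 1, 2, (3, 0), (2, 0))}"
      by (rule insertE[OF assms(3)[unfolded stable_presentations_def]]) (use False in simp)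
    have "stable_check ?M" using bspec[OF stable_check_pc mem] by (simp only: prod.case)
    then show ?thesis by (rule group.stable_group_if_check[OF M fin])
  qed
  then show ?thesis using stable_group_iso[OF M assms(1) fin _ group.pc_iso[OF assms(1) rel ord]] by blast
qed

lemma iso_if_same_presentation:
  assumes "group G" "group H" "has_pc_presentation G l m n P Q C" "has_pc_presentation H l m n P Q C"
  shows "G \<cong> H"
proof -
  obtain a b x where G: "pc_relations G a b x l m n P Q C" "order G = l * m * n"
    using assms(3) unfolding has_pc_presentation_def by blast
  obtain a' b' x' where H: "pc_relations H a' b' x' l m n P Q C" "order H = l * m * n"
    using assms(4) unfolding has_pc_presentation_def by blast
  show ?thesis by (rule pc_unique[OF assms(1,2) G H])
qed

lemma stable_presentation_exI:
  "has_pc_presentation G l m n P (0, 1) C \<Longrightarrow> (l, m, n, P, C) \<in> stable_presentations \<Longrightarrow>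
     \<exists>(l, m, n, P, C) \<in> stable_presentations. has_pc_presentation G l m n P (0, 1) C"
  by (rule bexI[of _ "(l, m, n, P, C)"]) simp_all

text \<open>A 2-group that is not elementary has an element of order 4, which bounds the order by
  8.\<close>

lemma (in group) stable_2_group_cases:
  assumes st: "stable_group G" and fin: "finite (carrier G)" and ord: "order G = 2 ^ k"
  shows "elementary_2_group G \<and> k \<le> 4 \<or>
    (\<exists>(l, m, n, P, C) \<in> stable_presentations. has_pc_presentation G l m n P (0, 1) C)"
proof (cases "elementary_2_group G")
  case True
  have "\<not> 5 \<le> k" using not_stable_elementary[OF fin True ord] st by blast
  then have "k \<le> 4" by linarith
  then show ?thesis using True by blast
next
  case False
  then obtain g where g: "g \<in> carrier G" "g \<otimes> g \<noteq> \<one>" by (auto simp: elementary_2_group_def)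
  then have "g \<noteq> \<one>" by auto
  then have "ord g \<noteq> 1" "ord g \<noteq> 2" using ord_eq_1[OF g(1)] ord_2_iff[OF g(1)] g(2) by auto
  then have og: "ord g = 4" using pow_4_two_group(2)[OF st fin ord g(1)] by blast
  have k4: "k < 4" using not_stable_large_2_group[OF fin ord _ g(1) og] st by (meson not_le)
  have "4 \<le> (2::nat) ^ k" using ord_dvd_group_order[OF g(1)] og ord by (simp add: dvd_imp_le)
  have "\<not> k \<le> 1"
  proof
    assume "k \<le> 1"
    then have "k = 0 \<or> k = 1" by linarith
    then show False using \<open>4 \<le> (2::nat) ^ k\<close> by auto
  qed
  then consider "k = 2" | "k = 3" using k4 by linarith
  then show ?thesis
  proof cases
    case 1
    then have "has_pc_presentation G 4 1 1 (1, 0) (0, 1) (0, 0)"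
      using pc_presentation_cyclic[OF fin g(1)] og ord by simp
    then show ?thesis by (intro disjI2 stable_presentation_exI, assumption) (simp add: stable_presentations_def)
  next
    case 2
    then have "order G = 8" using ord by simp
    from pc_presentation_order_8[OF st fin this g(1) og] show ?thesis
    proof (elim disjE)
      assume "has_pc_presentation G 4 2 1 (1, 0) (0, 1) (0, 0)"
      then show ?thesis
        by (intro disjI2 stable_presentation_exI, assumption) (simp add: stable_presentations_def)
    next
      assume "has_pc_presentation G 4 1 2 (3, 0) (0, 1) (0, 0)"
      then show ?thesis
        by (intro disjI2 stable_presentation_exI, assumption) (simp add: stable_presentations_def)
    next
      assume "has_pc_presentation G 4 1 2 (3, 0) (0, 1) (2, 0)"
      then show ?thesis
        by (intro disjI2 stable_presentation_exI, assumption) (simp add: stable_presentations_def)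
    qed
  qed
qed

lemma (in group) pc_presentation_prime_order:
  assumes "finite (carrier G)" "order G = p" "Factorial_Ring.prime p"
  shows "has_pc_presentation G p 1 1 (1, 0) (0, 1) (0, 0)"
proof -
  obtain y where y: "y \<in> carrier G" "ord y = p"
    using element_of_prime_order[OF assms(1,3)] assms(2) by auto
  show ?thesis using pc_presentation_cyclic[OF assms(1) y(1)] y(2) assms(2) by simp
qed

lemma (in group) stable_order_9:
  assumes st: "stable_group G" and fin: "finite (carrier G)" and ord: "order G = 9"
  shows "has_pc_presentation G 3 3 1 (1, 0) (0, 1) (0, 0)"
proof -
  have o: "order G = 3 ^ 2" using ord by simp
  have p3: "Factorial_Ring.prime (3::nat)" by (simp add: prime_nat_numeral_eq)
  show ?thesis
  proof (rule commuting_pair[OF st fin o p3])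
    fix z a
    assume za: "z \<in> carrier G" "ord z = 3" "a \<in> carrier G" "ord a = 3"
      "\<And>g. g \<in> carrier G \<Longrightarrow> g \<otimes> z = z \<otimes> g"
      "\<And>(i::nat) (j::nat). z [^] i \<otimes> a [^] j = \<one> \<Longrightarrow> ord z dvd i \<and> ord a dvd j"
    have "pc_relations G z a \<one> (ord z) (ord a) 1 (1, 0) (0, 1) (0, 0)"
      by (rule pc_relations_abelianI[OF fin za(1,3) za(5)[OF za(3), symmetric] za(6)])
    then show ?thesis unfolding za(2,4) by (rule has_pc_presentationI) (simp add: ord)
  qed simp_all
qed

text \<open>An involution and an element of order 3 cannot commute in a stable group. The involution
  normalizes the subgroup of index 2 generated by the other element, so it inverts it.\<close>

lemma (in group) stable_order_6:
  assumes st: "stable_group G" and fin: "finite (carrier G)" and ord: "order G = 6"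
  shows "has_pc_presentation G 3 1 2 (2, 0) (0, 1) (0, 0)"
proof -
  have p3: "Factorial_Ring.prime (3::nat)" by (simp add: prime_nat_numeral_eq)
  obtain a where a: "a \<in> carrier G" "ord a = 3" using element_of_prime_order[OF fin p3] ord by auto
  obtain y where y: "y \<in> carrier G" "ord y = 2" using element_of_prime_order[OF fin two_is_prime_nat] ord by auto
  have nc: "y \<otimes> a \<noteq> a \<otimes> y"
    using no_mixed_commuting[OF st fin y(1) a(1)] y(2) a(2) p3 by auto
  have yn: "y \<noteq> a [^] i" for i :: nat
  proof
    assume "y = a [^] i"
    moreover have "a [^] i \<otimes> a = a \<otimes> a [^] i" using nat_pow_Suc2[OF a(1), of i] by simp
    ultimately show False using nc by blast
  qed
  have D: "subgroup (generate G {a}) G" using a by (simp add: generate_is_subgroup)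
  have "card (carrier G) \<le> 2 * card (generate G {a})" using generate_pow_card[OF a(1)] a(2) ord by (simp add: order_def)
  from index_2_normalizes[OF fin D subgroup_self subgroup.subset[OF D] this y(1)]
  have "normalizes G y (generate G {a})" .
  moreover have "a \<in> generate G {a}" by (simp add: generate.incl)
  ultimately have "y \<otimes> a \<otimes> inv y \<in> generate G {a}" by (simp add: normalizes_def)
  then obtain i :: nat where i: "y \<otimes> a \<otimes> inv y = a [^] i" "i < 3"
    unfolding generate_singleton_eq[OF fin a(1)] a(2) by blast
  have "y \<otimes> a = y \<otimes> a \<otimes> inv y \<otimes> y" using y(1) a(1) by (simp add: m_assoc)
  then have ya: "y \<otimes> a = a [^] i \<otimes> y" unfolding i(1) .
  have "i \<noteq> 0"
  proof
    assume "i = 0"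
    then have "y \<otimes> a = y" using ya y(1) by simp
    then have "a = \<one>" using y(1) a(1) by (metis l_cancel_one')
    then show False using a(2) by simp
  qed
  moreover have "i \<noteq> 1" using ya nc a(1) by auto
  ultimately have "i = 2" using i(2) by linarith
  then have ya2: "y \<otimes> a = a [^] (2::nat) \<otimes> y" using ya by simp
  have y2: "y [^] (2::nat) = a [^] (0::nat)" using pow_ord_eq_1[OF y(1)] y(2) by simp
  have "pc_relations G a \<one> y (ord a) 1 2 (2, 0) (0, 1) (0, 0)"
    by (rule pc_relations_metacyclicI[OF fin a(1) y(1) two_is_prime_nat yn ya2 y2])
  then show ?thesis unfolding a(2) by (rule has_pc_presentationI) (simp add: ord)
qed

lemma (in group) stable_group_cases:
  assumes st: "stable_group G" and fin: "finite (carrier G)"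
  shows "(\<exists>k\<le>4. elementary_2_group G \<and> order G = 2 ^ k) \<or>
    (\<exists>(l, m, n, P, C) \<in> stable_presentations. has_pc_presentation G l m n P (0, 1) C)"
  using stable_order_cases[OF st fin]
proof
  assume "order G = 6"
  from stable_order_6[OF st fin this] show ?thesis
    by (intro disjI2 stable_presentation_exI, assumption) (simp add: stable_presentations_def)
next
  assume "\<exists>p k. Factorial_Ring.prime p \<and> order G = p ^ k"
  then obtain p k where p: "Factorial_Ring.prime p" and ord: "order G = p ^ k" by blast
  show ?thesis
  proof (cases "k = 0")
    case True
    then have o1: "order G = 1" using ord by simp
    then have "carrier G = {\<one>}" by (simp only: order_one_triv_iff)
    then have "elementary_2_group G" by (simp add: elementary_2_group_def)
    then have "elementary_2_group G \<and> order G = 2 ^ 0" using o1 by simp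
    then show ?thesis by blast
  next
    case k0: False
    then have "p dvd order G" using ord by simp
    then consider "p = 2" | "p = 3" | "p = 5 \<or> p = 7" using stable_prime_divisor[OF st fin p] by blast
    then show ?thesis
    proof cases
      case 1
      then show ?thesis using stable_2_group_cases[OF st fin] ord by blast
    next
      case 2
      then have "k \<le> 2" using stable_3_group[OF st fin] ord by blast
      then consider "k = 1" | "k = 2" using k0 by linarith
      then show ?thesis
      proof cases
        case 1
        then have "order G = 3" using \<open>p = 3\<close> ord by simp
        then have "has_pc_presentation G 3 1 1 (1, 0) (0, 1) (0, 0)"
          using pc_presentation_prime_order[OF fin] p \<open>p = 3\<close> by blast
        then show ?thesis by (intro disjI2 stable_presentation_exI, assumption) (simp add: stable_presentations_def)
      next
        case 2
        then have "order G = 9" using \<open>p = 3\<close> ord by simp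
        from stable_order_9[OF st fin this] show ?thesis
          by (intro disjI2 stable_presentation_exI, assumption) (simp add: stable_presentations_def)
      qed
    next
      case 3
      then have "k \<le> 1" using stable_5_or_7_group[OF st fin ord] by blast
      then have "order G = p" using k0 ord by (cases k) auto
      then have "has_pc_presentation G p 1 1 (1, 0) (0, 1) (0, 0)"
        using pc_presentation_prime_order[OF fin _ p] by blast
      then show ?thesis
        by (intro disjI2 stable_presentation_exI, assumption) (use 3 in \<open>auto simp: stable_presentations_def\<close>)
    qed
  qed
qed

lemma presentation_cases:
  assumes "(l, m, n, P, C) \<in> stable_presentations"
  obtains ns where "ns \<in> {[3], [3, 3], [4], [2, 4], [5], [7]}"
      "has_pc_presentation (cyclic_product ns) l m n P (0, 1) C"
  | "has_pc_presentation (sym_group 3) l m n P (0, 1) C"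
  | "has_pc_presentation (dihedral_group 4) l m n P (0, 1) C"
  | "has_pc_presentation quaternion_group l m n P (0, 1) C"
proof -
  note single = pc_presentation_cyclic_product_single and pair = pc_presentation_cyclic_product_pair
  show thesis
    using assms unfolding stable_presentations_def
  proof (elim insertE emptyE)
    assume "(l, m, n, P, C) = (3, 3, 1, (1, 0), (0, 0))"
    then show thesis using that(1)[of "[3, 3]"] pair[of 3 3] by simp
  next
    assume "(l, m, n, P, C) = (3, 1, 1, (1, 0), (0, 0))"
    then show thesis using that(1)[of "[3]"] single[of 3] by simp
  next
    assume "(l, m, n, P, C) = (4, 1, 1, (1, 0), (0, 0))"
    then show thesis using that(1)[of "[4]"] single[of 4] by simp
  next
    assume "(l, m, n, P, C) = (4, 2, 1, (1, 0), (0, 0))"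
    then show thesis using that(1)[of "[2, 4]"] pair[of 4 2] by simp
  next
    assume "(l, m, n, P, C) = (5, 1, 1, (1, 0), (0, 0))"
    then show thesis using that(1)[of "[5]"] single[of 5] by simp
  next
    assume "(l, m, n, P, C) = (7, 1, 1, (1, 0), (0, 0))"
    then show thesis using that(1)[of "[7]"] single[of 7] by simp
  next
    assume "(l, m, n, P, C) = (3, 1, 2, (2, 0), (0, 0))"
    then show thesis using that(2) pc_presentation_sym_group_3 by simp
  next
    assume "(l, m, n, P, C) = (4, 1, 2, (3, 0), (0, 0))"
    then show thesis using that(3) pc_presentation_dihedral_group_4 by simp
  next
    assume "(l, m, n, P, C) = (4, 1, 2, (3, 0), (2, 0))"
    then show thesis using that(4) pc_presentation_quaternion_group by simp
  qed
qed

lemma elementary_2_groups_iso: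
  assumes "group G" "group H" "order G = 2 ^ k" "order H = 2 ^ k" "elementary_2_group G" "elementary_2_group H"
  shows "G \<cong> H"
  using iso_trans[OF elementary_2_group_iso[OF assms(1,3,5)]
      group.iso_sym[OF assms(2) elementary_2_group_iso[OF assms(2,4,6)]]] .

lemma set_abelian_stable_list:
  "set abelian_stable_list = cyclic_product ` ({[1], [2], [2, 2], [2, 2, 2], [2, 2, 2, 2]} \<union>
     {[3], [3, 3], [4], [2, 4], [5], [7]})"
  unfolding abelian_stable_list_def set_map by (rule arg_cong[of _ _ "image cyclic_product"]) auto

lemma elementary_stable_list:
  assumes "ns \<in> {[1], [2], [2, 2], [2, 2, 2], [2, 2, 2, 2::nat]}"
  shows "elementary_2_group (cyclic_product ns)" "0 \<notin> set ns" "prod_list ns \<le> 16"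
  using assms by (auto simp: elementary_cyclic_product_Cons elementary_cyclic_product_Nil)

lemma stable_abelian_stable_list:
  assumes "H \<in> set abelian_stable_list"
  shows "stable_group H"
proof -
  obtain ns where H: "H = cyclic_product ns"
    and ns: "ns \<in> {[1], [2], [2, 2], [2, 2, 2], [2, 2, 2, 2]} \<or> ns \<in> {[3], [3, 3], [4], [2, 4], [5], [7]}"
    using assms unfolding set_abelian_stable_list by blast
  note gr = group_cyclic_product[of ns]
  have pres: "stable_group (cyclic_product ns)"
    if "has_pc_presentation (cyclic_product ns) l m n P (0, 1) C" "(l, m, n, P, C) \<in> stable_presentations" for l m n P C
    by (rule stable_if_presentation[OF gr that])
  note single = pc_presentation_cyclic_product_single and pair = pc_presentation_cyclic_product_pair
  show ?thesis
    unfolding H using ns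
  proof
    assume "ns \<in> {[1], [2], [2, 2], [2, 2, 2], [2, 2, 2, 2]}"
    note el = elementary_stable_list[OF this]
    show "stable_group (cyclic_product ns)"
      using group.elementary_stable[OF gr finite_cyclic_product[OF el(2)] el(1)] order_cyclic_product[OF el(2)] el(3) by simp
  next
    assume "ns \<in> {[3], [3, 3], [4], [2, 4], [5], [7]}"
    then show "stable_group (cyclic_product ns)"
    proof (elim insertE emptyE)
      assume "ns = [3]"
      then show ?thesis using pres[of 3 1 1 "(1, 0)" "(0, 0)"] single[of 3] by (simp add: stable_presentations_def)
    next
      assume "ns = [3, 3]"
      then show ?thesis using pres[of 3 3 1 "(1, 0)" "(0, 0)"] pair[of 3 3] by (simp add: stable_presentations_def)
    next
      assume "ns = [4]"
      then show ?thesis using pres[of 4 1 1 "(1, 0)" "(0, 0)"] single[of 4] by (simp add: stable_presentations_def)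
    next
      assume "ns = [2, 4]"
      then show ?thesis using pres[of 4 2 1 "(1, 0)" "(0, 0)"] pair[of 4 2] by (simp add: stable_presentations_def)
    next
      assume "ns = [5]"
      then show ?thesis using pres[of 5 1 1 "(1, 0)" "(0, 0)"] single[of 5] by (simp add: stable_presentations_def)
    next
      assume "ns = [7]"
      then show ?thesis using pres[of 7 1 1 "(1, 0)" "(0, 0)"] single[of 7] by (simp add: stable_presentations_def)
    qed
  qed
qed

text \<open>The order alone identifies \<open>C4\<close> with \<open>C2 x C2\<close> and
  \<open>C2 x C4\<close> with \<open>C2 x C2 x C2\<close>. Together with the property that all
  squares are trivial it separates all eleven groups.\<close>

lemma abelian_stable_list_not_iso:
  assumes ij: "i < length abelian_stable_list" "j < length abelian_stable_list" "i \<noteq> j"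
  shows "\<not> abelian_stable_list ! i \<cong> abelian_stable_list ! j"
proof
  let ?L = abelian_stable_list and ?\<kappa> = "\<lambda>H :: int list monoid. (order H, elementary_2_group H)"
  assume iso: "?L ! i \<cong> ?L ! j"
  have "map ?\<kappa> ?L = [(1, True), (2, True), (4, True), (8, True), (16, True), (3, False), (9, False), (4, False),
      (8, False), (5, False), (7, False)]"
    by (simp add: abelian_stable_list_def order_cyclic_product elementary_cyclic_product_Cons elementary_cyclic_product_Nil)
  then have "distinct (map ?\<kappa> ?L)" by simp
  from nth_eq_iff_index_eq[OF this, of i j] have "?\<kappa> (?L ! i) \<noteq> ?\<kappa> (?L ! j)"
    unfolding length_map using ij by (simp only: nth_map simp_thms)
  have group: "group H" if "H \<in> set ?L" for H
    using that group_cyclic_product unfolding abelian_stable_list_def set_map by (elim imageE) simp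
  have gr: "group (?L ! i)" "group (?L ! j)" 
    by (rule group[OF nth_mem[OF ij(1)]], rule group[OF nth_mem[OF ij(2)]])
  have "elementary_2_group (?L ! i) = elementary_2_group (?L ! j)"
    using elementary_2_group_hom_image[OF gr iso] elementary_2_group_hom_image[OF gr(2,1) group.iso_sym[OF gr(1) iso]] by blast
  moreover have "order (?L ! i) = order (?L ! j)" by (rule iso_order[OF iso])
  ultimately show False using \<open>?\<kappa> (?L ! i) \<noteq> ?\<kappa> (?L ! j)\<close> by simp
qed

theorem theorem16:
  fixes G :: "('a, 'b) monoid_scheme"
  assumes "group G" and "finite (carrier G)"
  shows "(stable_group G \<longleftrightarrow>
            (\<exists>H \<in> set abelian_stable_list. G \<cong> H) \<or>
            G \<cong> sym_group 3 \<or> G \<cong> dihedral_group 4 \<or> G \<cong> quaternion_group) \<and>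
         (\<forall>i < length abelian_stable_list. \<forall>j < length abelian_stable_list.
            i \<noteq> j \<longrightarrow> \<not> abelian_stable_list ! i \<cong> abelian_stable_list ! j) \<and>
         (\<forall>H \<in> set abelian_stable_list.
            \<not> H \<cong> sym_group 3 \<and> \<not> H \<cong> dihedral_group 4 \<and> \<not> H \<cong> quaternion_group) \<and>
         \<not> sym_group 3 \<cong> dihedral_group 4 \<and>
         \<not> sym_group 3 \<cong> quaternion_group \<and>
         \<not> dihedral_group 4 \<cong> quaternion_group"
proof (intro conjI)
  have gD: "group (dihedral_group 4)" by (rule group_dihedral_group) simp
  note gS = sym_group_is_group[of 3] and gQ = group_quaternion_group
  show "stable_group G \<longleftrightarrow> (\<exists>H \<in> set abelian_stable_list. G \<cong> H) \<or>
      G \<cong> sym_group 3 \<or> G \<cong> dihedral_group 4 \<or> G \<cong> quaternion_group"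
  proof
    assume "stable_group G"
    from group.stable_group_cases[OF assms(1) this assms(2)]
    show "(\<exists>H \<in> set abelian_stable_list. G \<cong> H) \<or> G \<cong> sym_group 3 \<or> G \<cong> dihedral_group 4 \<or> G \<cong> quaternion_group"
    proof
      assume "\<exists>k\<le>4. elementary_2_group G \<and> order G = 2 ^ k"
      then obtain k where k: "k \<le> 4" "elementary_2_group G" "order G = 2 ^ k" by blast
      have "k = 0 \<or> k = 1 \<or> k = 2 \<or> k = 3 \<or> k = 4" using k(1) by linarith
      then have "\<exists>ns \<in> {[1], [2], [2, 2], [2, 2, 2], [2, 2, 2, 2]}. prod_list ns = (2::nat) ^ k"
        by (elim disjE) simp_all
      then obtain ns where ns: "ns \<in> {[1], [2], [2, 2], [2, 2, 2], [2, 2, 2, 2]}" "prod_list ns = (2::nat) ^ k" by blast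
      note el = elementary_stable_list[OF ns(1)]
      have "order (cyclic_product ns) = 2 ^ k" using order_cyclic_product[OF el(2)] ns(2) by simp
      from elementary_2_groups_iso[OF assms(1) group_cyclic_product k(3) this k(2) el(1)]
      have "G \<cong> cyclic_product ns" .
      moreover have "cyclic_product ns \<in> set abelian_stable_list"
        unfolding set_abelian_stable_list by (rule imageI, rule UnI1, rule ns(1))
      ultimately show ?thesis by blast
    next
      assume "\<exists>(l, m, n, P, C) \<in> stable_presentations. has_pc_presentation G l m n P (0, 1) C"
      then obtain l m n P C where p: "(l, m, n, P, C) \<in> stable_presentations"
        and G: "has_pc_presentation G l m n P (0, 1) C" by auto
      note iso = iso_if_same_presentation[OF assms(1) _ G]
      show ?thesis
        using p
      proof (cases rule: presentation_cases)
        case (1 ns)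
        have "cyclic_product ns \<in> set abelian_stable_list"
          unfolding set_abelian_stable_list by (rule imageI, rule UnI2, rule 1(1))
        then show ?thesis using iso[OF group_cyclic_product 1(2)] by blast
      next
        case 2
        then show ?thesis using iso[OF gS] by blast
      next
        case 3
        then show ?thesis using iso[OF gD] by blast
      next
        case 4
        then show ?thesis using iso[OF gQ] by blast
      qed
    qed
  next
    have S: "stable_group (sym_group 3)"
      by (rule stable_if_presentation[OF gS pc_presentation_sym_group_3]) (simp add: stable_presentations_def)
    have D: "stable_group (dihedral_group 4)"
      by (rule stable_if_presentation[OF gD pc_presentation_dihedral_group_4]) (simp add: stable_presentations_def)
    have Q: "stable_group quaternion_group"
      by (rule stable_if_presentation[OF gQ pc_presentation_quaternion_group]) (simp add: stable_presentations_def)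
    note transfer = stable_group_iso[OF _ assms(1) iffD1[OF iso_finite assms(2)] _ group.iso_sym[OF assms(1)]]
    assume "(\<exists>H \<in> set abelian_stable_list. G \<cong> H) \<or> G \<cong> sym_group 3 \<or> G \<cong> dihedral_group 4 \<or> G \<cong> quaternion_group"
    then show "stable_group G"
    proof (elim disjE bexE)
      fix H assume H: "H \<in> set abelian_stable_list" "G \<cong> H"
      then have "group H" unfolding set_abelian_stable_list using group_cyclic_product by blast
      then show ?thesis using transfer[OF _ H(2) _ H(2)] stable_abelian_stable_list[OF H(1)] by blast
    next
      assume "G \<cong> sym_group 3"
      then show ?thesis by (intro transfer[OF gS _ S])
    next
      assume "G \<cong> dihedral_group 4"
      then show ?thesis by (intro transfer[OF gD _ D])
    next
      assume "G \<cong> quaternion_group"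
      then show ?thesis by (intro transfer[OF gQ _ Q])
    qed
  qed
  show "\<forall>i < length abelian_stable_list. \<forall>j < length abelian_stable_list.
      i \<noteq> j \<longrightarrow> \<not> abelian_stable_list ! i \<cong> abelian_stable_list ! j"
    using abelian_stable_list_not_iso by blast
  show "\<forall>H \<in> set abelian_stable_list. \<not> H \<cong> sym_group 3 \<and> \<not> H \<cong> dihedral_group 4 \<and> \<not> H \<cong> quaternion_group"
    unfolding set_abelian_stable_list using cyclic_product_not_iso by blast
  show "\<not> sym_group 3 \<cong> dihedral_group 4" "\<not> sym_group 3 \<cong> quaternion_group"
    using iso_order[of "sym_group 3" "dihedral_group 4"] iso_order[of "sym_group 3" quaternion_group]
    by (auto simp: order_sym_group_3 order_dihedral_group order_quaternion_group)
qed (rule dihedral_group_4_not_iso_quaternion_group)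

end
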